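(* The identity map is the only graded algebra automorphism $\varphi$ of $\mathrm{QSym}$ that preserves the quasisymmetric Schur basis, i.e. such that $\varphi(\{\mathcal{S}_\alpha:\alpha\in\mathcal{C}\})=\{\mathcal{S}_\alpha:\alpha\in\mathcal{C}\}$.
   Context: A composition is a finite (possibly empty) ordered list $\alpha=(\alpha_1,\dots,\alpha_k)$ of positive integers; $|\alpha|=\alpha_1+\cdots+\alpha_k$, and $\mathcal{C}$ is the set of all compositions ($\emptyset$ is the empty one). $\mathrm{QSym}=\bigoplus_{n\ge0}\mathrm{QSym}_n$ is the graded subalgebra of $\mathbb{Q}[[x_1,x_2,\dots]]$ of bounded-degree formal power series $f$ such that for each composition $(\alpha_1,\dots,\alpha_k)$ all monomials $x_{i_1}^{\alpha_1}\cdots x_{i_k}^{\alpha_k}$ with $i_1<\cdots<i_k$ have the same coefficient in $f$; $\mathrm{QSym}_n$ is the subspace of elements homogeneous of degree $n$. A map is graded if it maps $\mathrm{QSym}_n$ into $\mathrm{QSym}_n$ for all $n$. Quasisymmetric Schur functions: the reverse composition diagram of $\alpha=(\alpha_1,\dots,\alpha_k)$ is the left-justified array with $\alpha_i$ cells in row $i$ (rows numbered from top to bottom, columns from left to right); $(i,j)$ denotes the cell in row $i$, column $j$. A semistandard reverse composition tableau (SSRCT) of shape $\alpha$ is a filling $\tau$ of the cells of $\alpha$ with positive integers such that (1) entries in each row weakly decrease from left to right; (2) entries in the first column strictly increase from top to bottom; (3) if $i<j$, $(i,k),(j,k+1)\in\alpha$ and $\tau(i,k)\ge\tau(j,k+1)$,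 then $(i,k+1)\in\alpha$ and $\tau(i,k+1)>\tau(j,k+1)$. Put $x^\tau=\prod_i x_i^{c_i}$ with $c_i$ the number of entries of $\tau$ equal to $i$. Then $\mathcal{S}_\emptyset=1$ and $\mathcal{S}_\alpha=\sum_\tau x^\tau$, sum over all SSRCTs of shape $\alpha$. It is known that $\{\mathcal{S}_\alpha:\alpha\in\mathcal{C}\}$ is a basis of $\mathrm{QSym}$, with $\mathcal{S}_\alpha\in\mathrm{QSym}_{|\alpha|}$. *)

theory Defs
  imports Complex_Main "HOL-Library.Poly_Mapping" "HOL-Library.FuncSet"
    "HOL-Algebra.Module" "HOL-Algebra.QuotRing"
begin

section \<open>Power series in countably many variables\<close>

text \<open>
  The variables are \<open>x\<^sub>1, x\<^sub>2, \<dots>\<close>. A monomial is its finitely supported exponent vector, in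
  which the exponent of \<open>x\<^sub>i\<close> is stored at index \<open>i - 1\<close>; addition of exponent vectors is
  multiplication of monomials. A power series is its family of coefficients, with no
  restriction on the support.
\<close>

type_synonym monomial = "nat \<Rightarrow>\<^sub>0 nat"
type_synonym power_series = "monomial \<Rightarrow> rat"

definition mono_degree :: "monomial \<Rightarrow> nat" where
  "mono_degree m = (\<Sum>i\<in>Poly_Mapping.keys m. Poly_Mapping.lookup m i)"

definition ps_mult :: "power_series \<Rightarrow> power_series \<Rightarrow> power_series" where
  "ps_mult f g = (\<lambda>m. \<Sum>(a, b)\<in>{(a, b). a + b = m}. f a * g b)"

text \<open>The index set of the convolution is finite, so that its sum is not the default value 0.\<close>

lemma finite_mono_decomp: "finite {(a, b). a + b = (m::monomial)}"
proof -
  let ?l = Poly_Mapping.lookup and ?k = Poly_Mapping.keys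
  let ?D = "{(a, b). a + b = m}"
  let ?F = "PiE (?k m) (\<lambda>i. {..?l m i})"
  let ?r = "\<lambda>(a, b). (restrict (?l a) (?k m), restrict (?l b) (?k m))"
  have out: "?l a i = 0 \<and> ?l b i = 0" if "a + b = m" "i \<notin> ?k m" for a b i
    using that by (auto simp: in_keys_iff lookup_add)
  have "inj_on ?r ?D"
  proof (rule inj_onI, clarify)
    fix a b c d :: monomial
    assume m: "m = a + b" and cd: "c + d = a + b"
      and r: "restrict (?l a) (?k (a + b)) = restrict (?l c) (?k (a + b))"
        "restrict (?l b) (?k (a + b)) = restrict (?l d) (?k (a + b))"
    have "?l a i = ?l c i \<and> ?l b i = ?l d i" for i
      using out[of a b i] out[of c d i] m cd fun_cong[OF r(1), of i] fun_cong[OF r(2), of i]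
      by (cases "i \<in> ?k (a + b)") auto
    then show "a = c \<and> b = d" by (auto intro: poly_mapping_eqI)
  qed
  moreover have "?r ` ?D \<subseteq> ?F \<times> ?F" by (auto simp: lookup_add)
  moreover have "finite (?F \<times> ?F)" by (intro finite_cartesian_product finite_PiE) auto
  ultimately show ?thesis by (meson finite_imageD finite_subset)
qed


section \<open>Compositions and quasisymmetric functions\<close>

definition compositions :: "nat list set" where
  "compositions = {\<alpha>. \<forall>a\<in>set \<alpha>. 0 < a}"

text \<open>The monomial with exponent \<open>\<alpha> ! k\<close> at the \<open>k\<close>-th of the variables with indices \<open>us\<close>.\<close>

definition comp_monomial :: "nat list \<Rightarrow> nat list \<Rightarrow> monomial" where
  "comp_monomial \<alpha> us = (\<Sum>k<length \<alpha>. Poly_Mapping.single (us ! k) (\<alpha> ! k))"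

definition quasisymmetric :: "power_series \<Rightarrow> bool" where
  "quasisymmetric f \<longleftrightarrow>
    (\<forall>\<alpha>\<in>compositions. \<forall>us vs.
       length us = length \<alpha> \<longrightarrow> length vs = length \<alpha> \<longrightarrow>
       sorted_wrt (<) us \<longrightarrow> sorted_wrt (<) vs \<longrightarrow>
       f (comp_monomial \<alpha> us) = f (comp_monomial \<alpha> vs))"

definition QSym_set :: "power_series set" where
  "QSym_set = {f. (\<exists>d. \<forall>m. f m \<noteq> 0 \<longrightarrow> mono_degree m \<le> d) \<and> quasisymmetric f}"

definition QSym :: "(rat, power_series) module" where
  "QSym =
    \<lparr>carrier = QSym_set,
     mult = ps_mult,
     one = (\<lambda>m. if m = 0 then 1 else 0),
     zero = (\<lambda>m. 0),
     add = (\<lambda>f g m. f m + g m),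
     smult = (\<lambda>c f m. c * f m)\<rparr>"

definition QSym_graded :: "nat \<Rightarrow> power_series set" where
  "QSym_graded n = {f \<in> carrier QSym. \<forall>m. f m \<noteq> 0 \<longrightarrow> mono_degree m = n}"

text \<open>
  Only the values on the carrier matter; \<^const>\<open>ring_iso\<close> supplies bijectivity on the carrier
  and compatibility with addition, multiplication and the unit.
\<close>

definition graded_algebra_automorphism :: "(power_series \<Rightarrow> power_series) \<Rightarrow> bool" where
  "graded_algebra_automorphism \<phi> \<longleftrightarrow>
    \<phi> \<in> ring_iso QSym QSym \<and>
    (\<forall>c. \<forall>f\<in>carrier QSym. \<phi> (c \<odot>\<^bsub>QSym\<^esub> f) = c \<odot>\<^bsub>QSym\<^esub> \<phi> f) \<and>
    (\<forall>n. \<phi> ` QSym_graded n \<subseteq> QSym_graded n)"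


section \<open>Quasisymmetric Schur functions\<close>

text \<open>
  Rows and columns are numbered from 0 (top to bottom, left to right), so the first column
  is column 0; entries are positive integers.
\<close>

definition cells :: "nat list \<Rightarrow> (nat \<times> nat) set" where
  "cells \<alpha> = {(i, j). i < length \<alpha> \<and> j < \<alpha> ! i}"

text \<open>Fillings are extensional functions, so that each filling is counted exactly once.\<close>

definition SSRCT :: "nat list \<Rightarrow> (nat \<times> nat \<Rightarrow> nat) set" where
  "SSRCT \<alpha> = {\<tau> \<in> cells \<alpha> \<rightarrow>\<^sub>E {0<..}.
     (\<forall>i j j'. (i, j) \<in> cells \<alpha> \<longrightarrow> (i, j') \<in> cells \<alpha> \<longrightarrow> j \<le> j' \<longrightarrow> \<tau> (i, j') \<le> \<tau> (i, j)) \<and>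
     (\<forall>i i'. (i, 0) \<in> cells \<alpha> \<longrightarrow> (i', 0) \<in> cells \<alpha> \<longrightarrow> i < i' \<longrightarrow> \<tau> (i, 0) < \<tau> (i', 0)) \<and>
     (\<forall>i j k. i < j \<longrightarrow> (i, k) \<in> cells \<alpha> \<longrightarrow> (j, k + 1) \<in> cells \<alpha> \<longrightarrow> \<tau> (j, k + 1) \<le> \<tau> (i, k) \<longrightarrow>
        (i, k + 1) \<in> cells \<alpha> \<and> \<tau> (j, k + 1) < \<tau> (i, k + 1))}"

text \<open>
  The coefficient of \<open>m\<close> in \<open>\<Sum>\<^sub>\<tau> x\<^sup>\<tau>\<close> is the number of tableaux \<open>\<tau>\<close> with \<open>x\<^sup>\<tau> = m\<close>; recall that
  index \<open>i\<close> of \<open>m\<close> belongs to the variable \<open>x\<^bsub>i+1\<^esub>\<close>.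
\<close>

definition SSRCT_weight :: "nat list \<Rightarrow> monomial \<Rightarrow> (nat \<times> nat \<Rightarrow> nat) set" where
  "SSRCT_weight \<alpha> m = {\<tau> \<in> SSRCT \<alpha>. \<forall>i. Poly_Mapping.lookup m i = card {c \<in> cells \<alpha>. \<tau> c = Suc i}}"

definition qschur :: "nat list \<Rightarrow> power_series" where
  "qschur \<alpha> = (\<lambda>m. of_nat (card (SSRCT_weight \<alpha> m)))"

lemma finite_cells: "finite (cells \<alpha>)"
proof -
  have "cells \<alpha> = (SIGMA i:{..<length \<alpha>}. {..<\<alpha> ! i})" by (auto simp: cells_def)
  then show ?thesis by simp
qed

lemma finite_SSRCT_weight: "finite (SSRCT_weight \<alpha> m)"
proof (rule finite_subset)
  show "SSRCT_weight \<alpha> m \<subseteq> cells \<alpha> \<rightarrow>\<^sub>E Suc ` Poly_Mapping.keys m"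
  proof
    fix \<tau> assume t: "\<tau> \<in> SSRCT_weight \<alpha> m"
    then have P: "\<tau> \<in> cells \<alpha> \<rightarrow>\<^sub>E {0<..}" by (simp add: SSRCT_weight_def SSRCT_def)
    have "\<tau> c \<in> Suc ` Poly_Mapping.keys m" if c: "c \<in> cells \<alpha>" for c
    proof -
      from P c obtain i where i: "\<tau> c = Suc i"
        by (metis PiE_mem greaterThan_iff gr0_conv_Suc)
      with c have "{c \<in> cells \<alpha>. \<tau> c = Suc i} \<noteq> {}" by blast
      then have "0 < card {c \<in> cells \<alpha>. \<tau> c = Suc i}"
        by (simp only: card_gt_0_iff finite_cells finite_Collect_conjI Collect_mem_eq simp_thms)
      with t have "i \<in> Poly_Mapping.keys m" by (simp add: SSRCT_weight_def in_keys_iff)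
      with i show ?thesis by simp
    qed
    with P show "\<tau> \<in> cells \<alpha> \<rightarrow>\<^sub>E Suc ` Poly_Mapping.keys m" by (auto simp: PiE_iff)
  qed
  show "finite (cells \<alpha> \<rightarrow>\<^sub>E Suc ` Poly_Mapping.keys m)" by (simp add: finite_PiE finite_cells)
qed

text \<open>The empty composition needs no separate clause.\<close>

lemma qschur_Nil: "qschur [] = \<one>\<^bsub>QSym\<^esub>"
proof
  fix m :: monomial
  have "SSRCT_weight [] m = (if m = 0 then {\<lambda>_. undefined} else {})"
    by (auto simp: SSRCT_weight_def SSRCT_def cells_def poly_mapping_eq_iff fun_eq_iff)
  then show "qschur [] m = \<one>\<^bsub>QSym\<^esub> m" by (simp add: qschur_def QSym_def)
qed

definition qschur_basis :: "power_series set" where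
  "qschur_basis = qschur ` compositions"

end

theory Submission
  imports Defs "HOL-Library.List_Lexorder"
begin

text \<open>
  A graded automorphism \<open>\<phi>\<close> that permutes the quasisymmetric Schur functions permutes compositions
  by a bijection \<open>\<sigma>\<close> with \<open>\<phi> (S\<^sub>\<alpha>) = S\<^bsub>\<sigma> \<alpha>\<^esub>\<close> and \<open>|\<sigma> \<alpha>| = |\<alpha>|\<close>. There is only one composition of
  size 1, so \<open>\<phi>\<close> fixes \<open>S\<^bsub>(1)\<^esub>\<close>, and it must preserve the structure of multiplication by this
  single element. The Pieri rule (\<open>pieri_box\<close>) says that \<open>S\<^bsub>(1)\<^esub> S\<^sub>\<alpha>\<close> is the sum of the \<open>S\<^sub>\<beta>\<close> over
  all \<open>\<beta>\<close> such that subtracting 1 from the last part of some size of \<open>\<beta>\<close>, and dropping it if it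
  becomes 0, gives \<open>\<alpha>\<close>. As the \<open>S\<^sub>\<alpha>\<close> are
  linearly independent, \<open>\<sigma>\<close> is an automorphism of the graph with these edges, and the theorem
  reduces to the combinatorial fact that this graph has no automorphism preserving size except
  the identity (\<open>pieri_graph_rigid\<close>). Since the \<open>S\<^sub>\<alpha>\<close> span, \<open>\<phi>\<close> is then the identity.

  The Pieri rule is a commutation relation in disguise. List the cells of a tableau by decreasing
  entry and, among equal entries, by increasing column; deleting cells from the end of this list
  always leaves a tableau, and its shape loses a cell in a controlled way: going back, the cell is
  added to the first part of size \<open>k\<close> (or is a new first part, when \<open>k = 0\<close>). So \<open>S\<^sub>\<alpha>\<close> is built by the
  raising operators \<open>raise_first\<close>, whereas the product with \<open>S\<^bsub>(1)\<^esub>\<close> is described by the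
  lowering operators \<open>lower_last\<close>. The two families commute except for equal indices,
  where the commutator only records whether the composition has a part \<open>k\<close> and a part \<open>k + 1\<close>. These
  defects telescope over the columns to the identity, which accounts for the contribution of one
  variable to the factor \<open>S\<^bsub>(1)\<^esub>\<close>.

  Independence and spanning come from one triangularity: if the coefficient of the monomial
  function indexed by \<open>\<beta>\<close> in \<open>S\<^sub>\<alpha>\<close> is nonzero, then \<open>\<beta>\<close>, read backwards, is lexicographically at most
  \<open>\<alpha>\<close> read backwards, and the coefficient for \<open>\<beta> = \<alpha>\<close> is nonzero.

  For the rigidity, induct on the size. A composition of size at least 3 is determined by the set
  of its lower neighbours, except that \<open>v\<close> followed by \<open>1, 2\<close> and \<open>v\<close> followed by \<open>2, 1\<close>, where \<open>v\<close> has
  only parts 1 and 2, have the same ones (\<open>ambiguous_pair\<close>). They differ in what lies above them: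
  \<open>v\<close> followed by \<open>2, 2\<close> covers the second, while no composition covering the first has the corresponding lower neighbours.
\<close>

section \<open>Raising and lowering a part of a composition\<close>

text \<open>
  Adds a cell in column \<open>k\<close> (counted from 0), in the highest row where this is possible; column 0
  is extended by a new row at the top.
\<close>

fun raise_first :: "nat \<Rightarrow> nat list \<Rightarrow> nat list option" where
  "raise_first 0 \<alpha> = Some (1 # \<alpha>)"
| "raise_first (Suc k) [] = None"
| "raise_first (Suc k) (c # \<alpha>) =
     (if c = Suc k then Some (Suc (Suc k) # \<alpha>) else map_option ((#) c) (raise_first (Suc k) \<alpha>))"

text \<open>
  Removes a cell from column \<open>k\<close> (counted from 0), in the lowest row that ends there; a row of
  length 1 disappears.
\<close>

fun lower_last :: "nat \<Rightarrow> nat list \<Rightarrow> nat list option" where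
  "lower_last k [] = None"
| "lower_last k (c # \<alpha>) =
     (case lower_last k \<alpha> of
        Some \<gamma> \<Rightarrow> Some (c # \<gamma>)
      | None \<Rightarrow> if c = Suc k then Some (if k = 0 then \<alpha> else k # \<alpha>) else None)"

text \<open>
  Part 0 counts as always present, in accordance with the empty rows on which a new row can start.
\<close>

definition has_part :: "nat \<Rightarrow> nat list \<Rightarrow> bool" where
  "has_part k \<alpha> \<longleftrightarrow> k = 0 \<or> k \<in> set \<alpha>"

lemma raise_first_eq_None: "raise_first k \<alpha> = None \<longleftrightarrow> \<not> has_part k \<alpha>"
  by (induction k \<alpha> rule: raise_first.induct) (auto simp: has_part_def)

lemma lower_last_eq_None: "lower_last k \<alpha> = None \<longleftrightarrow> Suc k \<notin> set \<alpha>"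
  by (induction \<alpha>) (auto split: option.splits)

lemma raise_first_SomeE:
  assumes "has_part k \<alpha>" obtains \<beta> where "raise_first k \<alpha> = Some \<beta>"
  using assms by (cases "raise_first k \<alpha>") (auto simp: raise_first_eq_None)

lemma lower_last_SomeE:
  assumes "Suc k \<in> set \<alpha>" obtains \<beta> where "lower_last k \<alpha> = Some \<beta>"
  using assms by (cases "lower_last k \<alpha>") (auto simp: lower_last_eq_None)

lemma raise_first_has_part: "raise_first k \<alpha> = Some \<beta> \<Longrightarrow> has_part (Suc k) \<beta>"
  by (induction k \<alpha> arbitrary: \<beta> rule: raise_first.induct) (auto simp: has_part_def split: if_splits)

lemma raise_first_compositions:
  "raise_first k \<alpha> = Some \<beta> \<Longrightarrow> \<alpha> \<in> compositions \<longleftrightarrow> \<beta> \<in> compositions"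
  by (induction k \<alpha> arbitrary: \<beta> rule: raise_first.induct) (auto simp: compositions_def split: if_splits)

lemma lower_last_compositions:
  "lower_last k \<beta> = Some \<alpha> \<Longrightarrow> \<beta> \<in> compositions \<longleftrightarrow> \<alpha> \<in> compositions"
  by (induction \<beta> arbitrary: \<alpha>) (auto simp: compositions_def split: if_splits option.splits)

lemma raise_first_sum_list: "raise_first k \<alpha> = Some \<beta> \<Longrightarrow> sum_list \<beta> = Suc (sum_list \<alpha>)"
  by (induction k \<alpha> arbitrary: \<beta> rule: raise_first.induct) (auto split: if_splits)

lemma lower_last_sum_list: "lower_last k \<beta> = Some \<alpha> \<Longrightarrow> sum_list \<beta> = Suc (sum_list \<alpha>)"
  by (induction \<beta> arbitrary: \<alpha>) (auto split: if_splits option.splits)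

lemma raise_first_keeps_part:
  "raise_first k \<alpha> = Some \<beta> \<Longrightarrow> p \<in> set \<alpha> \<Longrightarrow> p \<noteq> k \<Longrightarrow> p \<in> set \<beta>"
  by (induction k \<alpha> arbitrary: \<beta> rule: raise_first.induct) (auto split: if_splits)

text \<open>
  For \<open>i \<noteq> k\<close> both operators act on parts of the same size only if \<open>i + 1 = k\<close>. Then, with at least two
  parts \<open>k\<close>, they act on different ones, and with fewer both composites are undefined.
\<close>

lemma raise_lower_commute:
  assumes "i \<noteq> k"
  shows "Option.bind (raise_first k \<alpha>) (lower_last i) = Option.bind (lower_last i \<alpha>) (raise_first k)"
proof (cases k)
  case 0
  then show ?thesis using assms by (cases "lower_last i \<alpha>") auto
next
  case (Suc l)
  show ?thesis using assms unfolding Suc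
  proof (induction \<alpha>)
    case (Cons c \<alpha>)
    note IH = Cons.IH[OF Cons.prems]
    show ?case
    proof (cases "c = Suc l")
      case True
      have "raise_first (Suc l) \<alpha> = None" if "lower_last i \<alpha> = None" "i = l"
        using that by (simp add: raise_first_eq_None lower_last_eq_None has_part_def)
      with True Cons.prems show ?thesis
        by (cases "lower_last i \<alpha>") auto
    next
      case False
      show ?thesis
      proof (cases "raise_first (Suc l) \<alpha>")
        case None
        then show ?thesis using IH False Cons.prems
          by (cases "lower_last i \<alpha>") simp_all
      next
        case (Some \<delta>)
        have keep: "lower_last i \<delta> \<noteq> None" if "lower_last i \<alpha> \<noteq> None" "c = Suc i"
          using raise_first_keeps_part[OF Some, of "Suc i"] that False by (auto simp: lower_last_eq_None)
        show ?thesis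
        proof (cases "lower_last i \<alpha>")
          case N: None
          then show ?thesis using Some IH False Cons.prems by simp
        next
          case S: (Some \<gamma>)
          have eq: "lower_last i \<delta> = raise_first (Suc l) \<gamma>" using IH Some S by simp
          show ?thesis using keep S Some False eq
            by (cases "raise_first (Suc l) \<gamma>") auto
        qed
      qed
    qed
  qed simp
qed

text \<open>
  The part that was raised is the only candidate for lowering.
\<close>

lemma lower_raise_cancel:
  "has_part k \<alpha> \<Longrightarrow> Suc k \<notin> set \<alpha> \<Longrightarrow> Option.bind (raise_first k \<alpha>) (lower_last k) = Some \<alpha>"
proof (cases k)
  case 0
  then show "Suc k \<notin> set \<alpha> \<Longrightarrow> ?thesis" by (auto split: option.splits simp: lower_last_eq_None[symmetric])
next
  case (Suc l)
  show "has_part k \<alpha> \<Longrightarrow> Suc k \<notin> set \<alpha> \<Longrightarrow> ?thesis" unfolding Suc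
  proof (induction \<alpha>)
    case (Cons c \<alpha>)
    then show ?case
      by (cases "lower_last (Suc l) \<alpha>"; cases "raise_first (Suc l) \<alpha>")
         (auto simp: has_part_def lower_last_eq_None[symmetric])
  qed (simp add: has_part_def)
qed

lemma raise_lower_cancel:
  "\<not> has_part k \<alpha> \<Longrightarrow> Suc k \<in> set \<alpha> \<Longrightarrow> Option.bind (lower_last k \<alpha>) (raise_first k) = Some \<alpha>"
proof (cases k)
  case 0
  then show "\<not> has_part k \<alpha> \<Longrightarrow> ?thesis" by (simp add: has_part_def)
next
  case (Suc l)
  show "\<not> has_part k \<alpha> \<Longrightarrow> Suc k \<in> set \<alpha> \<Longrightarrow> ?thesis" unfolding Suc
  proof (induction \<alpha>)
    case (Cons c \<alpha>)
    show ?case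
    proof (cases "Suc (Suc l) \<in> set \<alpha>")
      case True
      then obtain \<gamma> where "lower_last (Suc l) \<alpha> = Some \<gamma>" by (rule lower_last_SomeE)
      with Cons True show ?thesis by (auto simp: has_part_def)
    next
      case False
      then have "lower_last (Suc l) \<alpha> = None" by (simp add: lower_last_eq_None)
      with Cons.prems False show ?thesis by auto
    qed
  qed (simp add: has_part_def)
qed

text \<open>
  If the first part \<open>k\<close> precedes the last part \<open>k + 1\<close>, both composites exchange these two parts;
  otherwise both composites are the identity.
\<close>

lemma raise_lower_swap:
  "has_part k \<alpha> \<Longrightarrow> Suc k \<in> set \<alpha> \<Longrightarrow>
    Option.bind (raise_first k \<alpha>) (lower_last k) = Option.bind (lower_last k \<alpha>) (raise_first k)"
proof (cases k)
  case 0
  then show "Suc k \<in> set \<alpha> \<Longrightarrow> ?thesis"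
    by (cases "lower_last 0 \<alpha>") (auto simp: lower_last_eq_None)
next
  case (Suc l)
  show "has_part k \<alpha> \<Longrightarrow> Suc k \<in> set \<alpha> \<Longrightarrow> ?thesis" unfolding Suc
  proof (induction \<alpha>)
    case (Cons c \<alpha>)
    consider "c = Suc l" | "c = Suc (Suc l)" "Suc (Suc l) \<in> set \<alpha>" | "c = Suc (Suc l)" "Suc (Suc l) \<notin> set \<alpha>"
      | "c \<noteq> Suc l" "c \<noteq> Suc (Suc l)" by blast
    then show ?case
    proof cases
      case 1
      with Cons.prems show ?thesis
        by (cases "lower_last (Suc l) \<alpha>") (auto simp: has_part_def lower_last_eq_None)
    next
      case 2
      with Cons.prems have p: "has_part (Suc l) \<alpha>" by (auto simp: has_part_def)
      then obtain \<delta> where \<delta>: "raise_first (Suc l) \<alpha> = Some \<delta>" by (auto elim: raise_first_SomeE)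
      obtain \<gamma> where \<gamma>: "lower_last (Suc l) \<alpha> = Some \<gamma>" using 2 by (auto elim: lower_last_SomeE)
      have "lower_last (Suc l) \<delta> \<noteq> None" using raise_first_has_part[OF \<delta>] by (simp add: lower_last_eq_None has_part_def)
      then obtain \<epsilon> where \<epsilon>: "lower_last (Suc l) \<delta> = Some \<epsilon>" by auto
      then show ?thesis using Cons.IH[OF p 2(2)] 2 \<delta> \<gamma>
        by (cases "raise_first (Suc l) \<gamma>") auto
    next
      case 3
      then have "has_part (Suc l) \<alpha>" "lower_last (Suc l) \<alpha> = None" using Cons.prems by (auto simp: has_part_def lower_last_eq_None)
      with lower_raise_cancel[of "Suc l" \<alpha>] 3 show ?thesis
        by (cases "raise_first (Suc l) \<alpha>") auto
    next
      case 4
      with Cons.prems have p: "has_part (Suc l) \<alpha>" "Suc (Suc l) \<in> set \<alpha>" by (auto simp: has_part_def)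
      then obtain \<delta> where \<delta>: "raise_first (Suc l) \<alpha> = Some \<delta>" by (auto elim: raise_first_SomeE)
      obtain \<gamma> where \<gamma>: "lower_last (Suc l) \<alpha> = Some \<gamma>" using p by (auto elim: lower_last_SomeE)
      show ?thesis using Cons.IH[OF p] 4 \<delta> \<gamma>
        by (cases "raise_first (Suc l) \<gamma>") auto
    qed
  qed (simp add: has_part_def)
qed

definition raise_preimage :: "nat \<Rightarrow> nat list \<Rightarrow> nat list set" where
  "raise_preimage k \<beta> = {\<alpha> \<in> compositions. raise_first k \<alpha> = Some \<beta>}"

text \<open>
  The compositions that index the Pieri product of \<open>S\<^bsub>(1)\<^esub>\<close> with \<open>S\<^sub>\<alpha>\<close>.
\<close>

definition pieri_up :: "nat list \<Rightarrow> nat list set" where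
  "pieri_up \<alpha> = {\<beta> \<in> compositions. \<exists>i. lower_last i \<beta> = Some \<alpha>}"

lemma lower_last_index_unique:
  "lower_last i \<beta> = Some \<alpha> \<Longrightarrow> lower_last j \<beta> = Some \<alpha> \<Longrightarrow> i = j"
proof (induction \<beta> arbitrary: \<alpha>)
  case (Cons c \<beta>)
  have *: "lower_last 0 (1 # \<gamma>) \<noteq> None" for \<gamma>
    by (metis One_nat_def list.set_intros(1) lower_last_eq_None)
  show ?case using Cons *
    by (auto split: option.splits if_splits)
qed simp

lemma finite_compositions_sum_le: "finite {\<alpha> \<in> compositions. sum_list \<alpha> \<le> n}"
proof (rule finite_subset)
  have "length \<alpha> \<le> sum_list \<alpha>" if "\<alpha> \<in> compositions" for \<alpha>
    using that by (induction \<alpha>) (auto simp: compositions_def)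
  then show "{\<alpha> \<in> compositions. sum_list \<alpha> \<le> n} \<subseteq> {\<alpha>. set \<alpha> \<subseteq> {..n} \<and> length \<alpha> \<le> n}"
    by (force dest: member_le_sum_list)
  show "finite {\<alpha>. set \<alpha> \<subseteq> {..n} \<and> length \<alpha> \<le> n}" by (rule finite_lists_length_le) simp
qed

lemma finite_raise_preimage: "finite (raise_preimage k \<beta>)"
  by (rule finite_subset[OF _ finite_compositions_sum_le[of "sum_list \<beta>"]])
     (auto simp: raise_preimage_def dest: raise_first_sum_list)

lemma finite_pieri_up: "finite (pieri_up \<alpha>)"
  by (rule finite_subset[OF _ finite_compositions_sum_le[of "Suc (sum_list \<alpha>)"]])
     (auto simp: pieri_up_def dest: lower_last_sum_list)

lemma lower_last_index_less: "lower_last i \<beta> = Some \<alpha> \<Longrightarrow> i < sum_list \<beta>"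
  using lower_last_eq_None[of i \<beta>] member_le_sum_list[of "Suc i" \<beta>] by auto

text \<open>
  The commutation relation between raising and lowering, summed over all lowering indices and read
  at a fixed target \<open>\<alpha>\<close>. Only the lowering index \<open>k\<close> contributes a defect, and there the composites
  differ exactly on compositions with just one of the parts \<open>k\<close>, \<open>k + 1\<close>, on which the defined composite
  is the identity.
\<close>

lemma sum_pieri_up_raise_preimage:
  fixes g :: "nat list \<Rightarrow> rat"
  assumes "\<alpha> \<in> compositions"
  shows "(\<Sum>\<beta>\<in>pieri_up \<alpha>. \<Sum>\<gamma>\<in>raise_preimage k \<beta>. g \<gamma>) =
    (\<Sum>\<beta>\<in>raise_preimage k \<alpha>. \<Sum>\<gamma>\<in>pieri_up \<beta>. g \<gamma>)
      + (of_bool (has_part k \<alpha>) - of_bool (has_part (Suc k) \<alpha>)) * g \<alpha>"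
proof -
  \<comment> \<open>Both sides are sums over pairs of an index \<open>i\<close> and a start \<open>\<gamma>\<close> that the composite takes to \<open>\<alpha>\<close>:
    \<open>W\<close> consists of all these pairs, \<open>N\<close> of those with \<open>i \<noteq> k\<close>, and \<open>E\<close> of the starts for \<open>i = k\<close>.\<close>
  define up_down where "up_down i \<gamma> = Option.bind (raise_first k \<gamma>) (lower_last i)" for i \<gamma>
  define down_up where "down_up i \<gamma> = Option.bind (lower_last i \<gamma>) (raise_first k)" for i \<gamma>
  define N where "N h = {p. snd p \<in> compositions \<and> fst p \<noteq> k \<and> h (fst p) (snd p) = Some \<alpha>}"
    for h :: "nat \<Rightarrow> nat list \<Rightarrow> nat list option"
  define E where "E h = {\<gamma> \<in> compositions. h k \<gamma> = Some \<alpha>}"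
    for h :: "nat \<Rightarrow> nat list \<Rightarrow> nat list option"
  define W where "W h = {p. snd p \<in> compositions \<and> h (fst p) (snd p) = Some \<alpha>}"
    for h :: "nat \<Rightarrow> nat list \<Rightarrow> nat list option"
  have fin: "finite (W h)" if "h = up_down \<or> h = down_up" for h
  proof (rule finite_subset)
    show "W h \<subseteq> {..Suc (sum_list \<alpha>)} \<times> {\<gamma> \<in> compositions. sum_list \<gamma> \<le> sum_list \<alpha>}"
    proof
      fix p assume p: "p \<in> W h"
      obtain i \<gamma> where [simp]: "p = (i, \<gamma>)" by fastforce
      from p have c: "\<gamma> \<in> compositions" and h: "h i \<gamma> = Some \<alpha>" by (auto simp: W_def)
      from that have "i \<le> Suc (sum_list \<alpha>) \<and> sum_list \<gamma> \<le> sum_list \<alpha>"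
      proof
        assume "h = up_down"
        with h obtain \<delta> where "raise_first k \<gamma> = Some \<delta>" "lower_last i \<delta> = Some \<alpha>"
          by (auto simp: up_down_def bind_eq_Some_conv)
        then show ?thesis
          using lower_last_sum_list lower_last_index_less raise_first_sum_list by fastforce
      next
        assume "h = down_up"
        with h obtain \<delta> where "lower_last i \<gamma> = Some \<delta>" "raise_first k \<delta> = Some \<alpha>"
          by (auto simp: down_up_def bind_eq_Some_conv)
        then show ?thesis
          using lower_last_sum_list lower_last_index_less raise_first_sum_list by fastforce
      qed
      with c show "p \<in> {..Suc (sum_list \<alpha>)} \<times> {\<gamma> \<in> compositions. sum_list \<gamma> \<le> sum_list \<alpha>}" by simp
    qed
  qed (intro finite_cartesian_product finite_compositions_sum_le, simp)
  have split: "(\<Sum>p\<in>W h. g (snd p)) = (\<Sum>p\<in>N h. g (snd p)) + (\<Sum>\<gamma>\<in>E h. g \<gamma>)"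
    if "h = up_down \<or> h = down_up" for h
  proof -
    have W: "W h = N h \<union> Pair k ` E h" by (auto simp: W_def N_def E_def)
    have "(\<Sum>p\<in>W h. g (snd p)) = (\<Sum>p\<in>N h. g (snd p)) + (\<Sum>p\<in>Pair k ` E h. g (snd p))"
      unfolding W using fin[OF that] unfolding W by (intro sum.union_disjoint) (auto simp: N_def)
    also have "(\<Sum>p\<in>Pair k ` E h. g (snd p)) = (\<Sum>\<gamma>\<in>E h. g \<gamma>)"
      by (subst sum.reindex) (auto intro: inj_onI)
    finally show ?thesis .
  qed
  have finE: "finite (E h)" if "h = up_down \<or> h = down_up" for h
  proof -
    have "E h \<subseteq> snd ` W h"
    proof
      fix \<gamma> assume "\<gamma> \<in> E h"
      then have "(k, \<gamma>) \<in> W h" by (simp add: W_def E_def)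
      then show "\<gamma> \<in> snd ` W h" by force
    qed
    with fin[OF that] show ?thesis by (meson finite_imageI finite_subset)
  qed
  have NN: "N up_down = N down_up"
    by (auto simp: N_def up_down_def down_up_def raise_lower_commute)
  have the_index: "(THE i. lower_last i \<beta> = Some \<delta>) = i" if "lower_last i \<beta> = Some \<delta>" for i \<beta> \<delta>
    using that by (blast intro: the_equality lower_last_index_unique)
  have L: "(\<Sum>\<beta>\<in>pieri_up \<alpha>. \<Sum>\<gamma>\<in>raise_preimage k \<beta>. g \<gamma>) = (\<Sum>p\<in>W up_down. g (snd p))"
    unfolding sum.Sigma[OF finite_pieri_up ballI[OF finite_raise_preimage]]
    by (rule sum.reindex_bij_witness[where
      i = "\<lambda>p. (the (raise_first k (snd p)), snd p)" and
      j = "\<lambda>p. (THE i. lower_last i (fst p) = Some \<alpha>, snd p)"])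
      (auto simp: W_def up_down_def pieri_up_def raise_preimage_def raise_first_compositions
        the_index split: Option.bind_splits)
  have R: "(\<Sum>\<beta>\<in>raise_preimage k \<alpha>. \<Sum>\<gamma>\<in>pieri_up \<beta>. g \<gamma>) = (\<Sum>p\<in>W down_up. g (snd p))"
    unfolding sum.Sigma[OF finite_raise_preimage ballI[OF finite_pieri_up]]
    by (rule sum.reindex_bij_witness[where
      i = "\<lambda>p. (the (lower_last (fst p) (snd p)), snd p)" and
      j = "\<lambda>p. (THE i. lower_last i (snd p) = Some (fst p), snd p)"])
      (auto simp: W_def down_up_def pieri_up_def raise_preimage_def lower_last_compositions
        the_index split: Option.bind_splits)
  \<comment> \<open>\<open>Z\<close> is the common part of the two sets of starts for \<open>i = k\<close>, where raising and lowering swap.\<close>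
  define Z where "Z = {\<gamma> \<in> E up_down. has_part k \<gamma> \<and> has_part (Suc k) \<gamma>}"
  have h1: "up_down k \<gamma> = down_up k \<gamma>" if "has_part k \<gamma>" "has_part (Suc k) \<gamma>" for \<gamma>
    using raise_lower_swap that by (auto simp: up_down_def down_up_def has_part_def)
  have h2: "up_down k \<gamma> = Some \<gamma>" "down_up k \<gamma> = None" if "has_part k \<gamma>" "\<not> has_part (Suc k) \<gamma>" for \<gamma>
    using lower_raise_cancel that lower_last_eq_None[of k \<gamma>] by (auto simp: up_down_def down_up_def has_part_def)
  have h3: "down_up k \<gamma> = Some \<gamma>" "up_down k \<gamma> = None" if "\<not> has_part k \<gamma>" "has_part (Suc k) \<gamma>" for \<gamma>
    using raise_lower_cancel that raise_first_eq_None[of k \<gamma>] by (auto simp: up_down_def down_up_def has_part_def)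
  have h4: "down_up k \<gamma> = None" "up_down k \<gamma> = None" if "\<not> has_part k \<gamma>" "\<not> has_part (Suc k) \<gamma>" for \<gamma>
    using that raise_first_eq_None[of k \<gamma>] lower_last_eq_None[of k \<gamma>] by (auto simp: up_down_def down_up_def has_part_def)
  have E1: "E up_down = Z \<union> (if has_part k \<alpha> \<and> \<not> has_part (Suc k) \<alpha> then {\<alpha>} else {})"
  proof (rule Set.set_eqI)
    fix \<gamma>
    show "\<gamma> \<in> E up_down \<longleftrightarrow> \<gamma> \<in> Z \<union> (if has_part k \<alpha> \<and> \<not> has_part (Suc k) \<alpha> then {\<alpha>} else {})"
      using h2(1)[of \<gamma>] h3(2)[of \<gamma>] h4(2)[of \<gamma>] assms unfolding E_def Z_def
      by (cases "has_part k \<gamma>"; cases "has_part (Suc k) \<gamma>") auto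
  qed
  have E2: "E down_up = Z \<union> (if \<not> has_part k \<alpha> \<and> has_part (Suc k) \<alpha> then {\<alpha>} else {})"
  proof (rule Set.set_eqI)
    fix \<gamma>
    show "\<gamma> \<in> E down_up \<longleftrightarrow> \<gamma> \<in> Z \<union> (if \<not> has_part k \<alpha> \<and> has_part (Suc k) \<alpha> then {\<alpha>} else {})"
      using h1[of \<gamma>] h2(2)[of \<gamma>] h3(1)[of \<gamma>] h4(1)[of \<gamma>] assms unfolding E_def Z_def
      by (cases "has_part k \<gamma>"; cases "has_part (Suc k) \<gamma>") auto
  qed
  have "finite Z" using finE by (simp add: Z_def)
  moreover have "\<alpha> \<in> Z \<Longrightarrow> has_part k \<alpha> \<and> has_part (Suc k) \<alpha>" by (simp add: Z_def)
  ultimately have "(\<Sum>\<gamma>\<in>E up_down. g \<gamma>) = (\<Sum>\<gamma>\<in>E down_up. g \<gamma>)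
      + (of_bool (has_part k \<alpha>) - of_bool (has_part (Suc k) \<alpha>)) * g \<alpha>"
    unfolding E1 E2 by (cases "\<alpha> \<in> Z") auto
  then show ?thesis unfolding L R by (simp add: split NN)
qed

text \<open>
  The inverse images under raising, described by the row that has been raised.
\<close>

lemma raise_first_Suc_iff:
  "raise_first (Suc l) \<gamma> = Some \<alpha> \<longleftrightarrow>
    (\<exists>i<length \<alpha>. \<alpha> ! i = Suc (Suc l) \<and> (\<forall>h<i. \<alpha> ! h \<noteq> Suc l) \<and> \<gamma> = \<alpha>[i := Suc l])"
proof -
  have "raise_first (Suc l) \<gamma> = Some \<alpha> \<longleftrightarrow>
    (\<exists>x y. \<gamma> = x @ Suc l # y \<and> Suc l \<notin> set x \<and> \<alpha> = x @ Suc (Suc l) # y)"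
    (is "_ \<longleftrightarrow> ?R")
  proof
    show "raise_first (Suc l) \<gamma> = Some \<alpha> \<Longrightarrow> ?R"
    proof (induction \<gamma> arbitrary: \<alpha>)
      case (Cons c \<gamma>)
      show ?case
      proof (cases "c = Suc l")
        case True
        then show ?thesis using Cons.prems by (intro exI[of _ "[]"] exI[of _ \<gamma>]) auto
      next
        case False
        with Cons.prems obtain \<delta> where d: "raise_first (Suc l) \<gamma> = Some \<delta>" "\<alpha> = c # \<delta>" by auto
        with Cons.IH obtain x y where "\<gamma> = x @ Suc l # y \<and> Suc l \<notin> set x \<and> \<delta> = x @ Suc (Suc l) # y"
          by blast
        with d False show ?thesis by (intro exI[of _ "c # x"] exI[of _ y]) auto
      qed
    qed simp
    assume ?R
    then obtain x y where *: "\<gamma> = x @ Suc l # y" "Suc l \<notin> set x" "\<alpha> = x @ Suc (Suc l) # y" by blast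
    from *(2) show "raise_first (Suc l) \<gamma> = Some \<alpha>" unfolding *(1,3) by (induction x) auto
  qed
  also have "?R \<longleftrightarrow>
    (\<exists>i<length \<alpha>. \<alpha> ! i = Suc (Suc l) \<and> (\<forall>h<i. \<alpha> ! h \<noteq> Suc l) \<and> \<gamma> = \<alpha>[i := Suc l])"
    (is "_ \<longleftrightarrow> ?I")
  proof
    assume ?R
    then obtain x y where *: "\<gamma> = x @ Suc l # y" "Suc l \<notin> set x" "\<alpha> = x @ Suc (Suc l) # y" by blast
    then show ?I by (intro exI[of _ "length x"]) (auto simp: nth_append dest: nth_mem)
  next
    assume ?I
    then obtain i where *: "i < length \<alpha>" "\<alpha> ! i = Suc (Suc l)" "\<forall>h<i. \<alpha> ! h \<noteq> Suc l" "\<gamma> = \<alpha>[i := Suc l]"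
      by blast
    then show ?R
      by (intro exI[of _ "take i \<alpha>"] exI[of _ "drop (Suc i) \<alpha>"])
         (auto simp: upd_conv_take_nth_drop id_take_nth_drop[of i \<alpha>, symmetric] in_set_conv_nth
           simp flip: *(2))
  qed
  finally show ?thesis .
qed


section \<open>Peeling the last cell off a tableau\<close>

lemma SSRCT_I:
  assumes "\<And>c. c \<in> cells \<alpha> \<Longrightarrow> 0 < \<tau> c" "\<And>c. c \<notin> cells \<alpha> \<Longrightarrow> \<tau> c = undefined"
    "\<And>i j j'. (i, j) \<in> cells \<alpha> \<Longrightarrow> (i, j') \<in> cells \<alpha> \<Longrightarrow> j \<le> j' \<Longrightarrow> \<tau> (i, j') \<le> \<tau> (i, j)"
    "\<And>i i'. (i, 0) \<in> cells \<alpha> \<Longrightarrow> (i', 0) \<in> cells \<alpha> \<Longrightarrow> i < i' \<Longrightarrow> \<tau> (i, 0) < \<tau> (i', 0)"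
    "\<And>i j k. i < j \<Longrightarrow> (i, k) \<in> cells \<alpha> \<Longrightarrow> (j, Suc k) \<in> cells \<alpha> \<Longrightarrow> \<tau> (j, Suc k) \<le> \<tau> (i, k) \<Longrightarrow>
        (i, Suc k) \<in> cells \<alpha> \<and> \<tau> (j, Suc k) < \<tau> (i, Suc k)"
  shows "\<tau> \<in> SSRCT \<alpha>"
  using assms unfolding SSRCT_def PiE_iff extensional_def by auto

lemma SSRCT_D:
  assumes "\<tau> \<in> SSRCT \<alpha>"
  shows "c \<in> cells \<alpha> \<Longrightarrow> 0 < \<tau> c" "c \<notin> cells \<alpha> \<Longrightarrow> \<tau> c = undefined"
    "(i, j) \<in> cells \<alpha> \<Longrightarrow> (i, j') \<in> cells \<alpha> \<Longrightarrow> j \<le> j' \<Longrightarrow> \<tau> (i, j') \<le> \<tau> (i, j)"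
    "(i, 0) \<in> cells \<alpha> \<Longrightarrow> (i', 0) \<in> cells \<alpha> \<Longrightarrow> i < i' \<Longrightarrow> \<tau> (i, 0) < \<tau> (i', 0)"
    "i < i' \<Longrightarrow> (i, k) \<in> cells \<alpha> \<Longrightarrow> (i', Suc k) \<in> cells \<alpha> \<Longrightarrow> \<tau> (i', Suc k) \<le> \<tau> (i, k) \<Longrightarrow>
        (i, Suc k) \<in> cells \<alpha> \<and> \<tau> (i', Suc k) < \<tau> (i, Suc k)"
  using assms unfolding SSRCT_def PiE_iff extensional_def by (cases c; auto)+

text \<open>
  The tableaux at an intermediate stage of the construction: entries above \<open>w + 1\<close> are admitted
  everywhere, the entry \<open>w + 1\<close> only in columns before \<open>j\<close>, and smaller entries nowhere. The entry
  \<open>w + 1\<close> stands for the variable stored at index \<open>w\<close>.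
\<close>

definition staged :: "nat \<Rightarrow> nat \<Rightarrow> nat list \<Rightarrow> monomial \<Rightarrow> (nat \<times> nat \<Rightarrow> nat) set" where
  "staged w j \<alpha> m = {\<tau> \<in> SSRCT_weight \<alpha> m.
     \<forall>c\<in>cells \<alpha>. Suc w < \<tau> c \<or> \<tau> c = Suc w \<and> snd c < j}"

lemma stagedD:
  assumes "\<tau> \<in> staged w j \<alpha> m"
  shows "\<tau> \<in> SSRCT \<alpha>" "Poly_Mapping.lookup m v = card {c \<in> cells \<alpha>. \<tau> c = Suc v}"
    "c \<in> cells \<alpha> \<Longrightarrow> Suc w \<le> \<tau> c" "(i, k) \<in> cells \<alpha> \<Longrightarrow> j \<le> k \<Longrightarrow> Suc w < \<tau> (i, k)"
  using assms by (force simp: staged_def SSRCT_weight_def)+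

lemma stagedI:
  assumes "\<tau> \<in> SSRCT \<alpha>" "\<And>v. Poly_Mapping.lookup m v = card {c \<in> cells \<alpha>. \<tau> c = Suc v}"
    "\<And>c. c \<in> cells \<alpha> \<Longrightarrow> Suc w \<le> \<tau> c" "\<And>i k. (i, k) \<in> cells \<alpha> \<Longrightarrow> j \<le> k \<Longrightarrow> Suc w < \<tau> (i, k)"
  shows "\<tau> \<in> staged w j \<alpha> m"
  using assms by (force simp: staged_def SSRCT_weight_def not_le)

lemma finite_staged: "finite (staged w j \<alpha> m)"
  by (rule finite_subset[OF _ finite_SSRCT_weight[of \<alpha> m]]) (auto simp: staged_def)

text \<open>
  The tableaux whose last cell, in the order by decreasing entry and then increasing column, is
  \<open>(i, j)\<close> with entry \<open>w + 1\<close>.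
\<close>

definition last_at :: "nat \<Rightarrow> nat \<Rightarrow> nat \<Rightarrow> nat list \<Rightarrow> monomial \<Rightarrow> (nat \<times> nat \<Rightarrow> nat) set" where
  "last_at i w j \<alpha> m = {\<tau> \<in> staged w (Suc j) \<alpha> m. (i, j) \<in> cells \<alpha> \<and> \<tau> (i, j) = Suc w}"

lemma staged_Suc_eq: "staged w (Suc j) \<alpha> m = staged w j \<alpha> m \<union> (\<Union>i<length \<alpha>. last_at i w j \<alpha> m)"
proof -
  have "\<tau> \<in> staged w j \<alpha> m \<or> (\<exists>i<length \<alpha>. \<tau> \<in> last_at i w j \<alpha> m)" if "\<tau> \<in> staged w (Suc j) \<alpha> m" for \<tau>
    using that by (force simp: staged_def last_at_def cells_def less_Suc_eq)
  moreover have "staged w j \<alpha> m \<subseteq> staged w (Suc j) \<alpha> m" by (force simp: staged_def)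
  ultimately show ?thesis by (auto simp: last_at_def)
qed

text \<open>
  For two minimal entries in one column, the triple condition applied to the cell left of the upper
  one would force the upper one to be strictly larger.
\<close>

lemma min_unique_in_column:
  assumes "\<tau> \<in> staged w j' \<alpha> m" "(i, j) \<in> cells \<alpha>" "(i', j) \<in> cells \<alpha>" "\<tau> (i, j) = Suc w" "\<tau> (i', j) = Suc w"
  shows "i = i'"
proof -
  have "\<not> i < i'" if "(i, j) \<in> cells \<alpha>" "(i', j) \<in> cells \<alpha>" "\<tau> (i, j) = Suc w" "\<tau> (i', j) = Suc w" for i i'
  proof
    assume "i < i'"
    show False
    proof (cases j)
      case 0
      then show ?thesis using SSRCT_D(4)[OF stagedD(1)[OF assms(1)], of i i'] that \<open>i < i'\<close> by simp
    next
      case (Suc l)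
      then have c: "(i, l) \<in> cells \<alpha>" using that by (auto simp: cells_def)
      then show ?thesis
        using SSRCT_D(5)[OF stagedD(1)[OF assms(1)] \<open>i < i'\<close> c] stagedD(3)[OF assms(1) c] that Suc by simp
    qed
  qed
  then show ?thesis using assms by (metis linorder_cases)
qed

text \<open>
  Why the last cell can be removed: a cell to its right would hold a minimal entry in a later
  column, and a row above that ends just before column \<open>j\<close> would violate the triple condition. So
  the shortened row is the first one of its length.
\<close>

lemma last_at_row_length:
  assumes "\<tau> \<in> last_at i w j \<alpha> m"
  shows "i < length \<alpha>" "\<alpha> ! i = Suc j" "h < i \<Longrightarrow> 0 < j \<Longrightarrow> \<alpha> ! h \<noteq> j" "j = 0 \<Longrightarrow> \<alpha> \<in> compositions \<Longrightarrow> i = 0"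
proof -
  from assms have t: "\<tau> \<in> staged w (Suc j) \<alpha> m" and c: "(i, j) \<in> cells \<alpha>" and v: "\<tau> (i, j) = Suc w"
    by (auto simp: last_at_def)
  note S = stagedD(1)[OF t]
  show i: "i < length \<alpha>" using c by (simp add: cells_def)
  show "\<alpha> ! i = Suc j"
  proof (rule ccontr)
    assume "\<alpha> ! i \<noteq> Suc j"
    with c have c': "(i, Suc j) \<in> cells \<alpha>" by (auto simp: cells_def)
    show False using SSRCT_D(3)[OF S c c'] stagedD(4)[OF t c'] v by simp
  qed
  show "\<alpha> ! h \<noteq> j" if h_i: "h < i" "0 < j"
  proof
    assume h: "\<alpha> ! h = j"
    obtain l where l: "j = Suc l" using h_i(2) by (cases j) auto
    then have c': "(h, l) \<in> cells \<alpha>" using h h_i(1) i by (auto simp: cells_def)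
    then show False using SSRCT_D(5)[OF S h_i(1) c'] stagedD(3)[OF t c'] v c l h by (auto simp: cells_def)
  qed
  show "i = 0" if "j = 0" "\<alpha> \<in> compositions"
  proof (rule ccontr)
    assume "i \<noteq> 0"
    moreover have "(0, 0) \<in> cells \<alpha>" using that i nth_mem[of 0 \<alpha>]
      by (cases \<alpha>) (auto simp: cells_def compositions_def)
    ultimately show False using SSRCT_D(4)[OF S, of 0 i] stagedD(3)[OF t, of "(0, 0)"] v c that by simp
  qed
qed

lemma cells_lower_row:
  assumes "i < length \<alpha>" "\<alpha> ! i = Suc j"
  shows "cells (\<alpha>[i := j]) = cells \<alpha> - {(i, j)}" "(i, j) \<in> cells \<alpha>"
  using assms by (auto simp: cells_def nth_list_update less_Suc_eq split: if_splits)

lemma mem_cells_lower_row: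
  assumes "i < length \<alpha>" "\<alpha> ! i = Suc j"
  shows "c \<in> cells (\<alpha>[i := j]) \<longleftrightarrow> c \<in> cells \<alpha> \<and> c \<noteq> (i, j)"
  using cells_lower_row[OF assms] by simp

text \<open>
  The removed cell is minimal, so it never occurs as the strictly larger entry demanded by the triple
  condition, and the condition survives the removal.
\<close>

lemma restrict_last_at:
  assumes i: "i < length \<alpha>" "\<alpha> ! i = Suc j" and j: "0 < j" and t: "\<tau> \<in> last_at i w j \<alpha> m"
  shows "restrict \<tau> (cells (\<alpha>[i := j])) \<in> staged w j (\<alpha>[i := j]) (m - Poly_Mapping.single w 1)"
    (is "?\<tau> \<in> staged w j ?\<alpha> ?m")
proof -
  note C = cells_lower_row[OF i]
  note Cin = mem_cells_lower_row[OF i]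
  from t have t: "\<tau> \<in> staged w (Suc j) \<alpha> m" and v: "\<tau> (i, j) = Suc w" by (auto simp: last_at_def)
  note S = stagedD(1)[OF t]
  show ?thesis
  proof (rule stagedI)
    show "?\<tau> \<in> SSRCT ?\<alpha>"
    proof (rule SSRCT_I)
      fix i1 j1 k assume *: "i1 < j1" "(i1, k) \<in> cells ?\<alpha>" "(j1, Suc k) \<in> cells ?\<alpha>" "?\<tau> (j1, Suc k) \<le> ?\<tau> (i1, k)"
      then have "(i1, Suc k) \<in> cells \<alpha> \<and> \<tau> (j1, Suc k) < \<tau> (i1, Suc k)"
        using SSRCT_D(5)[OF S, of i1 j1 k] C(2) by (auto simp: Cin)
      moreover have "Suc w \<le> \<tau> (j1, Suc k)" using * C by (intro stagedD(3)[OF t]) auto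
      moreover have "(i1, Suc k) \<noteq> (i, j)"
      proof
        assume "(i1, Suc k) = (i, j)"
        with v have "\<tau> (i1, Suc k) = Suc w" by simp
        with calculation show False by simp
      qed
      ultimately show "(i1, Suc k) \<in> cells ?\<alpha> \<and> ?\<tau> (j1, Suc k) < ?\<tau> (i1, Suc k)"
        using *(3) C(1) by simp
    next
      fix c assume "c \<in> cells ?\<alpha>"
      then show "0 < ?\<tau> c" using SSRCT_D(1)[OF S] C(2) by (simp add: Cin)
    next
      fix i1 k1 k2 assume "(i1, k1) \<in> cells ?\<alpha>" "(i1, k2) \<in> cells ?\<alpha>" "k1 \<le> k2"
      then show "?\<tau> (i1, k2) \<le> ?\<tau> (i1, k1)" using SSRCT_D(3)[OF S] C(2) by (simp add: Cin)
    next
      fix i1 i2 assume "(i1, 0) \<in> cells ?\<alpha>" "(i2, 0) \<in> cells ?\<alpha>" "i1 < i2"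
      then show "?\<tau> (i1, 0) < ?\<tau> (i2, 0)" using SSRCT_D(4)[OF S] C(2) by (simp add: Cin)
    qed simp
    fix u
    have *: "{c \<in> cells ?\<alpha>. ?\<tau> c = Suc u} = {c \<in> cells \<alpha>. \<tau> c = Suc u} - {(i, j)}"
      unfolding C(1) by (auto simp: restrict_def)
    show "Poly_Mapping.lookup ?m u = card {c \<in> cells ?\<alpha>. ?\<tau> c = Suc u}"
    proof (cases "u = w")
      case True
      then have "(i, j) \<in> {c \<in> cells \<alpha>. \<tau> c = Suc u}" using v C(2) by simp
      then show ?thesis unfolding * using stagedD(2)[OF t, of u] True by (simp add: lookup_minus)
    next
      case False
      then have "(i, j) \<notin> {c \<in> cells \<alpha>. \<tau> c = Suc u}" using v by simp
      then show ?thesis unfolding * using stagedD(2)[OF t, of u] False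
        by (simp add: lookup_minus lookup_single)
    qed
  next
    fix c assume "c \<in> cells ?\<alpha>"
    then show "Suc w \<le> ?\<tau> c" using stagedD(3)[OF t] C(2) by (auto simp: Cin)
  next
    fix i1 k assume c: "(i1, k) \<in> cells ?\<alpha>" "j \<le> k"
    then have c': "(i1, k) \<in> cells \<alpha>" using C(2) by (auto simp: Cin)
    have "Suc w \<noteq> \<tau> (i1, k)"
    proof
      assume e: "Suc w = \<tau> (i1, k)"
      have k: "k = j"
      proof (rule ccontr)
        assume "k \<noteq> j"
        with stagedD(4)[OF t c'] c(2) e show False by simp
      qed
      have "i = i1" by (rule min_unique_in_column[OF t C(2)]) (use c' v e k in simp_all)
      moreover have "(i1, k) \<noteq> (i, j)" using c(1) unfolding Cin by blast
      ultimately show False using k by simp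
    qed
    with stagedD(3)[OF t c'] c(1) show "Suc w < ?\<tau> (i1, k)" by simp
  qed
qed

text \<open>
  The new cell takes part in the triple condition in two roles. As the lower right cell it is
  harmless because every row above that reaches column \<open>j - 1\<close> also reaches column \<open>j\<close>, with an entry
  greater than \<open>w + 1\<close>; as the upper left cell it is harmless because every entry in column \<open>j + 1\<close> exceeds \<open>w + 1\<close>.
\<close>

lemma extend_staged:
  assumes i: "i < length \<alpha>" "\<alpha> ! i = Suc j" "\<And>h. h < i \<Longrightarrow> \<alpha> ! h \<noteq> j" and j: "0 < j"
    and w: "w \<in> Poly_Mapping.keys m"
    and t: "\<tau> \<in> staged w j (\<alpha>[i := j]) (m - Poly_Mapping.single w 1)"
  shows "\<tau>((i, j) := Suc w) \<in> last_at i w j \<alpha> m" (is "?\<tau> \<in> _")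
proof -
  note C = cells_lower_row[OF i(1,2)]
  note Cin = mem_cells_lower_row[OF i(1,2)]
  note S = stagedD(1)[OF t]
  have "?\<tau> \<in> staged w (Suc j) \<alpha> m"
  proof (rule stagedI)
    show "?\<tau> \<in> SSRCT \<alpha>"
    proof (rule SSRCT_I)
      fix i1 k1 k2 assume *: "(i1, k1) \<in> cells \<alpha>" "(i1, k2) \<in> cells \<alpha>" "k1 \<le> k2"
      have "k2 \<le> j" if "i1 = i" using * i that by (auto simp: cells_def)
      then show "?\<tau> (i1, k2) \<le> ?\<tau> (i1, k1)"
        using SSRCT_D(3)[OF S, of i1 k1 k2] stagedD(3)[OF t, of "(i1, k1)"] * C(2) by (auto simp: Cin)
    next
      fix i1 j1 k assume *: "i1 < j1" "(i1, k) \<in> cells \<alpha>" "(j1, Suc k) \<in> cells \<alpha>" "?\<tau> (j1, Suc k) \<le> ?\<tau> (i1, k)"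
      consider "(j1, Suc k) = (i, j)" | "(i1, k) = (i, j)" | "(j1, Suc k) \<noteq> (i, j)" "(i1, k) \<noteq> (i, j)" by blast
      then show "(i1, Suc k) \<in> cells \<alpha> \<and> ?\<tau> (j1, Suc k) < ?\<tau> (i1, Suc k)"
      proof cases
        case 1
        with * i(3)[of i1] have "(i1, Suc k) \<in> cells \<alpha>" "i1 \<noteq> i" by (auto simp: cells_def)
        then show ?thesis using stagedD(4)[OF t, of i1 "Suc k"] 1 by (auto simp: Cin)
      next
        case 2
        then show ?thesis using stagedD(4)[OF t, of j1 "Suc k"] * C(2) by (auto simp: Cin)
      next
        case 3
        moreover have "Suc w \<le> \<tau> (j1, Suc k)" using 3 * C by (intro stagedD(3)[OF t]) auto
        ultimately show ?thesis using SSRCT_D(5)[OF S, of i1 j1 k] * C(2) by (auto simp: Cin)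
      qed
    next
      fix c assume "c \<in> cells \<alpha>"
      then show "0 < ?\<tau> c" using SSRCT_D(1)[OF S, of c] C(2) by (auto simp: Cin)
    next
      fix c assume "c \<notin> cells \<alpha>"
      then show "?\<tau> c = undefined" using SSRCT_D(2)[OF S, of c] C(2) by (auto simp: Cin)
    next
      fix i1 i2 assume "(i1, 0) \<in> cells \<alpha>" "(i2, 0) \<in> cells \<alpha>" "i1 < i2"
      then show "?\<tau> (i1, 0) < ?\<tau> (i2, 0)" using SSRCT_D(4)[OF S, of i1 i2] C(2) j by (simp add: Cin)
    qed
    fix u
    have "{c \<in> cells \<alpha>. ?\<tau> c = Suc u} = {c \<in> cells (\<alpha>[i := j]). \<tau> c = Suc u} \<union> (if u = w then {(i, j)} else {})"
      unfolding C(1) using C(2) by auto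
    moreover have "Poly_Mapping.lookup m u = Poly_Mapping.lookup (m - Poly_Mapping.single w 1) u + (if u = w then 1 else 0)"
      using w by (auto simp: lookup_minus lookup_single in_keys_iff)
    moreover have "finite {c \<in> cells (\<alpha>[i := j]). \<tau> c = Suc u}" using finite_cells by simp
    ultimately show "Poly_Mapping.lookup m u = card {c \<in> cells \<alpha>. ?\<tau> c = Suc u}"
      using stagedD(2)[OF t, of u] unfolding C(1) by (simp add: card_Un_disjoint)
  next
    fix c assume "c \<in> cells \<alpha>"
    then show "Suc w \<le> ?\<tau> c" using stagedD(3)[OF t, of c] C(2) by (auto simp: Cin)
  next
    fix i1 k assume c: "(i1, k) \<in> cells \<alpha>" "Suc j \<le> k"
    then show "Suc w < ?\<tau> (i1, k)" using stagedD(4)[OF t, of i1 k] C(2) by (auto simp: Cin)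
  qed
  then show ?thesis using C by (simp add: last_at_def)
qed

lemma card_last_at:
  assumes "i < length \<alpha>" "\<alpha> ! i = Suc j" "\<And>h. h < i \<Longrightarrow> \<alpha> ! h \<noteq> j" "0 < j" "w \<in> Poly_Mapping.keys m"
  shows "card (last_at i w j \<alpha> m) = card (staged w j (\<alpha>[i := j]) (m - Poly_Mapping.single w 1))"
proof (rule bij_betw_same_card)
  note C = cells_lower_row[OF assms(1,2)]
  note Cin = mem_cells_lower_row[OF assms(1,2)]
  show "bij_betw (\<lambda>\<tau>. restrict \<tau> (cells (\<alpha>[i := j]))) (last_at i w j \<alpha> m)
      (staged w j (\<alpha>[i := j]) (m - Poly_Mapping.single w 1))"
  proof (rule bij_betwI[where g = "\<lambda>\<tau>. \<tau>((i, j) := Suc w)"])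
    show "(\<lambda>\<tau>. restrict \<tau> (cells (\<alpha>[i := j]))) \<in> last_at i w j \<alpha> m \<rightarrow> staged w j (\<alpha>[i := j]) (m - Poly_Mapping.single w 1)"
      using restrict_last_at[OF assms(1,2,4)] by simp
    show "(\<lambda>\<tau>. \<tau>((i, j) := Suc w)) \<in> staged w j (\<alpha>[i := j]) (m - Poly_Mapping.single w 1) \<rightarrow> last_at i w j \<alpha> m"
      using extend_staged[OF assms] by simp
  next
    fix \<tau> assume t: "\<tau> \<in> last_at i w j \<alpha> m"
    then have "\<tau> (i, j) = Suc w" "\<And>c. c \<notin> cells \<alpha> \<Longrightarrow> \<tau> c = undefined"
      using SSRCT_D(2)[OF stagedD(1)] by (auto simp: last_at_def)
    then show "(restrict \<tau> (cells (\<alpha>[i := j])))((i, j) := Suc w) = \<tau>"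
      using C(2) by (auto simp: fun_eq_iff restrict_def Cin)
  next
    fix \<tau> assume t: "\<tau> \<in> staged w j (\<alpha>[i := j]) (m - Poly_Mapping.single w 1)"
    then have "\<And>c. c \<notin> cells (\<alpha>[i := j]) \<Longrightarrow> \<tau> c = undefined"
      using SSRCT_D(2)[OF stagedD(1)] by auto
    then show "restrict (\<tau>((i, j) := Suc w)) (cells (\<alpha>[i := j])) = \<tau>"
      using C(2) by (auto simp: fun_eq_iff restrict_def Cin)
  qed
qed

lemma mem_cells_Cons:
  "(i, k) \<in> cells (a # \<alpha>) \<longleftrightarrow> i = 0 \<and> k < a \<or> (\<exists>h. i = Suc h \<and> (h, k) \<in> cells \<alpha>)"
  by (cases i) (auto simp: cells_def)

text \<open>
  In column 0 the last cell is the whole top row, so that removing it shifts all other rows.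
\<close>

lemma card_last_at_0:
  assumes "w \<in> Poly_Mapping.keys m"
  shows "card (last_at 0 w 0 (Suc 0 # \<alpha>) m) = card (staged w 0 \<alpha> (m - Poly_Mapping.single w 1))"
proof (rule bij_betw_same_card)
  let ?down = "\<lambda>(\<tau> :: nat \<times> nat \<Rightarrow> nat) (i, k). \<tau> (Suc i, k)"
  let ?up = "\<lambda>(\<tau> :: nat \<times> nat \<Rightarrow> nat) (i, k).
    if i = 0 then (if k = 0 then Suc w else undefined) else \<tau> (i - 1, k)"
  have C [simp]: "(i, k) \<in> cells (Suc 0 # \<alpha>) \<longleftrightarrow> (i = 0 \<and> k = 0 \<or> (\<exists>i'. i = Suc i' \<and> (i', k) \<in> cells \<alpha>))" for i k
    by (auto simp: mem_cells_Cons)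
  show "bij_betw ?down (last_at 0 w 0 (Suc 0 # \<alpha>) m) (staged w 0 \<alpha> (m - Poly_Mapping.single w 1))"
  proof (rule bij_betwI[where g = ?up])
    show "?down \<in> last_at 0 w 0 (Suc 0 # \<alpha>) m \<rightarrow> staged w 0 \<alpha> (m - Poly_Mapping.single w 1)"
    proof
      fix \<tau> assume "\<tau> \<in> last_at 0 w 0 (Suc 0 # \<alpha>) m"
      then have t: "\<tau> \<in> staged w (Suc 0) (Suc 0 # \<alpha>) m" and v: "\<tau> (0, 0) = Suc w" by (auto simp: last_at_def)
      note S = stagedD(1)[OF t]
      have big: "Suc w < \<tau> (Suc i, k)" if "(i, k) \<in> cells \<alpha>" for i k
      proof (cases "k = 0")
        case True
        then show ?thesis using SSRCT_D(4)[OF S, of 0 "Suc i"] that v by simp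
      next
        case False
        then show ?thesis using stagedD(4)[OF t, of "Suc i" k] that by simp
      qed
      show "?down \<tau> \<in> staged w 0 \<alpha> (m - Poly_Mapping.single w 1)"
      proof (rule stagedI)
        show "?down \<tau> \<in> SSRCT \<alpha>"
        proof (rule SSRCT_I)
          fix i j k assume "i < j" "(i, k) \<in> cells \<alpha>" "(j, Suc k) \<in> cells \<alpha>" "?down \<tau> (j, Suc k) \<le> ?down \<tau> (i, k)"
          then show "(i, Suc k) \<in> cells \<alpha> \<and> ?down \<tau> (j, Suc k) < ?down \<tau> (i, Suc k)"
            using SSRCT_D(5)[OF S, of "Suc i" "Suc j" k] by simp
        next
          fix c assume "c \<in> cells \<alpha>"
          then show "0 < ?down \<tau> c" using SSRCT_D(1)[OF S, of "(Suc (fst c), snd c)"] by (cases c) simp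
        next
          fix c assume "c \<notin> cells \<alpha>"
          then show "?down \<tau> c = undefined" using SSRCT_D(2)[OF S, of "(Suc (fst c), snd c)"] by (cases c) simp
        next
          fix i k1 k2 assume "(i, k1) \<in> cells \<alpha>" "(i, k2) \<in> cells \<alpha>" "k1 \<le> k2"
          then show "?down \<tau> (i, k2) \<le> ?down \<tau> (i, k1)" using SSRCT_D(3)[OF S, of "Suc i"] by simp
        next
          fix i1 i2 assume "(i1, 0) \<in> cells \<alpha>" "(i2, 0) \<in> cells \<alpha>" "i1 < i2"
          then show "?down \<tau> (i1, 0) < ?down \<tau> (i2, 0)" using SSRCT_D(4)[OF S, of "Suc i1" "Suc i2"] by simp
        qed
        fix u
        have "{c \<in> cells (Suc 0 # \<alpha>). \<tau> c = Suc u} =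
           (\<lambda>(i, k). (Suc i, k)) ` {c \<in> cells \<alpha>. ?down \<tau> c = Suc u} \<union> (if u = w then {(0, 0)} else {})"
          (is "?L = ?R")
        proof (rule Set.set_eqI)
          fix c :: "nat \<times> nat"
          obtain i k where "c = (i, k)" by fastforce
          then show "c \<in> ?L \<longleftrightarrow> c \<in> ?R" using v by (cases i) (auto simp: image_iff)
        qed
        moreover have "card ((\<lambda>(i, k). (Suc i, k)) ` {c \<in> cells \<alpha>. ?down \<tau> c = Suc u}) = card {c \<in> cells \<alpha>. ?down \<tau> c = Suc u}"
          by (rule card_image) (auto intro: inj_onI)
        moreover have "finite {c \<in> cells \<alpha>. ?down \<tau> c = Suc u}" using finite_cells by simp
        ultimately have "card {c \<in> cells (Suc 0 # \<alpha>). \<tau> c = Suc u} =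
            card {c \<in> cells \<alpha>. ?down \<tau> c = Suc u} + (if u = w then 1 else 0)"
          by (simp only:) (subst card_Un_disjoint, auto)
        then show "Poly_Mapping.lookup (m - Poly_Mapping.single w 1) u = card {c \<in> cells \<alpha>. ?down \<tau> c = Suc u}"
          using stagedD(2)[OF t, of u] by (auto simp: lookup_minus lookup_single)
      qed (use big in \<open>auto simp: less_imp_le split: prod.splits\<close>)
    qed
    show "?up \<in> staged w 0 \<alpha> (m - Poly_Mapping.single w 1) \<rightarrow> last_at 0 w 0 (Suc 0 # \<alpha>) m"
    proof
      fix \<tau> assume t: "\<tau> \<in> staged w 0 \<alpha> (m - Poly_Mapping.single w 1)"
      note S = stagedD(1)[OF t]
      have big: "Suc w < \<tau> (i, k)" if "(i, k) \<in> cells \<alpha>" for i k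
        using stagedD(4)[OF t that] by simp
      have "?up \<tau> \<in> staged w (Suc 0) (Suc 0 # \<alpha>) m"
      proof (rule stagedI)
        show "?up \<tau> \<in> SSRCT (Suc 0 # \<alpha>)"
        proof (rule SSRCT_I)
          fix i j k assume *: "i < j" "(i, k) \<in> cells (Suc 0 # \<alpha>)" "(j, Suc k) \<in> cells (Suc 0 # \<alpha>)" "?up \<tau> (j, Suc k) \<le> ?up \<tau> (i, k)"
          from * obtain j' where j: "j = Suc j'" "(j', Suc k) \<in> cells \<alpha>" by auto
          show "(i, Suc k) \<in> cells (Suc 0 # \<alpha>) \<and> ?up \<tau> (j, Suc k) < ?up \<tau> (i, Suc k)"
          proof (cases i)
            case 0
            with * j big[OF j(2)] show ?thesis by simp
          next
            case (Suc i')
            with * j SSRCT_D(5)[OF S, of i' j' k] show ?thesis by simp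
          qed
        next
          fix c assume "c \<in> cells (Suc 0 # \<alpha>)"
          then show "0 < ?up \<tau> c" using SSRCT_D(1)[OF S, of "(fst c - 1, snd c)"] by (cases c) auto
        next
          fix c assume "c \<notin> cells (Suc 0 # \<alpha>)"
          then show "?up \<tau> c = undefined" using SSRCT_D(2)[OF S, of "(fst c - 1, snd c)"]
            by (cases c) (auto simp: gr0_conv_Suc)
        next
          fix i k1 k2 assume "(i, k1) \<in> cells (Suc 0 # \<alpha>)" "(i, k2) \<in> cells (Suc 0 # \<alpha>)" "k1 \<le> k2"
          then show "?up \<tau> (i, k2) \<le> ?up \<tau> (i, k1)" using SSRCT_D(3)[OF S, of "i - 1" k1 k2] by auto
        next
          fix i1 i2 assume "(i1, 0) \<in> cells (Suc 0 # \<alpha>)" "(i2, 0) \<in> cells (Suc 0 # \<alpha>)" "i1 < i2"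
          then show "?up \<tau> (i1, 0) < ?up \<tau> (i2, 0)"
            using SSRCT_D(4)[OF S, of "i1 - 1" "i2 - 1"] big[of "i2 - 1" 0] by auto
        qed
        fix u
        have "{c \<in> cells (Suc 0 # \<alpha>). ?up \<tau> c = Suc u} =
           (\<lambda>(i, k). (Suc i, k)) ` {c \<in> cells \<alpha>. \<tau> c = Suc u} \<union> (if u = w then {(0, 0)} else {})"
          (is "?L = ?R")
        proof (rule Set.set_eqI)
          fix c :: "nat \<times> nat"
          obtain i k where "c = (i, k)" by fastforce
          then show "c \<in> ?L \<longleftrightarrow> c \<in> ?R" by (cases i) (auto simp: image_iff)
        qed
        moreover have "card ((\<lambda>(i, k). (Suc i, k)) ` {c \<in> cells \<alpha>. \<tau> c = Suc u}) = card {c \<in> cells \<alpha>. \<tau> c = Suc u}"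
          by (rule card_image) (auto intro: inj_onI)
        moreover have "finite {c \<in> cells \<alpha>. \<tau> c = Suc u}" using finite_cells by simp
        moreover have m: "Poly_Mapping.lookup m u = Poly_Mapping.lookup (m - Poly_Mapping.single w 1) u + (if u = w then 1 else 0)"
          using assms by (auto simp: lookup_minus lookup_single in_keys_iff)
        ultimately have "card {c \<in> cells (Suc 0 # \<alpha>). ?up \<tau> c = Suc u} =
            card {c \<in> cells \<alpha>. \<tau> c = Suc u} + (if u = w then 1 else 0)"
          by (simp only:) (subst card_Un_disjoint, auto)
        then show "Poly_Mapping.lookup m u = card {c \<in> cells (Suc 0 # \<alpha>). ?up \<tau> c = Suc u}"
          using stagedD(2)[OF t, of u] m by simp
      qed (use big in \<open>auto simp: less_imp_le split: prod.splits\<close>)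
      then show "?up \<tau> \<in> last_at 0 w 0 (Suc 0 # \<alpha>) m" by (simp add: last_at_def)
    qed
  next
    fix \<tau> assume "\<tau> \<in> last_at 0 w 0 (Suc 0 # \<alpha>) m"
    then have "\<tau> (0, 0) = Suc w" "\<And>c. c \<notin> cells (Suc 0 # \<alpha>) \<Longrightarrow> \<tau> c = undefined"
      using SSRCT_D(2)[OF stagedD(1)] by (auto simp: last_at_def)
    then show "?up (?down \<tau>) = \<tau>" by (auto simp: fun_eq_iff gr0_conv_Suc)
  next
    fix \<tau> assume t: "\<tau> \<in> staged w 0 \<alpha> (m - Poly_Mapping.single w 1)"
    show "?down (?up \<tau>) = \<tau>" by (auto simp: fun_eq_iff)
  qed
qed

text \<open>
  The generating function of the tableaux at a given stage.
\<close>

definition stage_series :: "nat \<Rightarrow> nat \<Rightarrow> nat list \<Rightarrow> power_series" where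
  "stage_series w j \<alpha> m = of_nat (card (staged w j \<alpha> m))"

lemma last_at_nonempty_keys:
  assumes "\<tau> \<in> last_at i w j \<alpha> m"
  shows "w \<in> Poly_Mapping.keys m"
proof -
  from assms have "\<tau> \<in> staged w (Suc j) \<alpha> m" "(i, j) \<in> {c \<in> cells \<alpha>. \<tau> c = Suc w}"
    by (auto simp: last_at_def)
  then have "Poly_Mapping.lookup m w \<noteq> 0"
    using stagedD(2)[of \<tau> w "Suc j" \<alpha> m w] finite_cells[of \<alpha>] by auto
  then show ?thesis by (simp add: in_keys_iff)
qed

lemma sum_card_last_at:
  assumes "\<alpha> \<in> compositions" "w \<in> Poly_Mapping.keys m"
  shows "(\<Sum>i<length \<alpha>. card (last_at i w j \<alpha> m)) =
    (\<Sum>\<gamma>\<in>raise_preimage j \<alpha>. card (staged w j \<gamma> (m - Poly_Mapping.single w 1)))"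
proof (cases j)
  case 0
  show ?thesis
  proof (cases "\<exists>\<gamma>. \<alpha> = Suc 0 # \<gamma>")
    case True
    then obtain \<gamma> where \<gamma>: "\<alpha> = Suc 0 # \<gamma>" by blast
    have R: "raise_preimage j \<alpha> = {\<gamma>}" using assms(1) 0 \<gamma> by (auto simp: raise_preimage_def compositions_def)
    have "(\<Sum>i<length \<alpha>. card (last_at i w j \<alpha> m)) = (\<Sum>i\<in>{0}. card (last_at i w j \<alpha> m))"
    proof (rule sum.mono_neutral_right)
      show "\<forall>i\<in>{..<length \<alpha>} - {0}. card (last_at i w j \<alpha> m) = 0"
        using last_at_row_length(4)[OF _ 0 assms(1)] by (metis DiffD2 card.empty ex_in_conv insertI1)
    qed (auto simp: \<gamma>)
    also have "\<dots> = card (staged w j \<gamma> (m - Poly_Mapping.single w 1))"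
      using card_last_at_0[OF assms(2), of \<gamma>] by (simp add: 0 \<gamma>)
    finally show ?thesis unfolding R by simp
  next
    case False
    have "last_at i w j \<alpha> m = {}" for i
    proof (rule ccontr)
      assume "last_at i w j \<alpha> m \<noteq> {}"
      then obtain \<tau> where t: "\<tau> \<in> last_at i w j \<alpha> m" by blast
      then have "0 < length \<alpha>" "\<alpha> ! 0 = Suc 0"
        using last_at_row_length(1,2)[OF t] last_at_row_length(4)[OF t 0 assms(1)] 0 by auto
      with False show False by (cases \<alpha>) auto
    qed
    moreover have "raise_preimage j \<alpha> = {}" using False 0 by (auto simp: raise_preimage_def)
    ultimately show ?thesis by simp
  qed
next
  case (Suc l)
  \<comment> \<open>the rows whose last cell may be removed\<close>
  define I where "I = {i. i < length \<alpha> \<and> \<alpha> ! i = Suc j \<and> (\<forall>h<i. \<alpha> ! h \<noteq> j)}"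
  have R: "raise_preimage j \<alpha> = (\<lambda>i. \<alpha>[i := j]) ` I"
    using raise_first_Suc_iff[of l _ \<alpha>] raise_first_compositions[of "Suc l" _ \<alpha>] assms(1)
    unfolding I_def raise_preimage_def Suc by auto
  have inj: "inj_on (\<lambda>i. \<alpha>[i := j]) I"
  proof (rule inj_onI)
    fix i i' assume "i \<in> I" "i' \<in> I" "\<alpha>[i := j] = \<alpha>[i' := j]"
    then have "\<alpha>[i := j] ! i = \<alpha>[i' := j] ! i" "i < length \<alpha>" "\<alpha> ! i = Suc j" by (auto simp: I_def)
    then show "i = i'" by (cases "i = i'") auto
  qed
  have "(\<Sum>i<length \<alpha>. card (last_at i w j \<alpha> m)) = (\<Sum>i\<in>I. card (last_at i w j \<alpha> m))"
  proof (rule sum.mono_neutral_right)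
    show "\<forall>i\<in>{..<length \<alpha>} - I. card (last_at i w j \<alpha> m) = 0"
    proof
      fix i assume i: "i \<in> {..<length \<alpha>} - I"
      have "\<tau> \<notin> last_at i w j \<alpha> m" for \<tau>
        using last_at_row_length(1-3)[of \<tau> i w j \<alpha> m] i Suc by (auto simp: I_def)
      then show "card (last_at i w j \<alpha> m) = 0" by (metis card.empty ex_in_conv)
    qed
  qed (auto simp: I_def)
  also have "\<dots> = (\<Sum>i\<in>I. card (staged w j (\<alpha>[i := j]) (m - Poly_Mapping.single w 1)))"
    using card_last_at[OF _ _ _ _ assms(2)] Suc by (intro sum.cong) (auto simp: I_def)
  also have "\<dots> = (\<Sum>\<gamma>\<in>raise_preimage j \<alpha>. card (staged w j \<gamma> (m - Poly_Mapping.single w 1)))"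
    unfolding R by (simp add: sum.reindex[OF inj])
  finally show ?thesis .
qed

text \<open>
  Admitting the entry \<open>w + 1\<close> in one further column either changes nothing or adds one cell, that is,
  the family of generating functions is transformed by \<open>1 + x\<^sub>w A\<close> with \<open>A\<close> the transposed raising
  operator of that column.
\<close>

lemma stage_series_Suc:
  assumes "\<alpha> \<in> compositions"
  shows "stage_series w (Suc j) \<alpha> m = stage_series w j \<alpha> m +
    (if w \<in> Poly_Mapping.keys m
     then \<Sum>\<gamma>\<in>raise_preimage j \<alpha>. stage_series w j \<gamma> (m - Poly_Mapping.single w 1) else 0)"
proof -
  have fin: "finite (last_at i w j \<alpha> m)" for i
    by (rule finite_subset[OF _ finite_staged[of w "Suc j" \<alpha> m]]) (auto simp: last_at_def)
  have disj: "staged w j \<alpha> m \<inter> (\<Union>i<length \<alpha>. last_at i w j \<alpha> m) = {}"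
    using stagedD(4)[of _ w j \<alpha> m] by (fastforce simp: last_at_def)
  have disj': "last_at i w j \<alpha> m \<inter> last_at i' w j \<alpha> m = {}" if "i \<noteq> i'" for i i'
    using min_unique_in_column[of _ w "Suc j" \<alpha> m i j i'] that by (auto simp: last_at_def)
  have "card (staged w (Suc j) \<alpha> m) = card (staged w j \<alpha> m) + card (\<Union>i<length \<alpha>. last_at i w j \<alpha> m)"
    unfolding staged_Suc_eq by (rule card_Un_disjoint) (use finite_staged fin disj in auto)
  also have "card (\<Union>i<length \<alpha>. last_at i w j \<alpha> m) = (\<Sum>i<length \<alpha>. card (last_at i w j \<alpha> m))"
    by (rule card_UN_disjoint) (use fin disj' in auto)
  also have "\<dots> = (if w \<in> Poly_Mapping.keys m
     then \<Sum>\<gamma>\<in>raise_preimage j \<alpha>. card (staged w j \<gamma> (m - Poly_Mapping.single w 1)) else 0)"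
  proof (cases "w \<in> Poly_Mapping.keys m")
    case True
    then show ?thesis using sum_card_last_at[OF assms] by simp
  next
    case False
    then have "last_at i w j \<alpha> m = {}" for i using last_at_nonempty_keys by blast
    then show ?thesis using False by simp
  qed
  finally show ?thesis by (simp add: stage_series_def)
qed

text \<open>
  A column bound beyond every row is no restriction, so that the stages for consecutive entries fit
  together.
\<close>

lemma staged_0:
  assumes "\<And>a. a \<in> set \<alpha> \<Longrightarrow> a \<le> J"
  shows "staged w 0 \<alpha> m = staged (Suc w) J \<alpha> m"
proof -
  have "snd c < J" if "c \<in> cells \<alpha>" for c
    using that assms[OF nth_mem] by (fastforce simp: cells_def)
  then show ?thesis unfolding staged_def by (auto simp: Suc_lessI)
qed

lemma stage_series_qschur:
  assumes "\<And>a. a \<in> set \<alpha> \<Longrightarrow> a \<le> J"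
  shows "stage_series 0 J \<alpha> m = qschur \<alpha> m"
proof -
  have *: "snd c < J" if "c \<in> cells \<alpha>" for c
    using that assms[OF nth_mem] by (fastforce simp: cells_def)
  have "staged 0 J \<alpha> m = SSRCT_weight \<alpha> m"
  proof -
    have "Suc 0 < \<tau> c \<or> \<tau> c = Suc 0 \<and> snd c < J" if "\<tau> \<in> SSRCT_weight \<alpha> m" "c \<in> cells \<alpha>" for \<tau> c
    proof -
      have "0 < \<tau> c" using that SSRCT_D(1)[of \<tau> \<alpha> c] by (simp add: SSRCT_weight_def)
      with *[OF that(2)] show ?thesis by linarith
    qed
    then show ?thesis unfolding staged_def by blast
  qed
  then show ?thesis by (simp add: stage_series_def qschur_def)
qed

text \<open>
  The start of the construction: no cell can carry an entry whose variable does not occur.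
\<close>

lemma stage_series_beyond_keys:
  assumes "Poly_Mapping.keys m \<subseteq> {..<N}" "\<beta> \<in> compositions" "\<beta> \<noteq> []"
  shows "stage_series N j \<beta> m = 0"
proof -
  have "staged N j \<beta> m = {}"
  proof (rule ccontr)
    assume "staged N j \<beta> m \<noteq> {}"
    then obtain \<tau> where t: "\<tau> \<in> staged N j \<beta> m" by blast
    have c: "(0, 0) \<in> cells \<beta>" using assms(2,3) by (cases \<beta>) (auto simp: cells_def compositions_def)
    define v where "v = \<tau> (0, 0) - 1"
    have v: "\<tau> (0, 0) = Suc v" "N \<le> v" using stagedD(3)[OF t c] by (auto simp: v_def)
    then have "{c \<in> cells \<beta>. \<tau> c = Suc v} \<noteq> {}" using c by blast
    then have "Poly_Mapping.lookup m v \<noteq> 0"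
      unfolding stagedD(2)[OF t, of v] using finite_cells[of \<beta>] by (simp add: card_eq_0_iff)
    then have "v \<in> Poly_Mapping.keys m" by (simp add: in_keys_iff)
    then show False using assms(1) v by auto
  qed
  then show ?thesis by (simp add: stage_series_def)
qed


section \<open>The Pieri rule for one box\<close>

definition times_var :: "nat \<Rightarrow> power_series \<Rightarrow> power_series" where
  "times_var i f m = (if i \<in> Poly_Mapping.keys m then f (m - Poly_Mapping.single i 1) else 0)"

lemma keys_minus_single_subset: "Poly_Mapping.keys (m - Poly_Mapping.single i 1) \<subseteq> Poly_Mapping.keys (m :: monomial)"
  by (auto simp: in_keys_iff lookup_minus)

lemma keys_minus_single_other: "i \<noteq> w \<Longrightarrow> w \<in> Poly_Mapping.keys (m - Poly_Mapping.single i 1) \<longleftrightarrow> w \<in> Poly_Mapping.keys (m :: monomial)"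
  by (auto simp: in_keys_iff lookup_minus lookup_single)

lemma minus_single_commute: "m - Poly_Mapping.single i 1 - Poly_Mapping.single w 1 = m - Poly_Mapping.single w 1 - Poly_Mapping.single i (1::nat)"
  by (auto intro!: poly_mapping_eqI simp: lookup_minus)

text \<open>
  The Pieri rule holds at every stage in a corrected form: multiplication by the variables already
  completed, plus \<open>x\<^sub>w\<close> for the variable in progress unless \<open>\<alpha>\<close> has a part \<open>j\<close>. Passing to the next
  column, the defect of the commutation relation replaces the condition on part \<open>j\<close> by that on part
  \<open>j + 1\<close>; this is the telescoping. The correction also fits the terms that acquire a new cell, since a
  source of raising has a part \<open>j\<close> and a target has a part \<open>j + 1\<close>.
\<close>

lemma stage_pieri_step:
  assumes IH: "\<And>\<alpha> m. \<alpha> \<in> compositions \<Longrightarrow> Poly_Mapping.keys m \<subseteq> {..<N} \<Longrightarrow>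
      (\<Sum>\<beta>\<in>pieri_up \<alpha>. stage_series w j \<beta> m) =
      (\<Sum>i\<in>{w<..<N}. times_var i (stage_series w j \<alpha>) m)
        + of_bool (\<not> has_part j \<alpha>) * times_var w (stage_series w j \<alpha>) m"
    and a: "\<alpha> \<in> compositions" and m: "Poly_Mapping.keys m \<subseteq> {..<N}"
  shows "(\<Sum>\<beta>\<in>pieri_up \<alpha>. stage_series w (Suc j) \<beta> m) =
      (\<Sum>i\<in>{w<..<N}. times_var i (stage_series w (Suc j) \<alpha>) m)
        + of_bool (\<not> has_part (Suc j) \<alpha>) * times_var w (stage_series w (Suc j) \<alpha>) m"
proof -
  let ?F = "stage_series w j" and ?G = "stage_series w (Suc j)"
  have up: "\<beta> \<in> compositions" if "\<beta> \<in> pieri_up \<alpha>" for \<beta> using that by (simp add: pieri_up_def)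
  show ?thesis
  proof (cases "w \<in> Poly_Mapping.keys m")
    case False
    have "times_var i (?G \<alpha>) m = times_var i (?F \<alpha>) m" if "i \<in> {w<..<N}" for i
    proof -
      have "i \<noteq> w" using that by auto
      then show ?thesis using stage_series_Suc[OF a] False keys_minus_single_other[of i w m]
        by (simp add: times_var_def)
    qed
    then show ?thesis using False IH[OF a m] stage_series_Suc[OF up]
      by (simp add: times_var_def)
  next
    case True
    define m' where "m' = m - Poly_Mapping.single w 1"
    have m': "Poly_Mapping.keys m' \<subseteq> {..<N}"
      using m keys_minus_single_subset[of m w] unfolding m'_def by blast
    have X: "times_var i (?G \<alpha>) m = times_var i (?F \<alpha>) m + (\<Sum>\<delta>\<in>raise_preimage j \<alpha>. times_var i (?F \<delta>) m')"
      if "i \<in> {w<..<N}" for i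
    proof -
      have iw: "i \<noteq> w" using that by auto
      show ?thesis
      proof (cases "i \<in> Poly_Mapping.keys m")
        case i: True
        then show ?thesis
          using stage_series_Suc[OF a] True keys_minus_single_other[OF iw, of m] keys_minus_single_other[OF iw[symmetric], of m]
          by (simp add: times_var_def m'_def minus_single_commute[of m i w] del: One_nat_def)
      next
        case i: False
        then show ?thesis using keys_minus_single_other[OF iw[symmetric], of m] by (simp add: times_var_def m'_def)
      qed
    qed
    have D: "(\<Sum>\<gamma>\<in>pieri_up \<delta>. ?F \<gamma> m') = (\<Sum>i\<in>{w<..<N}. times_var i (?F \<delta>) m')"
      if "\<delta> \<in> raise_preimage j \<alpha>" for \<delta>
    proof -
      have "\<delta> \<in> compositions" "has_part j \<delta>"
        using that raise_first_eq_None[of j \<delta>] by (auto simp: raise_preimage_def)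
      then show ?thesis using IH[OF _ m', of \<delta>] by simp
    qed
    have E: "of_bool (\<not> has_part (Suc j) \<alpha>) * ?G \<alpha> m' = of_bool (\<not> has_part (Suc j) \<alpha>) * ?F \<alpha> m'"
    proof (cases "has_part (Suc j) \<alpha>")
      case False
      then have "raise_preimage j \<alpha> = {}" using raise_first_has_part by (auto simp: raise_preimage_def)
      then show ?thesis using stage_series_Suc[OF a, of w j m'] by simp
    qed simp
    have "(\<Sum>\<beta>\<in>pieri_up \<alpha>. ?G \<beta> m) = (\<Sum>\<beta>\<in>pieri_up \<alpha>. ?F \<beta> m) + (\<Sum>\<beta>\<in>pieri_up \<alpha>. \<Sum>\<gamma>\<in>raise_preimage j \<beta>. ?F \<gamma> m')"
      unfolding sum.distrib[symmetric] m'_def using stage_series_Suc[OF up] True by (intro sum.cong) auto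
    also have "\<dots> = (\<Sum>i\<in>{w<..<N}. times_var i (?F \<alpha>) m) + of_bool (\<not> has_part j \<alpha>) * ?F \<alpha> m'
        + ((\<Sum>\<delta>\<in>raise_preimage j \<alpha>. \<Sum>i\<in>{w<..<N}. times_var i (?F \<delta>) m')
        + (of_bool (has_part j \<alpha>) - of_bool (has_part (Suc j) \<alpha>)) * ?F \<alpha> m')"
      unfolding sum_pieri_up_raise_preimage[OF a] IH[OF a m] using D True by (simp add: times_var_def m'_def)
    also have "\<dots> = (\<Sum>i\<in>{w<..<N}. times_var i (?G \<alpha>) m) + of_bool (\<not> has_part (Suc j) \<alpha>) * ?F \<alpha> m'"
      by (subst sum.swap) (simp add: X sum.distrib algebra_simps of_bool_def)
    also have "\<dots> = (\<Sum>i\<in>{w<..<N}. times_var i (?G \<alpha>) m) + of_bool (\<not> has_part (Suc j) \<alpha>) * times_var w (?G \<alpha>) m"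
      using E True by (auto simp: times_var_def m'_def)
    finally show ?thesis .
  qed
qed

text \<open>
  Before the first column, part 0 counts as present and \<open>x\<^sub>w\<close> is absent; after the last column, no part
  is that large and \<open>x\<^sub>w\<close> has been completed.
\<close>

lemma stage_pieri:
  assumes "w \<le> N" "\<alpha> \<in> compositions" "Poly_Mapping.keys m \<subseteq> {..<N}"
  shows "(\<Sum>\<beta>\<in>pieri_up \<alpha>. stage_series w j \<beta> m) =
      (\<Sum>i\<in>{w<..<N}. times_var i (stage_series w j \<alpha>) m)
        + of_bool (\<not> has_part j \<alpha>) * times_var w (stage_series w j \<alpha>) m"
  using assms
proof (induction w arbitrary: \<alpha> m j rule: inc_induct)
  case base
  have "stage_series N j \<beta> m = 0" if "\<beta> \<in> pieri_up \<alpha>" for \<beta>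
    using that by (intro stage_series_beyond_keys base) (auto simp: pieri_up_def)
  moreover have "N \<notin> Poly_Mapping.keys m" using base by auto
  ultimately show ?case by (simp add: times_var_def)
next
  case (step w)
  show ?case using step.prems
  proof (induction j arbitrary: \<alpha> m)
    case 0
    \<comment> \<open>larger than all parts of \<open>\<alpha>\<close>, and at least as large as those of its upper neighbours\<close>
    define J where "J = Suc (Suc (sum_list \<alpha>))"
    have J: "a \<le> J" if "\<beta> = \<alpha> \<or> \<beta> \<in> pieri_up \<alpha>" "a \<in> set \<beta>" for a \<beta>
      using that member_le_sum_list[of a \<beta>] by (auto simp: J_def pieri_up_def dest: lower_last_sum_list)
    have eq: "stage_series w 0 \<beta> = stage_series (Suc w) J \<beta>" if "\<beta> = \<alpha> \<or> \<beta> \<in> pieri_up \<alpha>" for \<beta>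
      using staged_0[OF J[OF that]] by (simp add: stage_series_def fun_eq_iff)
    have "\<not> has_part J \<alpha>" using member_le_sum_list[of J \<alpha>] by (auto simp: has_part_def J_def)
    then have "(\<Sum>\<beta>\<in>pieri_up \<alpha>. stage_series w 0 \<beta> m) =
        (\<Sum>i\<in>{Suc w<..<N}. times_var i (stage_series w 0 \<alpha>) m) + times_var (Suc w) (stage_series w 0 \<alpha>) m"
      using step.IH[OF 0, of J] eq by simp
    also have "\<dots> = (\<Sum>i\<in>{w<..<N}. times_var i (stage_series w 0 \<alpha>) m)"
    proof (cases "Suc w = N")
      case True
      then have "Suc w \<notin> Poly_Mapping.keys m" "{w<..<N} = {}" using 0 by auto
      then show ?thesis using True by (simp add: times_var_def)
    next
      case False
      then have "{w<..<N} = insert (Suc w) {Suc w<..<N}" using step.hyps by auto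
      then show ?thesis by simp
    qed
    finally show ?case by (simp add: has_part_def)
  next
    case (Suc j)
    show ?case by (rule stage_pieri_step[OF Suc.IH Suc.prems])
  qed
qed

lemma sum_qschur_pieri_up:
  assumes "\<alpha> \<in> compositions"
  shows "(\<Sum>\<beta>\<in>pieri_up \<alpha>. qschur \<beta> m) = (\<Sum>i\<in>Poly_Mapping.keys m. qschur \<alpha> (m - Poly_Mapping.single i 1))"
proof -
  obtain N where N: "Poly_Mapping.keys m \<subseteq> {..<N}"
    using finite_nat_set_iff_bounded[of "Poly_Mapping.keys m"] by auto
  define J where "J = Suc (Suc (sum_list \<alpha>))"
  have J: "a \<le> J" if "\<beta> = \<alpha> \<or> \<beta> \<in> pieri_up \<alpha>" "a \<in> set \<beta>" for a \<beta>
    using that member_le_sum_list[of a \<beta>] by (auto simp: J_def pieri_up_def dest: lower_last_sum_list)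
  have eq: "stage_series 0 J \<beta> = qschur \<beta>" if "\<beta> = \<alpha> \<or> \<beta> \<in> pieri_up \<alpha>" for \<beta>
    using stage_series_qschur[OF J[OF that]] by (simp add: fun_eq_iff)
  have nJ: "\<not> has_part J \<alpha>" using member_le_sum_list[of J \<alpha>] by (auto simp: has_part_def J_def)
  have "(\<Sum>\<beta>\<in>pieri_up \<alpha>. qschur \<beta> m) = (\<Sum>i\<in>{0<..<Suc N}. times_var i (qschur \<alpha>) m) + times_var 0 (qschur \<alpha>) m"
    using stage_pieri[of 0 "Suc N" \<alpha> m J] nJ eq assms N by (simp add: subset_iff less_Suc_eq)
  also have "\<dots> = (\<Sum>i\<in>insert 0 {0<..<Suc N}. times_var i (qschur \<alpha>) m)" by simp
  also have "\<dots> = (\<Sum>i\<in>Poly_Mapping.keys m. times_var i (qschur \<alpha>) m)"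
    using N by (intro sum.mono_neutral_right) (auto simp: times_var_def)
  finally show ?thesis by (simp add: times_var_def)
qed

lemma pieri_up_Nil: "pieri_up [] = {[1]}"
proof -
  have "\<beta> = [1]" if "\<beta> \<in> pieri_up []" for \<beta>
  proof -
    from that have "\<beta> \<in> compositions" "sum_list \<beta> = 1" by (auto simp: pieri_up_def dest: lower_last_sum_list)
    then show ?thesis by (cases \<beta>; cases "tl \<beta>") (auto simp: compositions_def)
  qed
  moreover have "[1] \<in> pieri_up []" by (auto simp: pieri_up_def compositions_def intro!: exI[of _ 0])
  ultimately show ?thesis by blast
qed

text \<open>
  The Pieri rule for the empty composition computes \<open>S\<^bsub>(1)\<^esub>\<close> as the sum of all variables.
\<close>

lemma qschur_1: "qschur [1] m = of_bool (\<exists>i. m = Poly_Mapping.single i 1)"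
proof -
  have *: "m - Poly_Mapping.single i 1 = 0 \<longleftrightarrow> m = Poly_Mapping.single i 1" if "i \<in> Poly_Mapping.keys m" for i
    using that by (auto simp: poly_mapping_eq_iff fun_eq_iff lookup_minus lookup_single in_keys_iff when_def)
  have "qschur [1] m = (\<Sum>i\<in>Poly_Mapping.keys m. of_bool (m = Poly_Mapping.single i 1))"
    using sum_qschur_pieri_up[of "[]" m] unfolding pieri_up_Nil qschur_Nil
    by (simp add: compositions_def QSym_def * of_bool_def del: One_nat_def cong: sum.cong)
  also have "\<dots> = of_bool (\<exists>i. m = Poly_Mapping.single i 1)"
  proof (cases "\<exists>i. m = Poly_Mapping.single i 1")
    case True
    then obtain i where i: "m = Poly_Mapping.single i 1" by blast
    have "(\<Sum>h\<in>Poly_Mapping.keys m. of_bool (m = Poly_Mapping.single h 1)) = (1::rat)" unfolding i by simp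
    then show ?thesis using True by simp
  qed simp
  finally show ?thesis .
qed

lemma ps_mult_qschur_1: "ps_mult (qschur [1]) f m = (\<Sum>i\<in>Poly_Mapping.keys m. f (m - Poly_Mapping.single i 1))"
proof -
  let ?s = "\<lambda>i. Poly_Mapping.single i (1::nat)"
  have add: "?s i + (m - ?s i) = m" if "i \<in> Poly_Mapping.keys m" for i
    using that by (intro poly_mapping_eqI) (auto simp: lookup_add lookup_minus lookup_single in_keys_iff when_def)
  have inj: "inj_on (\<lambda>i. (?s i, m - ?s i)) (Poly_Mapping.keys m)"
  proof (rule inj_onI)
    fix i i' assume "(?s i, m - ?s i) = (?s i', m - ?s i')"
    then have "Poly_Mapping.lookup (?s i) i = Poly_Mapping.lookup (?s i') i" by simp
    then show "i = i'" by (simp add: lookup_single when_def split: if_splits)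
  qed
  have "ps_mult (qschur [1]) f m = (\<Sum>(a, b)\<in>(\<lambda>i. (?s i, m - ?s i)) ` Poly_Mapping.keys m. qschur [1] a * f b)"
    unfolding ps_mult_def
  proof (rule sum.mono_neutral_right[OF finite_mono_decomp])
    show "(\<lambda>i. (?s i, m - ?s i)) ` Poly_Mapping.keys m \<subseteq> {(a, b). a + b = m}" using add by auto
    show "\<forall>p\<in>{(a, b). a + b = m} - (\<lambda>i. (?s i, m - ?s i)) ` Poly_Mapping.keys m. (case p of (a, b) \<Rightarrow> qschur [1] a * f b) = 0"
    proof
      fix p assume p: "p \<in> {(a, b). a + b = m} - (\<lambda>i. (?s i, m - ?s i)) ` Poly_Mapping.keys m"
      then obtain a b where ab: "p = (a, b)" "a + b = m" by auto
      have "a \<noteq> ?s i" for i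
      proof
        assume a: "a = ?s i"
        then have "i \<in> Poly_Mapping.keys m" "b = m - ?s i" using ab by (auto simp: in_keys_iff lookup_add)
        with p a ab show False by auto
      qed
      then show "(case p of (a, b) \<Rightarrow> qschur [1] a * f b) = 0" using ab qschur_1[of a] by simp
    qed
  qed
  also have "\<dots> = (\<Sum>i\<in>Poly_Mapping.keys m. f (m - ?s i))"
    using qschur_1 by (subst sum.reindex[OF inj]) (auto intro!: sum.cong)
  finally show ?thesis .
qed

lemma pieri_box:
  assumes "\<alpha> \<in> compositions"
  shows "ps_mult (qschur [1]) (qschur \<alpha>) = (\<lambda>m. \<Sum>\<beta>\<in>pieri_up \<alpha>. qschur \<beta> m)"
  by (rule ext) (simp only: ps_mult_qschur_1 sum_qschur_pieri_up[OF assms])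


section \<open>Triangularity and linear independence\<close>

text \<open>
  The monomial \<open>x\<^sub>1\<^bsup>\<beta>\<^sub>1\<^esup> x\<^sub>2\<^bsup>\<beta>\<^sub>2\<^esup> \<dots>\<close>. For a quasisymmetric function, the coefficient there is
  its coordinate at \<open>\<beta>\<close> in the basis of monomial quasisymmetric functions.
\<close>

definition pack :: "nat list \<Rightarrow> monomial" where
  "pack \<beta> = comp_monomial \<beta> [0..<length \<beta>]"

lemma lookup_sum_single:
  "Poly_Mapping.lookup (\<Sum>k\<in>K. Poly_Mapping.single (g k) (h k)) i = (\<Sum>k\<in>K. if g k = i then h k else (0::nat))"
  by (simp add: lookup_sum lookup_single when_def)

lemma lookup_pack: "Poly_Mapping.lookup (pack \<beta>) i = (if i < length \<beta> then \<beta> ! i else 0)"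
  by (simp add: pack_def comp_monomial_def lookup_sum_single)

lemma card_cells: "card (cells \<alpha>) = sum_list \<alpha>"
proof -
  have "cells \<alpha> = (SIGMA i:{..<length \<alpha>}. {..<\<alpha> ! i})" by (auto simp: cells_def)
  then show ?thesis by (simp add: sum_list_sum_nth lessThan_atLeast0)
qed

lemma mono_degree_eq_sum:
  assumes "finite K" "Poly_Mapping.keys m \<subseteq> K"
  shows "mono_degree m = (\<Sum>i\<in>K. Poly_Mapping.lookup m i)"
  unfolding mono_degree_def using assms by (intro sum.mono_neutral_left) (auto simp: in_keys_iff)

lemma mono_degree_pack: "mono_degree (pack \<beta>) = sum_list \<beta>"
  by (subst mono_degree_eq_sum[of "{..<length \<beta>}"])
     (auto simp: lookup_pack in_keys_iff sum_list_sum_nth lessThan_atLeast0 split: if_splits)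

lemma qschur_degree:
  assumes "qschur \<alpha> m \<noteq> 0"
  shows "mono_degree m = sum_list \<alpha>"
proof -
  from assms have "SSRCT_weight \<alpha> m \<noteq> {}" by (auto simp: qschur_def)
  then obtain \<tau> where t: "\<tau> \<in> SSRCT \<alpha>" "\<And>i. Poly_Mapping.lookup m i = card {c \<in> cells \<alpha>. \<tau> c = Suc i}"
    by (auto simp: SSRCT_weight_def)
  have "cells \<alpha> = (\<Union>i\<in>Poly_Mapping.keys m. {c \<in> cells \<alpha>. \<tau> c = Suc i})"
  proof -
    have "\<exists>i\<in>Poly_Mapping.keys m. \<tau> c = Suc i" if c: "c \<in> cells \<alpha>" for c
    proof -
      have "0 < \<tau> c" using t(1) c by (auto simp: SSRCT_def PiE_iff)
      then obtain i where i: "\<tau> c = Suc i" by (auto simp: gr0_conv_Suc)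
      with c have "{c \<in> cells \<alpha>. \<tau> c = Suc i} \<noteq> {}" by blast
      then have "Poly_Mapping.lookup m i \<noteq> 0" unfolding t(2) using finite_cells[of \<alpha>] by (simp add: card_eq_0_iff)
      with i show ?thesis by (auto simp: in_keys_iff)
    qed
    then show ?thesis by blast
  qed
  then have "sum_list \<alpha> = card (\<Union>i\<in>Poly_Mapping.keys m. {c \<in> cells \<alpha>. \<tau> c = Suc i})"
    using card_cells by simp
  also have "\<dots> = (\<Sum>i\<in>Poly_Mapping.keys m. card {c \<in> cells \<alpha>. \<tau> c = Suc i})"
    by (rule card_UN_disjoint) (auto simp: finite_cells)
  finally show ?thesis by (simp add: mono_degree_def t(2))
qed

text \<open>
  The first column increases strictly, so the largest entry occurs only in the last row. This bounds
  the last part of the weight \<open>\<beta>\<close> by the last part of \<open>\<alpha>\<close>; if they agree, the last row is filled with the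
  largest entry, and deleting it gives a tableau for the remaining parts.
\<close>

lemma SSRCT_weight_pack_le:
  assumes "\<alpha> \<in> compositions" "\<beta> \<in> compositions" "\<tau> \<in> SSRCT_weight \<alpha> (pack \<beta>)"
  shows "rev \<beta> \<le> rev \<alpha>"
  using assms
proof (induction \<beta> arbitrary: \<alpha> \<tau> rule: rev_induct)
  case (snoc b \<beta>)
  define n where "n = length \<beta>"
  have S: "\<tau> \<in> SSRCT \<alpha>" using snoc.prems by (simp add: SSRCT_weight_def)
  have wt: "card {c \<in> cells \<alpha>. \<tau> c = Suc i} = (if i < n then \<beta> ! i else if i = n then b else 0)" for i
  proof -
    have "card {c \<in> cells \<alpha>. \<tau> c = Suc i} = Poly_Mapping.lookup (pack (\<beta> @ [b])) i"
      using snoc.prems(3) by (simp add: SSRCT_weight_def)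
    then show ?thesis by (simp add: lookup_pack n_def nth_append less_Suc_eq)
  qed
  have row: "\<tau> (i, k) \<le> \<tau> (i, 0)" if "(i, k) \<in> cells \<alpha>" for i k
    using S that by (auto simp: SSRCT_def cells_def)
  have col: "\<tau> (i, 0) < \<tau> (i', 0)" if "(i, 0) \<in> cells \<alpha>" "(i', 0) \<in> cells \<alpha>" "i < i'" for i i'
    using S that by (auto simp: SSRCT_def)
  have le: "\<tau> c \<le> Suc n" if "c \<in> cells \<alpha>" for c
  proof (rule ccontr)
    assume "\<not> \<tau> c \<le> Suc n"
    then obtain i where i: "\<tau> c = Suc i" "n < i" by (cases "\<tau> c") auto
    then have "card {c \<in> cells \<alpha>. \<tau> c = Suc i} = 0" using wt by simp
    then have "{c \<in> cells \<alpha>. \<tau> c = Suc i} = {}" using finite_cells[of \<alpha>] by (subst (asm) card_0_eq) auto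
    then show False using i(1) that by blast
  qed
  have "0 < b" using snoc.prems by (simp add: compositions_def)
  then have "{c \<in> cells \<alpha>. \<tau> c = Suc n} \<noteq> {}" using wt[of n] by (intro notI) simp
  then have "\<alpha> \<noteq> []" by (auto simp: cells_def)
  then obtain \<alpha>0 a where \<alpha>: "\<alpha> = \<alpha>0 @ [a]" by (cases \<alpha> rule: rev_cases) auto
  define L where "L = length \<alpha>0"
  have "0 < a" using snoc.prems \<alpha> by (simp add: compositions_def)
  have C: "(i, k) \<in> cells \<alpha> \<longleftrightarrow> (i, k) \<in> cells \<alpha>0 \<or> i = L \<and> k < a" for i k
    by (auto simp: cells_def \<alpha> nth_append L_def less_Suc_eq)
  have max_last: "{c \<in> cells \<alpha>. \<tau> c = Suc n} \<subseteq> {L} \<times> {..<a}"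
  proof
    fix c assume "c \<in> {c \<in> cells \<alpha>. \<tau> c = Suc n}"
    then obtain i k where c: "c = (i, k)" "(i, k) \<in> cells \<alpha>" "\<tau> (i, k) = Suc n" by (cases c) auto
    have "i = L"
    proof (rule ccontr)
      assume "i \<noteq> L"
      with c C have i: "(i, k) \<in> cells \<alpha>0" "i < L" by (auto simp: cells_def L_def)
      then have "\<tau> (i, 0) < \<tau> (L, 0)" using C \<open>0 < a\<close> by (intro col) (auto simp: cells_def)
      moreover have "\<tau> (L, 0) \<le> Suc n" using C \<open>0 < a\<close> by (intro le) auto
      ultimately show False using row[OF c(2)] c(3) by simp
    qed
    with c C show "c \<in> {L} \<times> {..<a}" by (auto simp: cells_def L_def)
  qed
  have fin: "finite ({L} \<times> {..<a})" by simp
  have "b \<le> card ({L} \<times> {..<a})" using card_mono[OF fin max_last] wt[of n] by simp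
  then have "b \<le> a" by (simp add: card_cartesian_product)
  show ?case
  proof (cases "b = a")
    case False
    with \<open>b \<le> a\<close> show ?thesis unfolding \<alpha> by simp
  next
    case True
    then have full: "{c \<in> cells \<alpha>. \<tau> c = Suc n} = {L} \<times> {..<a}"
      using card_subset_eq[OF fin max_last] wt[of n] by (simp add: card_cartesian_product)
    have sub: "cells \<alpha>0 \<subseteq> cells \<alpha>" and notL: "\<And>k. (L, k) \<notin> cells \<alpha>0" using C by (auto simp: cells_def L_def)
    have "restrict \<tau> (cells \<alpha>0) \<in> SSRCT_weight \<alpha>0 (pack \<beta>)"
    proof -
      have "restrict \<tau> (cells \<alpha>0) \<in> SSRCT \<alpha>0"
      proof -
        have up: "(i, Suc k) \<in> cells \<alpha>0 \<and> \<tau> (j, Suc k) < \<tau> (i, Suc k)"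
          if "i < j" "(i, k) \<in> cells \<alpha>0" "(j, Suc k) \<in> cells \<alpha>0" "\<tau> (j, Suc k) \<le> \<tau> (i, k)" for i j k
        proof -
          have "(i, Suc k) \<in> cells \<alpha> \<and> \<tau> (j, Suc k) < \<tau> (i, Suc k)"
            using SSRCT_D(5)[OF S that(1)] that sub by blast
          moreover have "i \<noteq> L" using notL that by blast
          ultimately show ?thesis using C by blast
        qed
        show ?thesis
          by (rule SSRCT_I) (use SSRCT_D(1,3,4)[OF S] up subsetD[OF sub] in simp_all)
      qed
      moreover have "Poly_Mapping.lookup (pack \<beta>) i = card {c \<in> cells \<alpha>0. restrict \<tau> (cells \<alpha>0) c = Suc i}" for i
      proof (cases "i = n")
        case True
        have "{c \<in> cells \<alpha>0. restrict \<tau> (cells \<alpha>0) c = Suc n} = {}" using full sub notL by fastforce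
        then have "card {c \<in> cells \<alpha>0. restrict \<tau> (cells \<alpha>0) c = Suc i} = 0"
          unfolding True by (simp only: card.empty)
        moreover have "Poly_Mapping.lookup (pack \<beta>) i = 0" using True by (simp add: lookup_pack n_def)
        ultimately show ?thesis by (simp only:)
      next
        case False
        have "{c \<in> cells \<alpha>0. restrict \<tau> (cells \<alpha>0) c = Suc i} = {c \<in> cells \<alpha>. \<tau> c = Suc i}"
        proof (rule Set.set_eqI)
          fix c :: "nat \<times> nat"
          obtain i' k where c: "c = (i', k)" by fastforce
          have "(L, k) \<in> {c \<in> cells \<alpha>. \<tau> c = Suc n}" if "k < a" unfolding full using that by simp
          then show "c \<in> {c \<in> cells \<alpha>0. restrict \<tau> (cells \<alpha>0) c = Suc i} \<longleftrightarrow> c \<in> {c \<in> cells \<alpha>. \<tau> c = Suc i}"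
            using C[of i' k] c False by auto
        qed
        then show ?thesis using wt[of i] False by (simp add: lookup_pack n_def)
      qed
      ultimately show ?thesis by (simp add: SSRCT_weight_def)
    qed
    then have "rev \<beta> \<le> rev \<alpha>0" using snoc.prems by (intro snoc.IH) (auto simp: compositions_def \<alpha>)
    then show ?thesis using True \<alpha> by simp
  qed
qed simp

lemma qschur_pack_le:
  "\<alpha> \<in> compositions \<Longrightarrow> \<beta> \<in> compositions \<Longrightarrow> qschur \<alpha> (pack \<beta>) \<noteq> 0 \<Longrightarrow> rev \<beta> \<le> rev \<alpha>"
  using SSRCT_weight_pack_le[of \<alpha> \<beta>] by (auto simp: qschur_def card_eq_0_iff)

text \<open>
  Filling each row with its own number gives a tableau.
\<close>

lemma qschur_pack_self: "qschur \<alpha> (pack \<alpha>) \<noteq> 0"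
proof -
  let ?\<tau> = "restrict (\<lambda>(i, k). Suc i) (cells \<alpha>)"
  have "?\<tau> \<in> SSRCT_weight \<alpha> (pack \<alpha>)"
  proof -
    have "?\<tau> \<in> SSRCT \<alpha>" unfolding SSRCT_def by (auto simp: PiE_iff split: if_splits)
    moreover have "Poly_Mapping.lookup (pack \<alpha>) i = card {c \<in> cells \<alpha>. ?\<tau> c = Suc i}" for i
    proof -
      have "{c \<in> cells \<alpha>. ?\<tau> c = Suc i} = (if i < length \<alpha> then {i} \<times> {..<\<alpha> ! i} else {})"
        by (auto simp: cells_def)
      then show ?thesis by (simp add: lookup_pack card_cartesian_product)
    qed
    ultimately show ?thesis by (simp add: SSRCT_weight_def)
  qed
  then show ?thesis using finite_SSRCT_weight[of \<alpha> "pack \<alpha>"] by (auto simp: qschur_def card_eq_0_iff)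
qed

text \<open>
  By triangularity, only the largest \<open>\<beta>\<close> with nonzero coefficient contributes to the coefficient of
  \<open>pack \<beta>\<close>.
\<close>

lemma qschur_independent:
  assumes "finite C" "C \<subseteq> compositions" "\<And>m. (\<Sum>\<alpha>\<in>C. c \<alpha> * qschur \<alpha> m) = 0" "\<alpha> \<in> C"
  shows "c \<alpha> = 0"
proof (rule ccontr)
  assume "c \<alpha> \<noteq> 0"
  define A where "A = rev ` {\<alpha> \<in> C. c \<alpha> \<noteq> 0}"
  have A: "finite A" "A \<noteq> {}" using assms \<open>c \<alpha> \<noteq> 0\<close> by (auto simp: A_def)
  then have "Max A \<in> A" by (rule Max_in)
  then obtain \<beta> where \<beta>: "\<beta> \<in> C" "c \<beta> \<noteq> 0" "Max A = rev \<beta>" by (auto simp: A_def)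
  have "(\<Sum>\<alpha>\<in>C. c \<alpha> * qschur \<alpha> (pack \<beta>)) = (\<Sum>\<alpha>\<in>{\<beta>}. c \<alpha> * qschur \<alpha> (pack \<beta>))"
  proof (rule sum.mono_neutral_right)
    show "\<forall>\<alpha>\<in>C - {\<beta>}. c \<alpha> * qschur \<alpha> (pack \<beta>) = 0"
    proof
      fix \<alpha> assume \<alpha>: "\<alpha> \<in> C - {\<beta>}"
      show "c \<alpha> * qschur \<alpha> (pack \<beta>) = 0"
      proof (rule ccontr)
        assume "c \<alpha> * qschur \<alpha> (pack \<beta>) \<noteq> 0"
        then have "c \<alpha> \<noteq> 0" "rev \<beta> \<le> rev \<alpha>" using qschur_pack_le[of \<alpha> \<beta>] \<alpha> \<beta> assms(2) by auto
        moreover have "rev \<alpha> \<le> rev \<beta>" using A \<alpha> \<open>c \<alpha> \<noteq> 0\<close> unfolding \<beta>(3)[symmetric] by (intro Max_ge) (auto simp: A_def)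
        ultimately have "rev \<alpha> = rev \<beta>" by simp
        then show False using \<alpha> by simp
      qed
    qed
  qed (use assms \<beta> in auto)
  then show False using assms(3)[of "pack \<beta>"] \<beta> qschur_pack_self[of \<beta>] by simp
qed

lemma inj_on_qschur: "inj_on qschur compositions"
proof (rule inj_onI, rule ccontr)
  fix \<alpha> \<beta> assume *: "\<alpha> \<in> compositions" "\<beta> \<in> compositions" "qschur \<alpha> = qschur \<beta>" "\<alpha> \<noteq> \<beta>"
  have "(if \<alpha> = \<alpha> then 1 else -1 :: rat) = 0"
    by (rule qschur_independent[of "{\<alpha>, \<beta>}" "\<lambda>\<gamma>. if \<gamma> = \<alpha> then 1 else -1"]) (use * in auto)
  then show False by simp
qed

lemma sum_qschur_eq_imp_eq:
  assumes "finite A" "A \<subseteq> compositions" "finite B" "B \<subseteq> compositions"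
    "\<And>m. (\<Sum>\<alpha>\<in>A. qschur \<alpha> m) = (\<Sum>\<alpha>\<in>B. qschur \<alpha> m)"
  shows "A = B"
proof -
  define c :: "nat list \<Rightarrow> rat" where "c \<gamma> = of_bool (\<gamma> \<in> A) - of_bool (\<gamma> \<in> B)" for \<gamma>
  have A: "(\<Sum>\<alpha>\<in>A \<union> B. of_bool (\<alpha> \<in> A) * qschur \<alpha> m) = (\<Sum>\<alpha>\<in>A. qschur \<alpha> m)" for m
    using assms by (intro sum.mono_neutral_cong_right) auto
  have B: "(\<Sum>\<alpha>\<in>A \<union> B. of_bool (\<alpha> \<in> B) * qschur \<alpha> m) = (\<Sum>\<alpha>\<in>B. qschur \<alpha> m)" for m
    using assms by (intro sum.mono_neutral_cong_right) auto
  have "c \<gamma> = 0" if "\<gamma> \<in> A \<union> B" for \<gamma>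
    by (rule qschur_independent[of "A \<union> B"])
       (use assms that A B in \<open>auto simp: c_def left_diff_distrib sum_subtractf\<close>)
  then have "\<gamma> \<in> A \<longleftrightarrow> \<gamma> \<in> B" for \<gamma>
    using \<open>\<And>\<gamma>. \<gamma> \<in> A \<union> B \<Longrightarrow> c \<gamma> = 0\<close>[of \<gamma>]
    by (cases "\<gamma> \<in> A"; cases "\<gamma> \<in> B") (auto simp: c_def)
  then show ?thesis by blast
qed


section \<open>Quasisymmetry and spanning\<close>

text \<open>
  Substitutes the variable with index \<open>\<pi> i\<close> for the one with index \<open>i\<close>.
\<close>

definition push :: "(nat \<Rightarrow> nat) \<Rightarrow> monomial \<Rightarrow> monomial" where
  "push \<pi> m = (\<Sum>i\<in>Poly_Mapping.keys m. Poly_Mapping.single (\<pi> i) (Poly_Mapping.lookup m i))"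

lemma lookup_push: "inj \<pi> \<Longrightarrow> Poly_Mapping.lookup (push \<pi> m) (\<pi> i) = Poly_Mapping.lookup m i"
  by (simp add: push_def lookup_sum_single inj_eq in_keys_iff)

lemma lookup_push_outside: "j \<notin> range \<pi> \<Longrightarrow> Poly_Mapping.lookup (push \<pi> m) j = 0"
  by (auto simp: push_def lookup_sum_single intro!: sum.neutral)

lemma push_eqI:
  assumes "inj \<pi>" "\<And>i. Poly_Mapping.lookup m' (\<pi> i) = Poly_Mapping.lookup m i"
    "\<And>j. j \<notin> range \<pi> \<Longrightarrow> Poly_Mapping.lookup m' j = 0"
  shows "push \<pi> m = m'"
proof (rule poly_mapping_eqI)
  fix j show "Poly_Mapping.lookup (push \<pi> m) j = Poly_Mapping.lookup m' j"
    using assms by (cases "j \<in> range \<pi>") (auto simp: lookup_push lookup_push_outside)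
qed

lemma push_add: "inj \<pi> \<Longrightarrow> push \<pi> (a + b) = push \<pi> a + push \<pi> b"
  by (rule push_eqI) (auto simp: lookup_add lookup_push lookup_push_outside)

lemma push_inject: "inj \<pi> \<Longrightarrow> push \<pi> a = push \<pi> b \<Longrightarrow> a = b"
  by (rule poly_mapping_eqI) (metis lookup_push)

lemma push_comp_monomial:
  assumes "inj \<pi>" "length us = length \<alpha>"
  shows "push \<pi> (comp_monomial \<alpha> us) = comp_monomial \<alpha> (map \<pi> us)"
  using assms
  by (intro push_eqI) (auto simp: comp_monomial_def lookup_sum_single inj_eq intro!: sum.neutral sum.cong)

text \<open>
  A factor of a relabelled monomial uses only relabelled variables, so it is itself relabelled.
\<close>

lemma push_decomp:
  assumes "inj \<pi>"
  shows "{(a, b). a + b = push \<pi> m} = (\<lambda>(a, b). (push \<pi> a, push \<pi> b)) ` {(a, b). a + b = m}"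
proof -
  have "\<exists>a' b'. a = push \<pi> a' \<and> b = push \<pi> b' \<and> a' + b' = m" if ab: "a + b = push \<pi> m" for a b
  proof -
    have out: "Poly_Mapping.lookup a j = 0 \<and> Poly_Mapping.lookup b j = 0" if "j \<notin> range \<pi>" for j
    proof -
      have "Poly_Mapping.lookup (a + b) j = 0" unfolding ab using that by (rule lookup_push_outside)
      then show ?thesis by (simp add: lookup_add)
    qed
    have "push \<pi> (Poly_Mapping.map_key \<pi> a) = a" "push \<pi> (Poly_Mapping.map_key \<pi> b) = b"
      using out assms by (auto intro!: push_eqI simp: map_key.rep_eq)
    moreover from this have "Poly_Mapping.map_key \<pi> a + Poly_Mapping.map_key \<pi> b = m"
      using ab push_add[OF assms] push_inject[OF assms] by metis
    ultimately show ?thesis by metis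
  qed
  then show ?thesis using push_add[OF assms] by (fastforce simp: image_iff)
qed

lemma comp_monomial_sorted_keys:
  "comp_monomial (map (Poly_Mapping.lookup m) (sorted_list_of_set (Poly_Mapping.keys m)))
     (sorted_list_of_set (Poly_Mapping.keys m)) = m" (is "comp_monomial ?\<alpha> ?us = m")
proof (rule poly_mapping_eqI)
  fix i
  have "Poly_Mapping.lookup (comp_monomial ?\<alpha> ?us) i = (\<Sum>k<length ?us. if ?us ! k = i then Poly_Mapping.lookup m i else 0)"
    by (auto simp: comp_monomial_def lookup_sum_single intro!: sum.cong)
  also have "\<dots> = (\<Sum>u\<leftarrow>?us. if u = i then Poly_Mapping.lookup m i else 0)"
    by (simp add: sum_list_sum_nth lessThan_atLeast0)
  also have "\<dots> = (\<Sum>u\<in>Poly_Mapping.keys m. if u = i then Poly_Mapping.lookup m i else 0)"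
    by (subst sum_list_distinct_conv_sum_set) auto
  finally show "Poly_Mapping.lookup (comp_monomial ?\<alpha> ?us) i = Poly_Mapping.lookup m i"
    by (simp add: in_keys_iff)
qed

lemma exponents_composition:
  "map (Poly_Mapping.lookup m) (sorted_list_of_set (Poly_Mapping.keys m)) \<in> compositions"
  by (auto simp: compositions_def in_keys_iff)

lemma sorted_wrt_less_keys: "sorted_wrt (<) (sorted_list_of_set (Poly_Mapping.keys (m :: monomial)))"
  by simp

lemma quasisymmetric_pack:
  assumes "quasisymmetric f"
  obtains \<beta> where "\<beta> \<in> compositions" "f m = f (pack \<beta>)"
proof -
  let ?us = "sorted_list_of_set (Poly_Mapping.keys m)"
  let ?\<beta> = "map (Poly_Mapping.lookup m) ?us"
  have "f (comp_monomial ?\<beta> ?us) = f (comp_monomial ?\<beta> [0..<length ?\<beta>])"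
    using assms exponents_composition[of m] sorted_wrt_less_keys[of m]
    unfolding quasisymmetric_def by auto
  then have "f m = f (pack ?\<beta>)" by (simp add: comp_monomial_sorted_keys pack_def)
  then show ?thesis by (rule that[OF exponents_composition])
qed

text \<open>
  Invariance under relabelling of the variables is the form of quasisymmetry that is inherited by
  products and by generating functions of tableaux.
\<close>

lemma quasisymmetric_iff_push:
  "quasisymmetric f \<longleftrightarrow> (\<forall>\<pi> m. strict_mono \<pi> \<longrightarrow> f (push \<pi> m) = f m)"
proof
  assume f: "quasisymmetric f"
  show "\<forall>\<pi> m. strict_mono \<pi> \<longrightarrow> f (push \<pi> m) = f m"
  proof (intro allI impI)
    fix \<pi> :: "nat \<Rightarrow> nat" and m :: monomial assume \<pi>: "strict_mono \<pi>"
    let ?us = "sorted_list_of_set (Poly_Mapping.keys m)"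
    let ?\<beta> = "map (Poly_Mapping.lookup m) ?us"
    have "sorted_wrt (<) (map \<pi> ?us)"
      using sorted_wrt_less_keys[of m] \<pi> by (simp add: sorted_wrt_map strict_mono_less)
    then have "f (comp_monomial ?\<beta> (map \<pi> ?us)) = f (comp_monomial ?\<beta> ?us)"
      using f exponents_composition[of m] sorted_wrt_less_keys[of m] unfolding quasisymmetric_def by auto
    then show "f (push \<pi> m) = f m"
      using push_comp_monomial[of \<pi> ?us ?\<beta>] strict_mono_imp_inj_on[OF \<pi>] by (simp add: comp_monomial_sorted_keys)
  qed
next
  assume f: "\<forall>\<pi> m. strict_mono \<pi> \<longrightarrow> f (push \<pi> m) = f m"
  have *: "f (comp_monomial \<alpha> us) = f (pack \<alpha>)" if us: "length us = length \<alpha>" "sorted_wrt (<) us" for \<alpha> us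
  proof -
    \<comment> \<open>extends \<open>us\<close> to an increasing map on all indices\<close>
    define \<pi> where "\<pi> i = (if i < length us then us ! i else Suc (sum_list us) + i)" for i
    have "strict_mono \<pi>"
    proof (rule strict_monoI)
      fix i j :: nat assume "i < j"
      then show "\<pi> i < \<pi> j"
        using us(2) member_le_sum_list[of "us ! i" us] by (auto simp: \<pi>_def sorted_wrt_iff_nth_less)
    qed
    moreover have "map \<pi> [0..<length \<alpha>] = us" by (rule nth_equalityI) (auto simp: \<pi>_def us)
    ultimately show ?thesis
      using f push_comp_monomial[of \<pi> "[0..<length \<alpha>]" \<alpha>] strict_mono_imp_inj_on[of \<pi>]
      by (metis pack_def length_upt diff_zero)
  qed
  show "quasisymmetric f" unfolding quasisymmetric_def by (simp add: *)
qed

lemma quasisymmetric_ps_mult: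
  assumes "quasisymmetric f" "quasisymmetric g"
  shows "quasisymmetric (ps_mult f g)"
  unfolding quasisymmetric_iff_push
proof (intro allI impI)
  fix \<pi> :: "nat \<Rightarrow> nat" and m :: monomial assume \<pi>: "strict_mono \<pi>"
  then have inj: "inj \<pi>" by (rule strict_mono_imp_inj_on)
  have "inj_on (\<lambda>(a, b). (push \<pi> a, push \<pi> b)) {(a, b). a + b = m}"
    by (auto intro!: inj_onI dest: push_inject[OF inj])
  then show "ps_mult f g (push \<pi> m) = ps_mult f g m"
    using assms \<pi> unfolding ps_mult_def push_decomp[OF inj] quasisymmetric_iff_push
    by (subst sum.reindex) (auto intro!: sum.cong)
qed

text \<open>
  The tableau conditions depend only on the order of the entries.
\<close>

lemma SSRCT_relabel:
  assumes t: "\<tau> \<in> SSRCT \<alpha>" and s: "\<sigma> \<in> cells \<alpha> \<rightarrow>\<^sub>E {0<..}"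
    and le: "\<And>c d. c \<in> cells \<alpha> \<Longrightarrow> d \<in> cells \<alpha> \<Longrightarrow> \<sigma> c \<le> \<sigma> d \<longleftrightarrow> \<tau> c \<le> \<tau> d"
  shows "\<sigma> \<in> SSRCT \<alpha>"
proof -
  have less: "\<sigma> c < \<sigma> d \<longleftrightarrow> \<tau> c < \<tau> d" if "c \<in> cells \<alpha>" "d \<in> cells \<alpha>" for c d
    using le[OF that(2,1)] by (simp add: not_le[symmetric])
  show ?thesis using t s unfolding SSRCT_def by (simp add: le less)
qed

lemma quasisymmetric_qschur: "quasisymmetric (qschur \<alpha>)"
  unfolding quasisymmetric_iff_push
proof (intro allI impI)
  fix \<pi> :: "nat \<Rightarrow> nat" and m :: monomial assume \<pi>: "strict_mono \<pi>"
  then have inj: "inj \<pi>" by (rule strict_mono_imp_inj_on)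
  let ?f = "\<lambda>\<tau>. restrict (\<lambda>c. Suc (\<pi> (\<tau> c - 1))) (cells \<alpha>)"
  let ?g = "\<lambda>\<tau>. restrict (\<lambda>c. Suc (inv_into UNIV \<pi> (\<tau> c - 1))) (cells \<alpha>)"
  have pos: "0 < \<tau> c" if "\<tau> \<in> SSRCT_weight \<alpha> m" "c \<in> cells \<alpha>" for \<tau> m c
    using that by (auto simp: SSRCT_weight_def SSRCT_def PiE_iff)
  have ext: "restrict \<tau> (cells \<alpha>) = \<tau>" if "\<tau> \<in> SSRCT_weight \<alpha> m" for \<tau> m
    using that by (auto simp: SSRCT_weight_def SSRCT_def PiE_iff extensional_restrict)
  have range: "\<tau> c - 1 \<in> range \<pi>" if "\<tau> \<in> SSRCT_weight \<alpha> (push \<pi> m)" "c \<in> cells \<alpha>" for \<tau> c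
  proof (rule ccontr)
    assume "\<tau> c - 1 \<notin> range \<pi>"
    then have "Poly_Mapping.lookup (push \<pi> m) (\<tau> c - 1) = 0" by (rule lookup_push_outside)
    then have "card {d \<in> cells \<alpha>. \<tau> d = Suc (\<tau> c - 1)} = 0" using that by (simp add: SSRCT_weight_def)
    then have "{d \<in> cells \<alpha>. \<tau> d = Suc (\<tau> c - 1)} = {}" using finite_cells[of \<alpha>] by (subst (asm) card_0_eq) auto
    moreover have "\<tau> c = Suc (\<tau> c - 1)" using pos[OF that] by simp
    ultimately show False using that(2) by blast
  qed
  have "bij_betw ?f (SSRCT_weight \<alpha> m) (SSRCT_weight \<alpha> (push \<pi> m))"
  proof (rule bij_betwI[where g = ?g])
    show "?f \<in> SSRCT_weight \<alpha> m \<rightarrow> SSRCT_weight \<alpha> (push \<pi> m)"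
    proof
      fix \<tau> assume t: "\<tau> \<in> SSRCT_weight \<alpha> m"
      have "?f \<tau> \<in> SSRCT \<alpha>"
      proof (rule SSRCT_relabel)
        show "\<tau> \<in> SSRCT \<alpha>" using t by (simp add: SSRCT_weight_def)
        fix c d assume "c \<in> cells \<alpha>" "d \<in> cells \<alpha>"
        then show "?f \<tau> c \<le> ?f \<tau> d \<longleftrightarrow> \<tau> c \<le> \<tau> d"
          using pos[OF t, of c] pos[OF t, of d] \<pi> by (auto simp: strict_mono_less_eq)
      qed auto
      moreover have "Poly_Mapping.lookup (push \<pi> m) j = card {c \<in> cells \<alpha>. ?f \<tau> c = Suc j}" for j
      proof (cases "j \<in> range \<pi>")
        case True
        then obtain i where i: "j = \<pi> i" by blast
        have "\<pi> (\<tau> c - 1) = \<pi> i \<longleftrightarrow> \<tau> c = Suc i" if "c \<in> cells \<alpha>" for c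
          using pos[OF t that] inj by (auto simp: inj_eq)
        then have "{c \<in> cells \<alpha>. ?f \<tau> c = Suc j} = {c \<in> cells \<alpha>. \<tau> c = Suc i}" using i by auto
        then show ?thesis using t i inj by (simp add: SSRCT_weight_def lookup_push)
      next
        case False
        then have "{c \<in> cells \<alpha>. ?f \<tau> c = Suc j} = {}" by auto
        then have "card {c \<in> cells \<alpha>. ?f \<tau> c = Suc j} = 0" by (simp only: card.empty)
        then show ?thesis by (simp only: lookup_push_outside[OF False])
      qed
      ultimately show "?f \<tau> \<in> SSRCT_weight \<alpha> (push \<pi> m)" by (simp add: SSRCT_weight_def)
    qed
    show "?g \<in> SSRCT_weight \<alpha> (push \<pi> m) \<rightarrow> SSRCT_weight \<alpha> m"
    proof
      fix \<tau> assume t: "\<tau> \<in> SSRCT_weight \<alpha> (push \<pi> m)"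
      have inv_pi: "\<pi> (inv_into UNIV \<pi> (\<tau> c - 1)) = \<tau> c - 1" if "c \<in> cells \<alpha>" for c
        using range[OF t that] by (rule f_inv_into_f)
      have "?g \<tau> \<in> SSRCT \<alpha>"
      proof (rule SSRCT_relabel)
        show "\<tau> \<in> SSRCT \<alpha>" using t by (simp add: SSRCT_weight_def)
        fix c d assume cd: "c \<in> cells \<alpha>" "d \<in> cells \<alpha>"
        have "inv_into UNIV \<pi> (\<tau> c - 1) \<le> inv_into UNIV \<pi> (\<tau> d - 1) \<longleftrightarrow> \<tau> c - 1 \<le> \<tau> d - 1"
          using strict_mono_less_eq[OF \<pi>, of "inv_into UNIV \<pi> (\<tau> c - 1)" "inv_into UNIV \<pi> (\<tau> d - 1)"]
          unfolding inv_pi[OF cd(1)] inv_pi[OF cd(2)] by blast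
        then show "?g \<tau> c \<le> ?g \<tau> d \<longleftrightarrow> \<tau> c \<le> \<tau> d"
          using pos[OF t, of c] pos[OF t, of d] cd by auto
      qed auto
      moreover have "Poly_Mapping.lookup m i = card {c \<in> cells \<alpha>. ?g \<tau> c = Suc i}" for i
      proof -
        have "inv_into UNIV \<pi> (\<tau> c - 1) = i \<longleftrightarrow> \<tau> c = Suc (\<pi> i)" if "c \<in> cells \<alpha>" for c
          using inv_pi[OF that] pos[OF t that] inj by (auto simp: inv_f_f)
        then have "{c \<in> cells \<alpha>. ?g \<tau> c = Suc i} = {c \<in> cells \<alpha>. \<tau> c = Suc (\<pi> i)}" by auto
        then show ?thesis using t lookup_push[OF inj, of m i] by (simp add: SSRCT_weight_def)
      qed
      ultimately show "?g \<tau> \<in> SSRCT_weight \<alpha> m" by (simp add: SSRCT_weight_def)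
    qed
  next
    fix \<tau> assume t: "\<tau> \<in> SSRCT_weight \<alpha> m"
    have "restrict \<tau> (cells \<alpha>) = \<tau>" by (rule ext[OF t])
    moreover have "?g (?f \<tau>) = restrict \<tau> (cells \<alpha>)"
      using pos[OF t] inj by (intro restrict_ext) (simp add: inv_f_f)
    ultimately show "?g (?f \<tau>) = \<tau>" by simp
  next
    fix \<tau> assume t: "\<tau> \<in> SSRCT_weight \<alpha> (push \<pi> m)"
    have "restrict \<tau> (cells \<alpha>) = \<tau>" by (rule ext[OF t])
    moreover have "?f (?g \<tau>) = restrict \<tau> (cells \<alpha>)"
      using pos[OF t] f_inv_into_f[OF range[OF t]] by (intro restrict_ext) simp
    ultimately show "?f (?g \<tau>) = \<tau>" by simp
  qed
  then show "qschur \<alpha> (push \<pi> m) = qschur \<alpha> m" by (simp add: qschur_def bij_betw_same_card)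
qed

lemma qschur_graded: "qschur \<alpha> \<in> QSym_graded (sum_list \<alpha>)"
  using qschur_degree[of \<alpha>] quasisymmetric_qschur[of \<alpha>]
  by (auto simp: QSym_graded_def QSym_def QSym_set_def)

lemma qschur_in_QSym: "qschur \<alpha> \<in> carrier QSym"
  using qschur_graded[of \<alpha>] by (simp add: QSym_graded_def)

lemma mono_degree_add: "mono_degree (a + b) = mono_degree a + mono_degree b"
proof -
  let ?K = "Poly_Mapping.keys a \<union> Poly_Mapping.keys b"
  have "Poly_Mapping.keys (a + b) \<subseteq> ?K" by (auto simp: in_keys_iff lookup_add)
  then show ?thesis
    by (simp add: mono_degree_eq_sum[of ?K] lookup_add sum.distrib)
qed

lemma QSym_set_mult: "f \<in> QSym_set \<Longrightarrow> g \<in> QSym_set \<Longrightarrow> ps_mult f g \<in> QSym_set"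
proof -
  assume f: "f \<in> QSym_set" and g: "g \<in> QSym_set"
  obtain d e where d: "\<And>m. f m \<noteq> 0 \<Longrightarrow> mono_degree m \<le> d" and e: "\<And>m. g m \<noteq> 0 \<Longrightarrow> mono_degree m \<le> e"
    using f g by (auto simp: QSym_set_def)
  have "mono_degree m \<le> d + e" if "ps_mult f g m \<noteq> 0" for m
  proof -
    from that obtain p where "p \<in> {(a, b). a + b = m}" "(case p of (a, b) \<Rightarrow> f a * g b) \<noteq> 0"
      unfolding ps_mult_def by (meson sum.neutral)
    then obtain a b where "a + b = m" "f a \<noteq> 0" "g b \<noteq> 0" by auto
    then show ?thesis using d[of a] e[of b] by (auto simp: mono_degree_add)
  qed
  then show ?thesis using f g quasisymmetric_ps_mult by (auto simp: QSym_set_def)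
qed

lemma QSym_set_add: "f \<in> QSym_set \<Longrightarrow> g \<in> QSym_set \<Longrightarrow> (\<lambda>m. f m + g m) \<in> QSym_set"
proof -
  assume f: "f \<in> QSym_set" and g: "g \<in> QSym_set"
  obtain d e where d: "\<And>m. f m \<noteq> 0 \<Longrightarrow> mono_degree m \<le> d" and e: "\<And>m. g m \<noteq> 0 \<Longrightarrow> mono_degree m \<le> e"
    using f g by (auto simp: QSym_set_def)
  have "mono_degree m \<le> max d e" if "f m + g m \<noteq> 0" for m
    using d[of m] e[of m] that by (cases "f m = 0") auto
  moreover have "quasisymmetric (\<lambda>m. f m + g m)" using f g by (simp add: QSym_set_def quasisymmetric_iff_push)
  ultimately show ?thesis by (auto simp: QSym_set_def)
qed

lemma QSym_set_smult: "f \<in> QSym_set \<Longrightarrow> (\<lambda>m. c * f m) \<in> QSym_set"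
  by (auto simp: QSym_set_def quasisymmetric_iff_push)

lemma QSym_set_zero: "(\<lambda>m. 0) \<in> QSym_set"
  by (auto simp: QSym_set_def quasisymmetric_iff_push)

lemma QSym_one: "\<one>\<^bsub>QSym\<^esub> \<in> carrier QSym"
  using qschur_in_QSym[of "[]"] by (simp add: qschur_Nil)

text \<open>
  Elimination from the top: subtracting a multiple of \<open>S\<^sub>\<gamma>\<close> for the largest \<open>\<gamma>\<close> in the support of \<open>f\<close>
  cancels the coordinate at \<open>\<gamma>\<close> and changes only smaller ones.
\<close>

lemma qschur_spans_bounded:
  assumes "quasisymmetric f" "\<And>m. f m \<noteq> 0 \<Longrightarrow> mono_degree m \<le> d"
  shows "\<exists>c. \<forall>m. f m = (\<Sum>\<alpha>\<in>{\<alpha> \<in> compositions. sum_list \<alpha> \<le> d}. c \<alpha> * qschur \<alpha> m)"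
proof -
  define C where "C = {\<alpha> \<in> compositions. sum_list \<alpha> \<le> d}"
  have fin: "finite C" unfolding C_def by (rule finite_compositions_sum_le)
  \<comment> \<open>the termination measure: everything up to the largest element of the support\<close>
  define below where "below f = {\<beta> \<in> C. \<exists>\<gamma>\<in>C. f (pack \<gamma>) \<noteq> 0 \<and> rev \<beta> \<le> rev \<gamma>}" for f :: power_series
  have "\<exists>c. \<forall>m. f m = (\<Sum>\<alpha>\<in>C. c \<alpha> * qschur \<alpha> m)" using assms
  proof (induction "card (below f)" arbitrary: f rule: less_induct)
    case less
    define A where "A = {\<gamma> \<in> C. f (pack \<gamma>) \<noteq> 0}"
    show ?case
    proof (cases "A = {}")
      case True
      have "f m = 0" for m
      proof (rule ccontr)
        assume "f m \<noteq> 0"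
        obtain \<beta> where \<beta>: "\<beta> \<in> compositions" "f m = f (pack \<beta>)" using quasisymmetric_pack[OF less.prems(1)] by metis
        then have "\<beta> \<in> A" using \<open>f m \<noteq> 0\<close> less.prems(2)[of "pack \<beta>"] by (simp add: A_def C_def mono_degree_pack)
        with True show False by blast
      qed
      then show ?thesis by (intro exI[of _ "\<lambda>_. 0"]) simp
    next
      case False
      have finA: "finite (rev ` A)" using fin by (simp add: A_def)
      then have "Max (rev ` A) \<in> rev ` A" using False by (intro Max_in) auto
      then obtain \<gamma> where \<gamma>: "\<gamma> \<in> A" "Max (rev ` A) = rev \<gamma>" by blast
      define k where "k = f (pack \<gamma>) / qschur \<gamma> (pack \<gamma>)"
      define h where "h m = f m - k * qschur \<gamma> m" for m
      have \<gamma>C: "\<gamma> \<in> compositions" "sum_list \<gamma> \<le> d" using \<gamma> by (auto simp: A_def C_def)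
      have small: "rev \<beta> < rev \<gamma>" if "\<beta> \<in> C" "h (pack \<beta>) \<noteq> 0" for \<beta>
      proof -
        have "rev \<beta> \<le> rev \<gamma>"
        proof (cases "f (pack \<beta>) = 0")
          case True
          then show ?thesis using that \<gamma>C qschur_pack_le[of \<gamma> \<beta>] by (auto simp: h_def C_def)
        next
          case False
          then show ?thesis using that finA unfolding \<gamma>(2)[symmetric] by (intro Max_ge) (auto simp: A_def)
        qed
        moreover have "\<beta> \<noteq> \<gamma>" using that qschur_pack_self[of \<gamma>] by (auto simp: h_def k_def)
        ultimately show ?thesis by (simp add: order_less_le)
      qed
      have "below h \<subset> below f"
      proof
        show "below h \<subseteq> below f"
        proof
          fix \<beta> assume "\<beta> \<in> below h"
          then obtain \<delta> where "\<beta> \<in> C" "\<delta> \<in> C" "h (pack \<delta>) \<noteq> 0" "rev \<beta> \<le> rev \<delta>" by (auto simp: below_def)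
          with small[of \<delta>] \<gamma> show "\<beta> \<in> below f" by (force simp: below_def A_def)
        qed
        have "\<gamma> \<in> below f" using \<gamma> by (auto simp: below_def A_def)
        moreover have "\<gamma> \<notin> below h" using small by (force simp: below_def)
        ultimately show "below h \<noteq> below f" by blast
      qed
      then have "card (below h) < card (below f)" using fin by (intro psubset_card_mono) (auto simp: below_def)
      moreover have "quasisymmetric h"
        using less.prems(1) quasisymmetric_qschur[of \<gamma>] by (simp add: quasisymmetric_iff_push h_def)
      moreover have "mono_degree m \<le> d" if "h m \<noteq> 0" for m
        using that less.prems(2)[of m] qschur_degree[of \<gamma> m] \<gamma>C by (cases "f m = 0") (auto simp: h_def)
      ultimately obtain c where c: "\<And>m. h m = (\<Sum>\<alpha>\<in>C. c \<alpha> * qschur \<alpha> m)" using less.hyps by blast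
      have "f m = (\<Sum>\<alpha>\<in>C. (c \<alpha> + (if \<alpha> = \<gamma> then k else 0)) * qschur \<alpha> m)" for m
      proof -
        have "(\<Sum>\<alpha>\<in>C. (if \<alpha> = \<gamma> then k else 0) * qschur \<alpha> m) = k * qschur \<gamma> m"
          using fin \<gamma> by (simp add: if_distrib[of "\<lambda>x. x * _"] A_def cong: if_cong)
        then show ?thesis using c[of m] by (simp add: distrib_right sum.distrib h_def)
      qed
      then show ?thesis by (intro exI[of _ "\<lambda>\<alpha>. c \<alpha> + (if \<alpha> = \<gamma> then k else 0)"]) blast
    qed
  qed
  then show ?thesis by (simp add: C_def)
qed

lemma qschur_spans:
  assumes "f \<in> carrier QSym"
  obtains C c where "finite C" "C \<subseteq> compositions" "f = (\<lambda>m. \<Sum>\<alpha>\<in>C. c \<alpha> * qschur \<alpha> m)"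
proof -
  from assms obtain d where "quasisymmetric f" "\<And>m. f m \<noteq> 0 \<Longrightarrow> mono_degree m \<le> d"
    by (auto simp: QSym_def QSym_set_def)
  from qschur_spans_bounded[OF this] obtain c
    where "\<And>m. f m = (\<Sum>\<alpha>\<in>{\<alpha> \<in> compositions. sum_list \<alpha> \<le> d}. c \<alpha> * qschur \<alpha> m)" by blast
  then show ?thesis using that[OF finite_compositions_sum_le[of d], of c] by auto
qed


section \<open>Rigidity of the Pieri graph\<close>

text \<open>
  The lower neighbours of \<open>\<beta>\<close> in the Pieri graph.
\<close>

definition downs :: "nat list \<Rightarrow> nat list set" where
  "downs \<beta> = {\<alpha>. \<exists>i. lower_last i \<beta> = Some \<alpha>}"

lemma lower_last_append_Cons:
  "Suc i \<notin> set y \<Longrightarrow> lower_last i (x @ Suc i # y) = Some (x @ (if i = 0 then y else i # y))"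
  by (induction x) (auto simp: lower_last_eq_None[THEN iffD2])

lemma lower_last_SomeD:
  assumes "lower_last i \<beta> = Some \<alpha>"
  obtains x y where "\<beta> = x @ Suc i # y" "Suc i \<notin> set y" "\<alpha> = x @ (if i = 0 then y else i # y)"
proof -
  have "Suc i \<in> set \<beta>" using assms lower_last_eq_None[of i \<beta>] by auto
  then obtain x y where *: "\<beta> = x @ Suc i # y" "Suc i \<notin> set y" by (meson split_list_last)
  with assms lower_last_append_Cons[OF *(2), of x] that show ?thesis by auto
qed

lemma lower_last_append_left:
  assumes "Suc i \<notin> set y" "lower_last i x = Some x'"
  shows "lower_last i (x @ y) = Some (x' @ y)"
proof -
  from assms(2) obtain a b where "x = a @ Suc i # b" "Suc i \<notin> set b" "x' = a @ (if i = 0 then b else i # b)"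
    by (rule lower_last_SomeD)
  then show ?thesis using assms(1) lower_last_append_Cons[of i "b @ y" a] by simp
qed

lemma lower_last_count:
  assumes "lower_last i \<beta> = Some \<alpha>"
  shows "count_list \<alpha> p + of_bool (p = Suc i) = count_list \<beta> p + of_bool (i \<noteq> 0 \<and> p = i)"
  using assms by (elim lower_last_SomeD) auto

lemma lower_last_keeps_part: "lower_last i \<beta> = Some \<alpha> \<Longrightarrow> p \<in> set \<beta> \<Longrightarrow> p \<noteq> Suc i \<Longrightarrow> p \<in> set \<alpha>"
  by (elim lower_last_SomeD) auto

lemma lower_last_nth:
  assumes "lower_last i \<beta> = Some \<alpha>" "0 < i"
  shows "length \<alpha> = length \<beta>" "\<alpha> ! k \<le> \<beta> ! k" "\<beta> ! k \<noteq> Suc i \<Longrightarrow> \<alpha> ! k = \<beta> ! k"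
  using assms by (auto elim!: lower_last_SomeD simp: nth_append nth_Cons split: nat.splits)

lemma lower_last_0_length: "lower_last 0 \<beta> = Some \<alpha> \<Longrightarrow> length \<beta> = Suc (length \<alpha>)"
  by (elim lower_last_SomeD) auto

lemma in_downsI: "lower_last i \<beta> = Some \<alpha> \<Longrightarrow> \<alpha> \<in> downs \<beta>"
  by (auto simp: downs_def)

text \<open>
  If the largest part \<open>M\<close> of \<open>\<beta>\<close> exceeds all parts of \<open>\<beta>'\<close>, no lower neighbour contains \<open>M\<close>. This is only
  possible if \<open>\<beta>\<close> consists of the single part \<open>M\<close>, whose only lower neighbour consists of \<open>M - 1\<close>; for
  \<open>M \<ge> 3\<close> no other composition has this as its only lower neighbour.
\<close>

lemma Max_le_if_downs_eq:
  assumes "\<beta> \<in> compositions" "\<beta>' \<in> compositions" "sum_list \<beta> = sum_list \<beta>'" "3 \<le> sum_list \<beta>"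
    and D: "downs \<beta> = downs \<beta>'"
  shows "Max (set \<beta>) \<le> Max (set \<beta>')"
proof (rule ccontr)
  define M M' where "M = Max (set \<beta>)" and "M' = Max (set \<beta>')"
  assume "\<not> ?thesis"
  then have less: "M' < M" by (simp add: M_def M'_def)
  have "sum_list \<beta> \<noteq> 0" "sum_list \<beta>' \<noteq> 0" using assms(3,4) by linarith+
  then have ne: "\<beta> \<noteq> []" "\<beta>' \<noteq> []" by (metis sum_list.Nil)+
  have M: "M \<in> set \<beta>" and M': "M' \<in> set \<beta>'" using ne by (auto simp: M_def M'_def)
  have small: "M \<notin> set \<delta>" if "\<delta> \<in> downs \<beta>" for \<delta>
  proof
    assume "M \<in> set \<delta>"
    from that D obtain i where i: "lower_last i \<beta>' = Some \<delta>" by (auto simp: downs_def)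
    have "p \<le> M'" if "p \<in> set \<beta>'" for p using that by (simp add: M'_def)
    with i have "\<forall>p\<in>set \<delta>. p \<le> M'" by (elim lower_last_SomeD) (auto split: if_splits intro: Suc_leD)
    with \<open>M \<in> set \<delta>\<close> less show False by auto
  qed
  obtain i where i: "M = Suc i" using less by (cases M) auto
  have all: "p = M" if "p \<in> set \<beta>" for p
  proof (rule ccontr)
    assume "p \<noteq> M"
    have "0 < p" using that assms(1) by (simp add: compositions_def)
    then obtain q where q: "p = Suc q" by (cases p) auto
    with that obtain \<delta> where "lower_last q \<beta> = Some \<delta>" using lower_last_SomeE by metis
    then show False using small[OF in_downsI] lower_last_keeps_part[OF _ M] \<open>p \<noteq> M\<close> q by metis
  qed
  obtain \<delta> where \<delta>: "lower_last i \<beta> = Some \<delta>" using M i lower_last_SomeE by metis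
  then obtain x y where xy: "\<beta> = x @ Suc i # y" "Suc i \<notin> set y" "\<delta> = x @ (if i = 0 then y else i # y)"
    by (rule lower_last_SomeD)
  have "y = []" using all xy i by (cases y) auto
  moreover have "x = []" using all small[OF in_downsI[OF \<delta>]] xy i by (cases x) auto
  ultimately have b: "\<beta> = [M]" "\<delta> = [M - 1]" "3 \<le> M" using xy i assms by (auto split: if_splits)
  have "0 < M'" using M' assms(2) by (simp add: compositions_def)
  then obtain i' where i': "M' = Suc i'" by (meson gr0_implies_Suc)
  obtain \<delta>' where \<delta>': "lower_last i' \<beta>' = Some \<delta>'" using M' i' lower_last_SomeE by metis
  then have "\<delta>' \<in> downs \<beta>" using D in_downsI by blast
  then obtain j where j: "lower_last j \<beta> = Some \<delta>'" by (auto simp: downs_def)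
  then have "\<delta>' = [M - 1]" using b by (auto split: if_splits)
  moreover obtain x' y' where xy': "\<beta>' = x' @ Suc i' # y'" "\<delta>' = x' @ (if i' = 0 then y' else i' # y')"
    using \<delta>' by (rule lower_last_SomeD)
  moreover have "p \<le> M'" if "p \<in> set \<beta>'" for p using that by (simp add: M'_def)
  ultimately have d': "\<delta>' = [M - 1]" and xy': "\<beta>' = x' @ Suc i' # y'" "\<delta>' = x' @ (if i' = 0 then y' else i' # y')"
    and le': "\<And>p. p \<in> set \<beta>' \<Longrightarrow> p \<le> M'" by auto
  show False
  proof (cases "i' = 0")
    case True
    then have "M - 1 \<in> set (x' @ y')" using d' xy'(2) by simp
    then have "M - 1 \<le> M'" using le' xy'(1) by auto
    then show False using b i' True by simp
  next
    case False
    then have "x' @ i' # y' = [M - 1]" using d' xy'(2) by simp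
    then have "i' = M - 1" by (auto simp: append_eq_Cons_conv)
    then show False using b i' less by simp
  qed
qed

text \<open>
  Lowering another part instead would not change the number of maximal parts, and this cannot happen
  on both sides at once.
\<close>

lemma lowering_max_eq_if_downs_eq:
  assumes "\<beta> \<in> compositions" "\<beta>' \<in> compositions" "sum_list \<beta> = sum_list \<beta>'" "3 \<le> sum_list \<beta>"
    and D: "downs \<beta> = downs \<beta>'"
  obtains i \<gamma> where "Suc i = Max (set \<beta>)" "Suc i = Max (set \<beta>')" "lower_last i \<beta> = Some \<gamma>" "lower_last i \<beta>' = Some \<gamma>"
proof -
  have MM: "Max (set \<beta>) = Max (set \<beta>')"
    using Max_le_if_downs_eq[OF assms] Max_le_if_downs_eq[OF assms(2,1)] assms by simp
  have "sum_list \<beta> \<noteq> 0" "sum_list \<beta>' \<noteq> 0" using assms(3,4) by linarith+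
  then have ne: "\<beta> \<noteq> []" "\<beta>' \<noteq> []" by (metis sum_list.Nil)+
  then have M: "Max (set \<beta>) \<in> set \<beta>" "Max (set \<beta>) \<in> set \<beta>'" unfolding MM[symmetric] using MM by (auto intro: Max_in) (metis List.finite_set Max_in set_empty)
  then have "0 < Max (set \<beta>)" using assms(1) by (simp add: compositions_def)
  then obtain i where i: "Max (set \<beta>) = Suc i" by (meson gr0_implies_Suc)
  obtain \<gamma> where \<gamma>: "lower_last i \<beta> = Some \<gamma>" using M i lower_last_SomeE by metis
  obtain \<gamma>' where \<gamma>': "lower_last i \<beta>' = Some \<gamma>'" using M i lower_last_SomeE by metis
  obtain t where t: "lower_last t \<beta>' = Some \<gamma>" using in_downsI[OF \<gamma>] D by (auto simp: downs_def)
  obtain t' where t': "lower_last t' \<beta> = Some \<gamma>'" using in_downsI[OF \<gamma>'] D by (auto simp: downs_def)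
  have le: "Suc t \<le> Suc i" "Suc t' \<le> Suc i"
    using t t' lower_last_eq_None[of t \<beta>'] lower_last_eq_None[of t' \<beta>] unfolding i[symmetric]
    by (auto simp: MM) (metis List.finite_set Max_ge MM option.distinct(1))
  \<comment> \<open>counting the parts equal to the maximum in \<open>\<gamma>\<close> and \<open>\<gamma>'\<close>\<close>
  have "t = i"
  proof (rule ccontr)
    assume "t \<noteq> i"
    have "t' \<noteq> i" using \<gamma> \<gamma>' t t' lower_last_index_unique \<open>t \<noteq> i\<close> by fastforce
    then show False
      using lower_last_count[OF \<gamma>, of "Suc i"] lower_last_count[OF \<gamma>', of "Suc i"]
        lower_last_count[OF t, of "Suc i"] lower_last_count[OF t', of "Suc i"] le \<open>t \<noteq> i\<close> by simp
  qed
  then show ?thesis using that[of i \<gamma>] i MM \<gamma> t by simp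
qed

text \<open>
  Compositions with the same result when a maximal part is lowered differ by exchanging a part \<open>i\<close>
  with a part \<open>i + 1\<close>. Lowering a part \<open>i\<close> keeps the exchanged positions apart unless \<open>i = 1\<close>, when parts
  are deleted. Then all parts are 1 or 2, and comparing the results of deleting the last 1 leaves
  just the exchange at the very end.
\<close>

lemma ambiguous_pair_aux:
  assumes D: "downs \<beta> = downs \<beta>'"
    and b: "\<beta> = x @ Suc i # z @ i # y" "\<beta>' = x @ i # z @ Suc i # y"
    and i: "0 < i" and z: "\<forall>p\<in>set (x @ z @ y). 0 < p \<and> p \<le> Suc i" "Suc i \<notin> set z" "Suc i \<notin> set y"
  shows "\<exists>v. set v \<subseteq> {1, 2} \<and> \<beta> = v @ [2, 1] \<and> \<beta>' = v @ [1, 2]"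
proof -
  have len: "length \<beta> = length \<beta>'" using b by simp
  have nx: "\<beta> ! length x = Suc i" "\<beta>' ! length x = i" using b by auto
  have cnt: "count_list \<beta> (Suc i) = count_list \<beta>' (Suc i)" using b by simp
  obtain j where j: "i = Suc j" using i by (cases i) auto
  then obtain \<delta> where \<delta>: "lower_last j \<beta> = Some \<delta>" using b lower_last_SomeE[of j \<beta>] by auto
  obtain t where t: "lower_last t \<beta>' = Some \<delta>" using in_downsI[OF \<delta>] D by (auto simp: downs_def)
  \<comment> \<open>Otherwise \<open>\<delta>\<close> has \<open>i + 1\<close> at position \<open>length x\<close>, where \<open>\<beta>'\<close> has only \<open>i\<close>.\<close>
  have "j = 0"
  proof (rule ccontr)
    assume j0: "j \<noteq> 0"
    have "t \<noteq> i" using lower_last_count[OF \<delta>, of "Suc i"] lower_last_count[OF t, of "Suc i"] cnt j by auto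
    moreover have "t \<noteq> 0" using lower_last_0_length[of \<beta>' \<delta>] t len lower_last_nth(1)[OF \<delta>] j0
      by (cases t) auto
    ultimately have "\<delta> ! length x \<le> i" using lower_last_nth(2)[OF t, of "length x"] nx by simp
    moreover have "\<delta> ! length x = Suc i" using lower_last_nth(3)[OF \<delta>, of "length x"] j0 nx j by simp
    ultimately show False by simp
  qed
  with j have i1: "i = 1" by simp
  have ones: "replicate (length w) 1 = w" if "w = z \<or> w = y" for w
  proof -
    have "p = 1" if "p \<in> set w" for p
    proof -
      have "0 < p \<and> p \<le> Suc i \<and> p \<noteq> Suc i" using that z \<open>w = z \<or> w = y\<close> by auto
      then show ?thesis using i1 by linarith
    qed
    then show ?thesis by (metis replicate_eqI)
  qed
  define a c where "a = length z" and "c = length y"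
  have zy: "z = replicate a 1" "y = replicate c 1" using ones by (auto simp: a_def c_def)
  have b': "\<beta> = x @ 2 # replicate (a + c) 1 @ [1]" "\<beta>' = x @ 1 # replicate a 1 @ 2 # replicate c 1"
    using b i1 zy by (auto simp: replicate_add replicate_append_same numeral_2_eq_2)
  have "lower_last 0 ((x @ 2 # replicate (a + c) 1) @ Suc 0 # []) = Some (x @ 2 # replicate (a + c) 1)"
    by (subst lower_last_append_Cons) auto
  then have \<delta>_eq: "\<delta> = x @ 2 # replicate (a + c) 1" using \<delta> b' \<open>j = 0\<close> by simp
  have t0: "t = 0" using lower_last_nth(1)[OF t] len lower_last_0_length[of \<beta> \<delta>] \<delta> \<open>j = 0\<close> by auto
  have "c = 0"
  proof (rule ccontr)
    assume "c \<noteq> 0"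
    then obtain c' where c: "c = Suc c'" by (cases c) auto
    have "\<beta>' = (x @ 1 # replicate a 1 @ 2 # replicate c' 1) @ Suc 0 # []"
      using b' c by (simp add: replicate_append_same)
    then have "lower_last 0 \<beta>' = Some (x @ 1 # replicate a 1 @ 2 # replicate c' 1)"
      using lower_last_append_Cons[of 0 "[]" "x @ 1 # replicate a 1 @ 2 # replicate c' 1"] by simp
    with t t0 \<delta>_eq show False by simp
  qed
  have "\<beta>' = (x @ replicate a 1) @ Suc 0 # [2]" using b' \<open>c = 0\<close> by (simp add: replicate_append_same)
  then have "lower_last 0 \<beta>' = Some (x @ replicate a 1 @ [2])"
    using lower_last_append_Cons[of 0 "[2]" "x @ replicate a 1"] by simp
  with t t0 \<delta>_eq \<open>c = 0\<close> have "replicate a 1 @ [2 :: nat] = 2 # replicate a 1" by simp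
  then have "a = 0" by (cases a) auto
  have "p \<in> {1, 2}" if "p \<in> set x" for p
  proof -
    have "0 < p \<and> p \<le> Suc i" using z(1) that by auto
    then have "p = 1 \<or> p = 2" using i1 by linarith
    then show ?thesis by simp
  qed
  then show ?thesis using b' \<open>a = 0\<close> \<open>c = 0\<close> by (intro exI[of _ x]) auto
qed

text \<open>
  The lower neighbours determine a composition up to one family of exceptions.
\<close>

lemma ambiguous_pair:
  assumes "\<beta> \<in> compositions" "\<beta>' \<in> compositions" "sum_list \<beta> = sum_list \<beta>'" "3 \<le> sum_list \<beta>"
    and D: "downs \<beta> = downs \<beta>'" and neq: "\<beta> \<noteq> \<beta>'"
  shows "\<exists>v. set v \<subseteq> {1, 2} \<and> (\<beta> = v @ [2, 1] \<and> \<beta>' = v @ [1, 2] \<or> \<beta> = v @ [1, 2] \<and> \<beta>' = v @ [2, 1])"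
proof -
  obtain i \<gamma> where i: "Suc i = Max (set \<beta>)" "Suc i = Max (set \<beta>')"
    and \<gamma>: "lower_last i \<beta> = Some \<gamma>" "lower_last i \<beta>' = Some \<gamma>"
    using lowering_max_eq_if_downs_eq[OF assms(1-5)] by metis
  have le: "p \<le> Suc i \<and> 0 < p" if "p \<in> set \<beta> \<union> set \<beta>'" for p
    using that assms(1,2) i Max_ge[of "set \<beta>" p] Max_ge[of "set \<beta>'" p] by (auto simp: compositions_def)
  obtain x y where xy: "\<beta> = x @ Suc i # y" "Suc i \<notin> set y" "\<gamma> = x @ (if i = 0 then y else i # y)"
    using \<gamma>(1) by (rule lower_last_SomeD)
  obtain x' y' where xy': "\<beta>' = x' @ Suc i # y'" "Suc i \<notin> set y'" "\<gamma> = x' @ (if i = 0 then y' else i # y')"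
    using \<gamma>(2) by (rule lower_last_SomeD)
  have "0 < i"
  proof (rule ccontr)
    assume "\<not> 0 < i"
    then have "\<forall>p\<in>set \<beta>. p = 1" "\<forall>p\<in>set \<beta>'. p = 1" using le by fastforce+
    then have r: "\<beta> = replicate (length \<beta>) 1" "\<beta>' = replicate (length \<beta>') 1"
      by (metis replicate_eqI)+
    have "sum_list \<beta> = length \<beta>" by (subst r(1)) (simp add: sum_list_replicate)
    moreover have "sum_list \<beta>' = length \<beta>'" by (subst r(2)) (simp add: sum_list_replicate)
    ultimately have "length \<beta> = length \<beta>'" using assms(3) by simp
    then show False using neq r by simp
  qed
  then have eq: "x @ i # y = x' @ i # y'" using xy xy' by simp
  then consider us where "x = x' @ us" "us @ i # y = i # y'" | us where "x @ us = x'" "i # y = us @ i # y'"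
    by (auto simp: append_eq_append_conv2)
  then show ?thesis
  proof cases
    case 1
    show ?thesis
    proof (cases us)
      case Nil
      then show ?thesis using 1 xy xy' neq by simp
    next
      case (Cons u z)
      then have "u = i" "y' = z @ i # y" "x = x' @ i # z" using 1 by auto
      then have "\<exists>v. set v \<subseteq> {1, 2} \<and> \<beta>' = v @ [2, 1] \<and> \<beta> = v @ [1, 2]"
        using xy xy' \<open>0 < i\<close> le by (intro ambiguous_pair_aux[of _ _ x' i z y] D[symmetric]) auto
      then show ?thesis by blast
    qed
  next
    case 2
    show ?thesis
    proof (cases us)
      case Nil
      then show ?thesis using 2 xy xy' neq by simp
    next
      case (Cons u z)
      then have "u = i" "y = z @ i # y'" "x' = x @ i # z" using 2 by auto
      then have "\<exists>v. set v \<subseteq> {1, 2} \<and> \<beta> = v @ [2, 1] \<and> \<beta>' = v @ [1, 2]"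
        using xy xy' \<open>0 < i\<close> le by (intro ambiguous_pair_aux[of _ _ x i z y'] D) auto
      then show ?thesis by blast
    qed
  qed
qed

lemma compositions_sum_2: "\<beta> \<in> compositions \<Longrightarrow> sum_list \<beta> = 2 \<Longrightarrow> \<beta> = [2] \<or> \<beta> = [1, 1]"
  by (cases \<beta>; cases "tl \<beta>"; cases "tl (tl \<beta>)") (auto simp: compositions_def)

lemma pieri_up_3: "pieri_up [3] \<subseteq> {[4], [1, 3], [3, 1]}"
proof
  fix \<gamma> assume "\<gamma> \<in> pieri_up [3]"
  then obtain i where "lower_last i \<gamma> = Some [3]" by (auto simp: pieri_up_def)
  then obtain x y where xy: "\<gamma> = x @ Suc i # y" "[3] = x @ (if i = 0 then y else i # y)"
    by (rule lower_last_SomeD)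
  then show "\<gamma> \<in> {[4], [1, 3], [3, 1]}"
    by (cases "i = 0"; cases x) (auto simp: Cons_eq_append_conv)
qed

lemma downs_eq_111:
  assumes "\<gamma> \<in> compositions" "downs \<gamma> = {[1, 1]}"
  shows "\<gamma> = [1, 1, 1]"
proof -
  have "p = 1" if p: "p \<in> set \<gamma>" for p
  proof (rule ccontr)
    assume "p \<noteq> 1"
    have "0 < p" using p assms(1) by (simp add: compositions_def)
    then obtain i where i: "p = Suc i" "i \<noteq> 0" using \<open>p \<noteq> 1\<close> by (cases p) simp_all
    then obtain \<delta> where \<delta>: "lower_last i \<gamma> = Some \<delta>" using p lower_last_SomeE by metis
    then have d: "\<delta> = [1, 1]" using in_downsI assms(2) by blast
    then obtain x y where xy: "\<gamma> = x @ Suc i # y" "[1, 1] = x @ i # y"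
      using \<delta> i by (elim lower_last_SomeD) auto
    then have "1 \<in> set \<gamma>" by (auto simp: Cons_eq_append_conv)
    then obtain \<delta>' where \<delta>': "lower_last 0 \<gamma> = Some \<delta>'" using lower_last_SomeE[of 0 \<gamma>] by auto
    then have "\<delta>' = [1, 1]" using in_downsI assms(2) by blast
    then show False using lower_last_index_unique[OF \<delta>] \<delta>' d i by simp
  qed
  then have r: "\<gamma> = replicate (length \<gamma>) 1" by (metis replicate_eqI)
  obtain i where "lower_last i \<gamma> = Some [1, 1]" using assms(2) by (auto simp: downs_def)
  then have "sum_list \<gamma> = 3" by (auto dest: lower_last_sum_list)
  moreover have "sum_list \<gamma> = length \<gamma>" by (subst r) (simp add: sum_list_replicate)
  ultimately show ?thesis using r by (simp add: numeral_3_eq_3)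
qed

text \<open>
  Once all smaller compositions are fixed, a composition keeps its lower neighbours. In size 2 the
  two compositions have the same lower neighbour but are separated by the numbers of upper
  neighbours of \<open>(3)\<close> and \<open>(1, 1, 1)\<close>. In larger sizes only the exceptional pairs remain, and they are
  separated by looking one level up.
\<close>

lemma pieri_graph_rigid:
  assumes bij: "bij_betw \<sigma> compositions compositions"
    and size: "\<And>\<alpha>. \<alpha> \<in> compositions \<Longrightarrow> sum_list (\<sigma> \<alpha>) = sum_list \<alpha>"
    and up: "\<And>\<alpha>. \<alpha> \<in> compositions \<Longrightarrow> pieri_up (\<sigma> \<alpha>) = \<sigma> ` pieri_up \<alpha>"
  shows "\<alpha> \<in> compositions \<Longrightarrow> \<sigma> \<alpha> = \<alpha>"
proof (induction "sum_list \<alpha>" arbitrary: \<alpha> rule: less_induct)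
  case less
  have \<sigma>: "\<sigma> \<alpha> \<in> compositions" if "\<alpha> \<in> compositions" for \<alpha> using bij that by (auto simp: bij_betw_def)
  have inj: "\<sigma> \<alpha> = \<sigma> \<beta> \<Longrightarrow> \<alpha> = \<beta>" if "\<alpha> \<in> compositions" "\<beta> \<in> compositions" for \<alpha> \<beta>
    using bij that by (auto simp: bij_betw_def inj_on_def)
  have downs_comp: "\<alpha> \<in> compositions" if "\<alpha> \<in> downs \<beta>" "\<beta> \<in> compositions" for \<alpha> \<beta>
    using that lower_last_compositions by (auto simp: downs_def)
  have up_iff: "\<beta> \<in> pieri_up \<alpha> \<longleftrightarrow> \<alpha> \<in> downs \<beta>" if "\<beta> \<in> compositions" for \<alpha> \<beta>
    using that by (auto simp: downs_def pieri_up_def)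
  have downs_image: "downs (\<sigma> \<beta>) = \<sigma> ` downs \<beta>" if \<beta>: "\<beta> \<in> compositions" for \<beta>
  proof (intro equalityI subsetI)
    fix \<alpha>' assume a: "\<alpha>' \<in> downs (\<sigma> \<beta>)"
    then have "\<alpha>' \<in> compositions" using downs_comp \<sigma>[OF \<beta>] by blast
    then obtain \<alpha> where \<alpha>: "\<alpha> \<in> compositions" "\<alpha>' = \<sigma> \<alpha>" using bij by (auto simp: bij_betw_def)
    then have "\<sigma> \<beta> \<in> \<sigma> ` pieri_up \<alpha>" using a up[OF \<alpha>(1)] up_iff[OF \<sigma>[OF \<beta>]] by blast
    then obtain \<beta>' where "\<beta>' \<in> pieri_up \<alpha>" "\<sigma> \<beta> = \<sigma> \<beta>'" by blast
    then have "\<beta> \<in> pieri_up \<alpha>" using inj[OF \<beta>, of \<beta>'] by (auto simp: pieri_up_def)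
    then show "\<alpha>' \<in> \<sigma> ` downs \<beta>" using up_iff[OF \<beta>] \<alpha> by blast
  next
    fix \<alpha>' assume "\<alpha>' \<in> \<sigma> ` downs \<beta>"
    then obtain \<alpha> where \<alpha>: "\<alpha> \<in> downs \<beta>" "\<alpha>' = \<sigma> \<alpha>" by blast
    then have "\<sigma> \<beta> \<in> pieri_up \<alpha>'" using up[OF downs_comp[OF \<alpha>(1) \<beta>]] up_iff[OF \<beta>] by blast
    then show "\<alpha>' \<in> downs (\<sigma> \<beta>)" using up_iff[OF \<sigma>[OF \<beta>]] by blast
  qed
  consider "sum_list \<alpha> \<le> 1" | "sum_list \<alpha> = 2" | "3 \<le> sum_list \<alpha>" by linarith
  then show ?case
  proof cases
    case 1
    have rep: "\<beta> = replicate (sum_list \<beta>) 1" if "\<beta> \<in> compositions" "sum_list \<beta> \<le> 1" for \<beta>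
      using that by (cases \<beta>; cases "tl \<beta>") (auto simp: compositions_def le_Suc_eq)
    have "\<sigma> \<alpha> = replicate (sum_list \<alpha>) 1"
      using rep[OF \<sigma>[OF less.prems]] 1 size[OF less.prems] by simp
    then show ?thesis using rep[OF less.prems 1] by simp
  next
    case 2
    show ?thesis
    proof (rule ccontr)
      assume neq: "\<sigma> \<alpha> \<noteq> \<alpha>"
      have c: "[2] \<in> compositions" "[1, 1] \<in> compositions" "[3] \<in> compositions" by (auto simp: compositions_def)
      have "\<sigma> [2] = [2] \<or> \<sigma> [2] = [1, 1]" "\<sigma> [1, 1] = [2] \<or> \<sigma> [1, 1] = [1, 1]" "\<alpha> = [2] \<or> \<alpha> = [1, 1]"
        using compositions_sum_2[OF \<sigma>[OF c(1)]] compositions_sum_2[OF \<sigma>[OF c(2)]]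
          compositions_sum_2[OF less.prems 2] size[OF c(1)] size[OF c(2)] by simp_all
      \<comment> \<open>then \<open>[3]\<close> would go to \<open>[1, 1, 1]\<close>, which has four upper neighbours instead of three\<close>
      then have s2: "\<sigma> [2] = [1, 1]" using neq inj[OF c(1,2)] by auto
      have "downs [3] = {[2]}" by (auto simp: downs_def split: if_splits intro!: exI[of _ 2])
      then have "downs (\<sigma> [3]) = {[1, 1]}" using downs_image[OF c(3)] s2 by simp
      then have "\<sigma> [3] = [1, 1, 1]" using downs_eq_111 \<sigma>[OF c(3)] by blast
      then have "pieri_up [1, 1, 1] = \<sigma> ` pieri_up [3]" using up[OF c(3)] by simp
      then have "card (pieri_up [1, 1, 1]) \<le> card (pieri_up [3])" using card_image_le[OF finite_pieri_up] by simp
      also have "\<dots> \<le> card {[4], [1, 3], [3, 1 :: nat]}" by (rule card_mono[OF _ pieri_up_3]) simp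
      also have "\<dots> = 3" by simp
      finally have "card (pieri_up [1, 1, 1]) \<le> 3" .
      moreover have "{[1, 1, 1, 1], [2, 1, 1], [1, 2, 1], [1, 1, 2]} \<subseteq> pieri_up [1, 1, 1]"
      proof -
        have "lower_last 0 [1, 1, 1, 1] = Some [1, 1, 1]" "lower_last 1 [2, 1, 1] = Some [1, 1, 1]"
          "lower_last 1 [1, 2, 1] = Some [1, 1, 1]" "lower_last 1 [1, 1, 2] = Some [1, 1, 1]" by auto
        then show ?thesis unfolding pieri_up_def compositions_def by auto
      qed
      then have "card {[1, 1, 1, 1], [2, 1, 1], [1, 2, 1], [1, 1, 2 :: nat]} \<le> card (pieri_up [1, 1, 1])"
        by (rule card_mono[OF finite_pieri_up])
      ultimately show False by simp
    qed
  next
    case 3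
    show ?thesis
    proof (rule ccontr)
      assume neq: "\<sigma> \<alpha> \<noteq> \<alpha>"
      have same: "downs (\<sigma> \<beta>) = downs \<beta>" if \<beta>: "\<beta> \<in> compositions" "sum_list \<beta> = sum_list \<alpha>" for \<beta>
      proof -
        have "\<sigma> \<delta> = \<delta>" if "\<delta> \<in> downs \<beta>" for \<delta>
        proof (rule less.hyps)
          show "sum_list \<delta> < sum_list \<alpha>" using that \<beta> lower_last_sum_list by (fastforce simp: downs_def)
          show "\<delta> \<in> compositions" using that downs_comp \<beta> by blast
        qed
        then show ?thesis using downs_image[OF \<beta>(1)] by simp
      qed
      have amb: "\<exists>v. set v \<subseteq> {1, 2} \<and> (\<beta> = v @ [2, 1] \<and> \<sigma> \<beta> = v @ [1, 2] \<or> \<beta> = v @ [1, 2] \<and> \<sigma> \<beta> = v @ [2, 1])"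
        if \<beta>: "\<beta> \<in> compositions" "sum_list \<beta> = sum_list \<alpha>" "\<sigma> \<beta> \<noteq> \<beta>" for \<beta>
        using ambiguous_pair[OF \<beta>(1) \<sigma>[OF \<beta>(1)] _ _ same[OF \<beta>(1,2), symmetric] \<beta>(3)[symmetric]] size[OF \<beta>(1)] \<beta>(2) 3 by simp
      obtain v where v: "set v \<subseteq> {1, 2}" and or: "\<alpha> = v @ [2, 1] \<and> \<sigma> \<alpha> = v @ [1, 2] \<or> \<alpha> = v @ [1, 2] \<and> \<sigma> \<alpha> = v @ [2, 1]"
        using amb[OF less.prems refl neq] by blast
      have vc: "v @ w \<in> compositions" if "set w \<subseteq> {1, 2}" for w using v that by (auto simp: compositions_def)
      have sum: "sum_list \<alpha> = sum_list v + 3" using or by auto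
      have swap: "\<sigma> (v @ [2, 1]) = v @ [1, 2]"
      proof (cases "\<alpha> = v @ [2, 1]")
        case True
        then show ?thesis using or by auto
      next
        case False
        then have a: "\<alpha> = v @ [1, 2]" "\<sigma> \<alpha> = v @ [2, 1]" using or by auto
        have "\<sigma> (v @ [2, 1]) \<noteq> v @ [2, 1]" using inj[OF less.prems, of "v @ [2, 1]"] a vc[of "[2, 1]"] by auto
        then show ?thesis using amb[of "v @ [2, 1]"] vc[of "[2, 1]"] sum by auto
      qed
      \<comment> \<open>\<open>v @ [2, 1]\<close> lies below \<open>v @ [2, 2]\<close>, so \<open>v @ [1, 2]\<close> lies below \<open>\<gamma>\<close>. As it ends in 2, it does not
        arise by lowering a last part 2, which means that \<open>\<gamma>\<close> has more parts 1 than \<open>v\<close>. This number is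
        too large for the other lower neighbour of \<open>v @ [2, 2]\<close>, if there is one; otherwise \<open>\<gamma>\<close>, having
        parts 1 and 2, has too many lower neighbours.\<close>
      define \<gamma> where "\<gamma> = \<sigma> (v @ [2, 2])"
      have v22: "v @ [2, 2] \<in> compositions" by (rule vc) simp
      have d1: "lower_last 1 (v @ [2, 2]) = Some (v @ [2, 1])"
        using lower_last_append_Cons[of 1 "[]" "v @ [2]"] by (simp add: numeral_2_eq_2)
      have "v @ [1, 2] \<in> downs \<gamma>"
        unfolding \<gamma>_def downs_image[OF v22] using in_downsI[OF d1] swap by (metis imageI)
      then obtain t where t: "lower_last t \<gamma> = Some (v @ [1, 2])" by (auto simp: downs_def)
      have "t \<noteq> 1"
      proof
        assume "t = 1"
        with t obtain x y where xy: "\<gamma> = x @ 2 # y" "2 \<notin> set y" "v @ [1, 2] = x @ 1 # y"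
          by (elim lower_last_SomeD) (auto simp: numeral_2_eq_2)
        then have "last (v @ [1, 2]) = last (1 # y)" by (metis last_appendR list.distinct(1))
        then show False using xy(2) last_in_set[of y] by (cases "y = []") auto
      qed
      then have cnt: "count_list v 1 + 1 \<le> count_list \<gamma> 1"
        using lower_last_count[OF t, of 1] by simp
      show False
      proof (cases "1 \<in> set v")
        case True
        then obtain v' where v': "lower_last 0 v = Some v'" using lower_last_SomeE[of 0 v] by auto
        then have d2: "lower_last 0 (v @ [2, 2]) = Some (v' @ [2, 2])" by (intro lower_last_append_left) auto
        have c: "v' @ [2, 2] \<in> compositions" using lower_last_compositions[OF d2] v22 by simp
        have "\<sigma> (v' @ [2, 2]) = v' @ [2, 2]"
        proof (rule ccontr)
          assume "\<sigma> (v' @ [2, 2]) \<noteq> v' @ [2, 2]"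
          moreover have "sum_list (v' @ [2, 2]) = sum_list \<alpha>" using lower_last_sum_list[OF v'] sum by simp
          ultimately obtain u where "v' @ [2, 2] = u @ [2, 1] \<or> v' @ [2, 2] = u @ [1, 2]" using amb[OF c] by blast
          then show False by auto
        qed
        then have "v' @ [2, 2] \<in> downs \<gamma>"
          unfolding \<gamma>_def downs_image[OF v22] using in_downsI[OF d2] by (metis imageI)
        then obtain s where s: "lower_last s \<gamma> = Some (v' @ [2, 2])" by (auto simp: downs_def)
        show False using lower_last_count[OF s, of 1] lower_last_count[OF v', of 1] cnt
          by (auto split: if_splits simp: of_bool_def)
      next
        case False
        then have "set v \<subseteq> {2}" using v by auto
        then have "downs (v @ [2, 2]) \<subseteq> {v @ [2, 1]}"
        proof -
          have "\<delta> = v @ [2, 1]" if "lower_last i (v @ [2, 2]) = Some \<delta>" for i \<delta>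
          proof -
            have "Suc i \<in> set (v @ [2, 2])" using that lower_last_eq_None[of i "v @ [2, 2]"] by auto
            then have "i = 1" using \<open>set v \<subseteq> {2}\<close> by auto
            then show ?thesis using that d1 by simp
          qed
          then show ?thesis by (auto simp: downs_def)
        qed
        then have only: "\<delta> = v @ [1, 2]" if "\<delta> \<in> downs \<gamma>" for \<delta>
          using that swap unfolding \<gamma>_def downs_image[OF v22] by auto
        have "1 \<in> set \<gamma>" using cnt count_notin[of 1 \<gamma>] by (cases "1 \<in> set \<gamma>") auto
        then obtain \<delta>0 where d0: "lower_last 0 \<gamma> = Some \<delta>0" using lower_last_SomeE[of 0 \<gamma>] by auto
        then have l0: "lower_last 0 \<gamma> = Some (v @ [1, 2])" using only in_downsI by blast
        have "count_list \<gamma> 2 \<noteq> 0" using lower_last_count[OF l0, of 2] by simp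
        then have "2 \<in> set \<gamma>" using count_notin[of 2 \<gamma>] by (cases "2 \<in> set \<gamma>") auto
        then obtain \<delta>1 where d1': "lower_last 1 \<gamma> = Some \<delta>1" using lower_last_SomeE[of 1 \<gamma>] by (auto simp: numeral_2_eq_2)
        then have "\<delta>1 = v @ [1, 2]" using only in_downsI by blast
        then show False using lower_last_index_unique[OF l0] d1' by fastforce
      qed
    qed
  qed
qed


section \<open>Automorphisms that permute the basis\<close>

lemma graded_algebra_automorphism_if_id:
  assumes id: "\<forall>f\<in>carrier QSym. \<phi> f = f"
  shows "graded_algebra_automorphism \<phi>"
proof -
  have mult: "f \<otimes>\<^bsub>QSym\<^esub> g \<in> carrier QSym" and add: "f \<oplus>\<^bsub>QSym\<^esub> g \<in> carrier QSym"
    and smult: "c \<odot>\<^bsub>QSym\<^esub> f \<in> carrier QSym"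
    if "f \<in> carrier QSym" "g \<in> carrier QSym" for f g c
    using that QSym_set_mult QSym_set_add QSym_set_smult by (auto simp: QSym_def)
  have "\<phi> \<in> ring_hom QSym QSym"
    using id mult add QSym_one by (intro ring_hom_memI) auto
  moreover have "bij_betw \<phi> (carrier QSym) (carrier QSym)"
    using id by (auto simp: bij_betw_def inj_on_def image_iff)
  moreover have "\<phi> ` QSym_graded n \<subseteq> QSym_graded n" for n
    using id by (auto simp: QSym_graded_def)
  ultimately show ?thesis
    using id smult by (auto simp: graded_algebra_automorphism_def ring_iso_def)
qed

lemma automorphism_linear:
  assumes \<phi>: "graded_algebra_automorphism \<phi>" and C: "finite C"
  shows "(\<lambda>m. \<Sum>\<alpha>\<in>C. c \<alpha> * qschur \<alpha> m) \<in> carrier QSym \<and>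
    \<phi> (\<lambda>m. \<Sum>\<alpha>\<in>C. c \<alpha> * qschur \<alpha> m) = (\<lambda>m. \<Sum>\<alpha>\<in>C. c \<alpha> * \<phi> (qschur \<alpha>) m)"
  using C
proof (induction C)
  case empty
  have z: "(\<lambda>m. 0) \<in> carrier QSym" using QSym_set_zero by (simp add: QSym_def)
  then have "\<phi> (0 \<odot>\<^bsub>QSym\<^esub> (\<lambda>m. 0)) = 0 \<odot>\<^bsub>QSym\<^esub> \<phi> (\<lambda>m. 0)"
    using \<phi> unfolding graded_algebra_automorphism_def by blast
  with z show ?case by (simp add: QSym_def)
next
  case (insert \<alpha> C)
  let ?s = "\<lambda>m. \<Sum>\<alpha>\<in>C. c \<alpha> * qschur \<alpha> m"
  have sC: "(\<lambda>m. c \<alpha> * qschur \<alpha> m) \<in> carrier QSym"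
    using QSym_set_smult qschur_in_QSym[of \<alpha>] by (simp add: QSym_def)
  have "\<phi> (c \<alpha> \<odot>\<^bsub>QSym\<^esub> qschur \<alpha>) = c \<alpha> \<odot>\<^bsub>QSym\<^esub> \<phi> (qschur \<alpha>)"
    using \<phi> qschur_in_QSym[of \<alpha>] unfolding graded_algebra_automorphism_def by blast
  then have s: "\<phi> (\<lambda>m. c \<alpha> * qschur \<alpha> m) = (\<lambda>m. c \<alpha> * \<phi> (qschur \<alpha>) m)" by (simp add: QSym_def)
  have "\<phi> \<in> ring_hom QSym QSym" using \<phi> by (simp add: graded_algebra_automorphism_def ring_iso_def)
  then have "\<phi> ((\<lambda>m. c \<alpha> * qschur \<alpha> m) \<oplus>\<^bsub>QSym\<^esub> ?s) = \<phi> (\<lambda>m. c \<alpha> * qschur \<alpha> m) \<oplus>\<^bsub>QSym\<^esub> \<phi> ?s"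
    using sC conjunct1[OF insert.IH] by (rule ring_hom_add)
  then have "\<phi> (\<lambda>m. c \<alpha> * qschur \<alpha> m + ?s m) = (\<lambda>m. c \<alpha> * \<phi> (qschur \<alpha>) m + \<phi> ?s m)"
    by (simp add: s QSym_def)
  moreover have "(\<lambda>m. c \<alpha> * qschur \<alpha> m + ?s m) \<in> carrier QSym"
    using sC insert.IH QSym_set_add by (simp add: QSym_def)
  ultimately show ?case using insert by simp
qed

text \<open>
  Applying \<open>\<phi>\<close> to the Pieri rule shows that the induced permutation of compositions is an
  automorphism of the Pieri graph.
\<close>

lemma automorphism_fixes_qschur:
  assumes \<phi>: "graded_algebra_automorphism \<phi>" and basis: "\<phi> ` qschur_basis = qschur_basis"
    and "\<alpha> \<in> compositions"
  shows "\<phi> (qschur \<alpha>) = qschur \<alpha>"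
proof -
  define \<sigma> where "\<sigma> \<alpha> = inv_into compositions qschur (\<phi> (qschur \<alpha>))" for \<alpha>
  have hom: "\<phi> \<in> ring_hom QSym QSym" and inj: "inj_on \<phi> (carrier QSym)"
    using \<phi> by (auto simp: graded_algebra_automorphism_def ring_iso_def bij_betw_def)
  have \<sigma>: "\<sigma> \<alpha> \<in> compositions" "qschur (\<sigma> \<alpha>) = \<phi> (qschur \<alpha>)" if "\<alpha> \<in> compositions" for \<alpha>
  proof -
    have "\<phi> (qschur \<alpha>) \<in> qschur ` compositions" using basis that by (auto simp: qschur_basis_def)
    then show "\<sigma> \<alpha> \<in> compositions" "qschur (\<sigma> \<alpha>) = \<phi> (qschur \<alpha>)"
      unfolding \<sigma>_def by (rule inv_into_into, rule f_inv_into_f)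
  qed
  have inj_\<sigma>: "inj_on \<sigma> compositions"
  proof (rule inj_onI)
    fix \<alpha> \<beta> assume c: "\<alpha> \<in> compositions" "\<beta> \<in> compositions" "\<sigma> \<alpha> = \<sigma> \<beta>"
    then have "\<phi> (qschur \<alpha>) = \<phi> (qschur \<beta>)" using \<sigma> by metis
    then have "qschur \<alpha> = qschur \<beta>" using inj qschur_in_QSym by (auto dest: inj_onD)
    then show "\<alpha> = \<beta>" using inj_on_qschur c by (auto dest: inj_onD)
  qed
  have "\<beta> \<in> \<sigma> ` compositions" if "\<beta> \<in> compositions" for \<beta>
  proof -
    have "qschur \<beta> \<in> \<phi> ` qschur_basis" using basis that by (auto simp: qschur_basis_def)
    then obtain \<alpha> where \<alpha>: "\<alpha> \<in> compositions" "qschur \<beta> = \<phi> (qschur \<alpha>)" by (auto simp: qschur_basis_def)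
    then have "qschur \<beta> = qschur (\<sigma> \<alpha>)" using \<sigma>(2) by simp
    then have "\<beta> = \<sigma> \<alpha>" using inj_on_qschur that \<sigma>(1)[OF \<alpha>(1)] by (auto dest: inj_onD)
    then show ?thesis using \<alpha> by blast
  qed
  then have bij: "bij_betw \<sigma> compositions compositions"
    using inj_\<sigma> \<sigma>(1) by (auto simp: bij_betw_def)
  have size: "sum_list (\<sigma> \<alpha>) = sum_list \<alpha>" if "\<alpha> \<in> compositions" for \<alpha>
  proof -
    have "\<phi> (qschur \<alpha>) \<in> QSym_graded (sum_list \<alpha>)"
      using \<phi> qschur_graded[of \<alpha>] unfolding graded_algebra_automorphism_def by blast
    then have "qschur (\<sigma> \<alpha>) \<in> QSym_graded (sum_list \<alpha>)" using \<sigma>(2)[OF that] by simp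
    then show ?thesis
      using qschur_pack_self[of "\<sigma> \<alpha>"] mono_degree_pack[of "\<sigma> \<alpha>"] by (auto simp: QSym_graded_def)
  qed
  have "\<sigma> [1] = [1]"
  proof -
    have c: "[1] \<in> compositions" by (simp add: compositions_def)
    have "\<sigma> [1] \<in> compositions" "sum_list (\<sigma> [1]) = 1" using \<sigma>(1)[OF c] size[OF c] by simp_all
    then show ?thesis by (cases "\<sigma> [1]"; cases "tl (\<sigma> [1])") (auto simp: compositions_def)
  qed
  then have box: "\<phi> (qschur [1]) = qschur [1]" using \<sigma>(2)[of "[1]"] by (simp add: compositions_def)
  have up: "pieri_up (\<sigma> \<alpha>) = \<sigma> ` pieri_up \<alpha>" if a: "\<alpha> \<in> compositions" for \<alpha>
  proof (rule sum_qschur_eq_imp_eq)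
    have uc: "pieri_up \<alpha> \<subseteq> compositions" for \<alpha> by (auto simp: pieri_up_def)
    show "pieri_up (\<sigma> \<alpha>) \<subseteq> compositions" "finite (pieri_up (\<sigma> \<alpha>))" "finite (\<sigma> ` pieri_up \<alpha>)"
      by (auto simp: uc finite_pieri_up)
    show "\<sigma> ` pieri_up \<alpha> \<subseteq> compositions" using \<sigma>(1) uc by blast
    fix m
    have "ps_mult (qschur [1]) (qschur (\<sigma> \<alpha>)) = \<phi> (ps_mult (qschur [1]) (qschur \<alpha>))"
      using ring_hom_mult[OF hom qschur_in_QSym[of "[1]"] qschur_in_QSym[of \<alpha>]] box \<sigma>(2)[OF a]
      by (simp add: QSym_def)
    also have "\<dots> = \<phi> (\<lambda>m. \<Sum>\<beta>\<in>pieri_up \<alpha>. 1 * qschur \<beta> m)" unfolding pieri_box[OF a] by simp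
    also have "\<dots> = (\<lambda>m. \<Sum>\<beta>\<in>pieri_up \<alpha>. 1 * \<phi> (qschur \<beta>) m)"
      using conjunct2[OF automorphism_linear[OF \<phi> finite_pieri_up, where c = "\<lambda>_. 1"]] by simp
    also have "\<dots> = (\<lambda>m. \<Sum>\<beta>\<in>pieri_up \<alpha>. qschur (\<sigma> \<beta>) m)" by (auto intro!: ext sum.cong simp: \<sigma>(2)[OF subsetD[OF uc]])
    finally have "(\<Sum>\<beta>\<in>pieri_up (\<sigma> \<alpha>). qschur \<beta> m) = (\<Sum>\<beta>\<in>pieri_up \<alpha>. qschur (\<sigma> \<beta>) m)"
      unfolding pieri_box[OF \<sigma>(1)[OF a]] by (rule fun_cong)
    also have "\<dots> = (\<Sum>\<beta>\<in>\<sigma> ` pieri_up \<alpha>. qschur \<beta> m)"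
      using inj_on_subset[OF inj_\<sigma> uc] by (simp add: sum.reindex)
    finally show "(\<Sum>\<beta>\<in>pieri_up (\<sigma> \<alpha>). qschur \<beta> m) = (\<Sum>\<beta>\<in>\<sigma> ` pieri_up \<alpha>. qschur \<beta> m)" .
  qed
  have "\<sigma> \<alpha> = \<alpha>" using pieri_graph_rigid[OF bij size up] assms(3) by blast
  then show ?thesis using \<sigma>(2)[OF assms(3)] by simp
qed

theorem proposition6p2:
  fixes \<phi> :: "power_series \<Rightarrow> power_series"
  shows "graded_algebra_automorphism \<phi> \<and> \<phi> ` qschur_basis = qschur_basis \<longleftrightarrow>
    (\<forall>f\<in>carrier QSym. \<phi> f = f)"
proof
  assume \<phi>: "graded_algebra_automorphism \<phi> \<and> \<phi> ` qschur_basis = qschur_basis"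
  show "\<forall>f\<in>carrier QSym. \<phi> f = f"
  proof
    fix f assume "f \<in> carrier QSym"
    then obtain C c where C: "finite C" "C \<subseteq> compositions" and f: "f = (\<lambda>m. \<Sum>\<alpha>\<in>C. c \<alpha> * qschur \<alpha> m)"
      by (rule qschur_spans)
    have "\<phi> f = (\<lambda>m. \<Sum>\<alpha>\<in>C. c \<alpha> * \<phi> (qschur \<alpha>) m)"
      unfolding f using automorphism_linear[OF conjunct1[OF \<phi>] C(1)] by blast
    also have "\<dots> = f"
      unfolding f using automorphism_fixes_qschur \<phi> C(2) by (auto intro!: ext sum.cong)
    finally show "\<phi> f = f" .
  qed
next
  assume id: "\<forall>f\<in>carrier QSym. \<phi> f = f"
  then have "\<phi> ` qschur_basis = id ` qschur_basis"
    using qschur_in_QSym by (intro image_cong) (auto simp: qschur_basis_def)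
  then show "graded_algebra_automorphism \<phi> \<and> \<phi> ` qschur_basis = qschur_basis"
    using graded_algebra_automorphism_if_id[OF id] by simp
qed

end
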